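(* Let $\Omega\subset\mathbb R^d$ be nonempty, open and bounded, and let $\Xi\subset\overline\Omega$ be nonempty and closed. Let $\ell\colon\mathbb R_+\times\overline\Omega\times\mathbb R^d\to\mathbb R_+$ be such that: $t\mapsto\ell(t,x,p)$ is measurable for every $(x,p)$; $(x,p)\mapsto\ell(t,x,p)$ is continuous for a.e. $t$; $p\mapsto\ell(t,x,p)$ is convex for a.e. $t$ and every $x$; and there exist $\alpha>0$, $\theta>1$ with $\ell(t,x,p)\ge\alpha|p|^\theta$ for all $(t,x,p)$. Let $h\colon\mathbb R_+\times\overline\Omega\times\overline\Omega\times\mathbb R^d\times\mathbb R^d\to\mathbb R_+$ be such that: $t\mapsto h(t,x,\tilde x,p,\tilde p)$ is measurable for every $(x,\tilde x,p,\tilde p)$; $(x,\tilde x,p,\tilde p)\mapsto h(t,x,\tilde x,p,\tilde p)$ is continuous for a.e. $t$; $(p,\tilde p)\mapsto h(t,x,\tilde x,p,\tilde p)$ is convex for a.e. $t$ and every $(x,\tilde x)$; $h(t,x,\tilde x,p,\tilde p)=h(t,\tilde x,x,\tilde p,p)$ for all arguments; and there exist $C>0$ and $\beta\in(0,\theta]$ with $h(t,x,\tilde x,p,\tilde p)\le C(|p|^\beta+|\tilde p|^\beta)$ for all arguments. Let $\Psi\colon\mathbb R_+\to\mathbb R_+$ be lower semicontinuous and nondecreasing, with constants $a,b>0$ such that $\Psi(t)\ge at-b$ for all $t\ge0$. Assume there exists $\kappa>0$ such that for every $x_0\in\overline\Omega$ there exists an absolutely continuous $\gamma\in\Gamma$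 with $\gamma(0)=x_0$ and $\int_0^{+\infty}\ell(t,\gamma(t),\dot\gamma(t))\,\mathrm dt+\Psi(\tau(\gamma))\le\kappa$. Assume moreover that: (a) for every $x\in\overline\Omega$ and every sequence $(x_n)$ in $\overline\Omega$ with $x_n\to x$, one has $\mathrm d_{\mathrm{geo}}(x_n,x)\to0$, where $\mathrm d_{\mathrm{geo}}$ is the geodesic distance in $\overline\Omega$; (b) there exists $\alpha^\ast>0$ such that $\ell(t,x,p)\le\alpha^\ast|p|^\theta$ for every $(t,x,p)$, where $\theta>1$ is the same exponent as in the lower bound $\ell(t,x,p)\ge\alpha|p|^\theta$. Let $m_0\in\mathcal P(\overline\Omega)$. Then $Q\in\mathcal P(\Gamma)$ is an equilibrium of the mean field game with initial condition $m_0$ if and only if it is a strong equilibrium of the mean field game with initial condition $m_0$.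
   Context: $\mathbb R_+=[0,+\infty)$. $\Gamma=\mathcal C(\mathbb R_+;\overline\Omega)$ is the Polish space of continuous curves with uniform convergence on compact time intervals; $\mathcal P(\cdot)$ denotes Borel probability measures; $e_0(\gamma)=\gamma(0)$; ${e_0}_\#Q$ is the pushforward; $\operatorname{spt}(Q)$ is the support of $Q$ (points all of whose neighborhoods have positive $Q$-measure). "Absolutely continuous" for $\gamma\in\Gamma$ means absolutely continuous on every compact interval. The geodesic distance between two points of $\overline\Omega$ is the infimum of lengths of curves in $\overline\Omega$ joining them. Exit time: $\tau(\gamma)=\inf\{t\ge0:\gamma(t)\in\Xi\}\in[0,+\infty]$, with $\inf\emptyset=+\infty$; convention $\Psi(+\infty)=+\infty$; $s\wedge t=\min\{s,t\}$. Cost of $\gamma\in\Gamma$ given $Q\in\mathcal P(\Gamma)$: $$F(\gamma,Q)=\int_0^{+\infty}\ell(t,\gamma(t),\dot\gamma(t))\,\mathrm dt+\Psi(\tau(\gamma))+\int_\Gamma\int_0^{\tau(\gamma)\wedge\tau(\tilde\gamma)}h(t,\gamma(t),\tilde\gamma(t),\dot\gamma(t),\dot{\tilde\gamma}(t))\,\mathrm dt\,\mathrm dQ(\tilde\gamma),$$ with $F(\gamma,Q)=+\infty$ by convention if $\gamma$ is not absolutely continuous, if $Q$ gives positive measure to a set of functions which are not absolutely continuous, or if $\tilde\gamma\mapsto\int_0^{\tau(\gamma)\wedge\tau(\tilde\gamma)}h(t,\gamma(t),\tilde\gamma(t),\dot\gamma(t),\dot{\tilde\gamma}(t))\,\mathrm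 dt$ is not $Q$-integrable. Equilibrium: $Q\in\mathcal P(\Gamma)$ is an equilibrium with initial condition $m_0$ if ${e_0}_\#Q=m_0$, $\int_\Gamma F(\gamma,Q)\,\mathrm dQ(\gamma)<+\infty$, and $Q$-almost every $\gamma$ satisfies $F(\gamma,Q)=\inf\{F(\omega,Q):\omega\in\Gamma,\ \omega(0)=\gamma(0)\}$. Strong equilibrium: the same with "$Q$-almost every $\gamma$" replaced by "every $\gamma\in\operatorname{spt}(Q)$". *)

theory Defs
  imports "HOL-Probability.Probability"
begin

subsection \<open>The space of curves\<close>

text \<open>A curve is a function on the whole real line; requiring it to be \<^const>\<open>undefined\<close> at
  negative times (via \<^const>\<open>PiE\<close>) makes the correspondence with continuous functions on
  the nonnegative half-line one-to-one. In applications \<open>X\<close> is the closure of \<open>\<Omega>\<close>.\<close>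

definition curves :: "'a::euclidean_space set \<Rightarrow> (real \<Rightarrow> 'a) set" where
  "curves X = {\<gamma> \<in> {0..} \<rightarrow>\<^sub>E X. continuous_on {0..} \<gamma>}"

text \<open>Uniform convergence on compact time intervals: the sets
  \<open>{\<omega>. \<forall>t\<in>{0..T}. dist (\<omega> t) (\<gamma> t) < \<epsilon>}\<close> form a neighbourhood base at \<open>\<gamma>\<close>.\<close>

definition curve_topology :: "'a::euclidean_space set \<Rightarrow> (real \<Rightarrow> 'a) topology" where
  "curve_topology X = topology (\<lambda>U. U \<subseteq> curves X \<and>
     (\<forall>\<gamma>\<in>U. \<exists>T\<ge>0. \<exists>\<epsilon>>0. \<forall>\<omega>\<in>curves X. (\<forall>t\<in>{0..T}. dist (\<omega> t) (\<gamma> t) < \<epsilon>) \<longrightarrow> \<omega> \<in> U))"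

lemma openin_curve_topology:
  "openin (curve_topology X) U \<longleftrightarrow> U \<subseteq> curves X \<and>
     (\<forall>\<gamma>\<in>U. \<exists>T\<ge>0. \<exists>\<epsilon>>0. \<forall>\<omega>\<in>curves X. (\<forall>t\<in>{0..T}. dist (\<omega> t) (\<gamma> t) < \<epsilon>) \<longrightarrow> \<omega> \<in> U)"
proof -
  let ?nb = "\<lambda>U \<gamma> T \<epsilon>. \<forall>\<omega>\<in>curves X. (\<forall>t\<in>{0..T::real}. dist (\<omega> t) (\<gamma> t) < (\<epsilon>::real)) \<longrightarrow> \<omega> \<in> U"
  let ?L = "\<lambda>U. U \<subseteq> curves X \<and> (\<forall>\<gamma>\<in>U. \<exists>T\<ge>0. \<exists>\<epsilon>>0. ?nb U \<gamma> T \<epsilon>)"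
  have Int: "?L (S \<inter> S')" if S: "?L S" and S': "?L S'" for S S'
  proof (intro conjI ballI)
    fix \<gamma> assume "\<gamma> \<in> S \<inter> S'"
    then obtain T e T' e' where *: "T \<ge> 0" "e > 0" "?nb S \<gamma> T e" "T' \<ge> 0" "e' > 0" "?nb S' \<gamma> T' e'"
      using S[THEN conjunct2, rule_format, of \<gamma>] S'[THEN conjunct2, rule_format, of \<gamma>]
      by (elim IntE) blast
    have "?nb (S \<inter> S') \<gamma> (max T T') (min e e')" using * by (simp add: le_max_iff_disj)
    then show "\<exists>T\<ge>0. \<exists>\<epsilon>>0. ?nb (S \<inter> S') \<gamma> T \<epsilon>"
      using * by (intro exI[of _ "max T T'"] conjI exI[of _ "min e e'"]) auto
  qed (use S in auto)
  have Un: "?L (\<Union>K)" if K: "\<forall>S\<in>K. ?L S" for K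
  proof (intro conjI ballI)
    fix \<gamma> assume "\<gamma> \<in> \<Union>K"
    then obtain S where "S \<in> K" "\<gamma> \<in> S" by auto
    then obtain T e where "T \<ge> 0" "e > 0" "?nb S \<gamma> T e"
      using K[rule_format, OF \<open>S \<in> K\<close>] by blast
    then show "\<exists>T\<ge>0. \<exists>\<epsilon>>0. ?nb (\<Union>K) \<gamma> T \<epsilon>" using \<open>S \<in> K\<close> by blast
  qed (use K in auto)
  have "istopology ?L"
    unfolding istopology_def
  proof (rule conjI)
    show "\<forall>S S'. ?L S \<longrightarrow> ?L S' \<longrightarrow> ?L (S \<inter> S')" using Int by (intro allI impI)
    show "\<forall>K. (\<forall>S\<in>K. ?L S) \<longrightarrow> ?L (\<Union>K)" using Un by (intro allI impI)
  qed
  then show ?thesis unfolding curve_topology_def by (simp add: topology_inverse')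
qed

lemma topspace_curve_topology: "topspace (curve_topology X) = curves X"
proof -
  have "openin (curve_topology X) (curves X)"
    unfolding openin_curve_topology by (auto intro!: exI[of _ 0] exI[of _ 1])
  then have "curves X \<subseteq> topspace (curve_topology X)" by (rule openin_subset)
  moreover have "topspace (curve_topology X) \<subseteq> curves X"
    using openin_topspace[of "curve_topology X"] unfolding openin_curve_topology by (rule conjunct1)
  ultimately show ?thesis by (rule subset_antisym[rotated])
qed

definition curve_borel :: "'a::euclidean_space set \<Rightarrow> (real \<Rightarrow> 'a) measure" where
  "curve_borel X = sigma (curves X) {U. openin (curve_topology X) U}"

definition curve_support :: "'a::euclidean_space set \<Rightarrow> (real \<Rightarrow> 'a) measure \<Rightarrow> (real \<Rightarrow> 'a) set" where
  "curve_support X Q = {\<gamma> \<in> curves X. \<forall>U. openin (curve_topology X) U \<and> \<gamma> \<in> U \<longrightarrow> emeasure Q U > 0}"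


subsection \<open>Real-analysis notions\<close>

text \<open>The usual \<open>\<epsilon>\<close>-\<open>\<delta>\<close> definition; a \<^const>\<open>division_of\<close> is a finite family of
  compact intervals with pairwise disjoint interiors.\<close>

definition abs_continuous_on :: "real \<Rightarrow> real \<Rightarrow> (real \<Rightarrow> 'a::euclidean_space) \<Rightarrow> bool" where
  "abs_continuous_on a b f \<longleftrightarrow>
     (\<forall>\<epsilon>>0. \<exists>\<delta>>0. \<forall>D S. D division_of S \<and> S \<subseteq> {a..b} \<and> (\<Sum>K\<in>D. Sup K - Inf K) < \<delta> \<longrightarrow>
        (\<Sum>K\<in>D. norm (f (Sup K) - f (Inf K))) < \<epsilon>)"

definition abs_continuous_curve :: "(real \<Rightarrow> 'a::euclidean_space) \<Rightarrow> bool" where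
  "abs_continuous_curve \<gamma> \<longleftrightarrow> (\<forall>a b. 0 \<le> a \<and> a \<le> b \<longrightarrow> abs_continuous_on a b \<gamma>)"

definition curve_length :: "(real \<Rightarrow> 'a::euclidean_space) \<Rightarrow> ennreal" where
  "curve_length g =
     (SUP (n, s) \<in> {(n::nat, s::nat \<Rightarrow> real). mono s \<and> range s \<subseteq> {0..1}}.
        \<Sum>i<n. ennreal (dist (g (s i)) (g (s (Suc i)))))"

definition geodesic_dist :: "'a::euclidean_space set \<Rightarrow> 'a \<Rightarrow> 'a \<Rightarrow> ennreal" where
  "geodesic_dist X x y =
     (INF g \<in> {g. path g \<and> path_image g \<subseteq> X \<and> pathstart g = x \<and> pathfinish g = y}. curve_length g)"

definition lower_semicontinuous_on :: "real set \<Rightarrow> (real \<Rightarrow> real) \<Rightarrow> bool" where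
  "lower_semicontinuous_on S f \<longleftrightarrow>
     (\<forall>x\<in>S. \<forall>y<f x. eventually (\<lambda>z. y < f z) (at x within S))"


subsection \<open>The mean field game\<close>

text \<open>With values in \<^typ>\<open>ennreal\<close>, the infimum of the empty set is \<open>\<infinity>\<close>.\<close>

definition exit_time :: "'a::euclidean_space set \<Rightarrow> (real \<Rightarrow> 'a) \<Rightarrow> ennreal" where
  "exit_time \<Xi> \<gamma> = (INF t \<in> {t. 0 \<le> t \<and> \<gamma> t \<in> \<Xi>}. ennreal t)"

definition exit_cost :: "(real \<Rightarrow> real) \<Rightarrow> ennreal \<Rightarrow> ennreal" where
  "exit_cost \<Psi> s = (if s = \<infinity> then \<infinity> else ennreal (\<Psi> (enn2real s)))"

text \<open>The velocity of an absolutely continuous curve exists at almost every time; elsewhere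
  \<^const>\<open>vector_derivative\<close> is an unspecified value, which does not influence the integrals.\<close>

abbreviation velocity :: "(real \<Rightarrow> 'a::euclidean_space) \<Rightarrow> real \<Rightarrow> 'a" where
  "velocity \<gamma> t \<equiv> vector_derivative \<gamma> (at t)"

definition running_cost :: "(real \<Rightarrow> 'a \<Rightarrow> 'a \<Rightarrow> real) \<Rightarrow> (real \<Rightarrow> 'a::euclidean_space) \<Rightarrow> ennreal" where
  "running_cost l \<gamma> = (\<integral>\<^sup>+t\<in>{0..}. ennreal (l t (\<gamma> t) (velocity \<gamma> t)) \<partial>lebesgue)"

definition interaction ::
  "'a::euclidean_space set \<Rightarrow> (real \<Rightarrow> 'a \<Rightarrow> 'a \<Rightarrow> 'a \<Rightarrow> 'a \<Rightarrow> real) \<Rightarrow> (real \<Rightarrow> 'a) \<Rightarrow> (real \<Rightarrow> 'a) \<Rightarrow> ennreal" where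
  "interaction \<Xi> h \<gamma> \<omega> =
     (\<integral>\<^sup>+t\<in>{t. 0 \<le> t \<and> ennreal t \<le> min (exit_time \<Xi> \<gamma>) (exit_time \<Xi> \<omega>)}.
        ennreal (h t (\<gamma> t) (\<omega> t) (velocity \<gamma> t) (velocity \<omega> t)) \<partial>lebesgue)"

text \<open>Integrability of the \<^typ>\<open>ennreal\<close>-valued interaction term means that it is measurable
  with finite integral; the library's \<^const>\<open>integrable\<close> applies only to Banach-space-valued
  functions.\<close>

definition mfg_cost ::
  "'a::euclidean_space set \<Rightarrow> (real \<Rightarrow> 'a \<Rightarrow> 'a \<Rightarrow> real) \<Rightarrow>
   (real \<Rightarrow> 'a \<Rightarrow> 'a \<Rightarrow> 'a \<Rightarrow> 'a \<Rightarrow> real) \<Rightarrow> (real \<Rightarrow> real) \<Rightarrow>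
   (real \<Rightarrow> 'a) \<Rightarrow> (real \<Rightarrow> 'a) measure \<Rightarrow> ennreal" where
  "mfg_cost \<Xi> l h \<Psi> \<gamma> Q =
     (if abs_continuous_curve \<gamma> \<and> (AE \<omega> in Q. abs_continuous_curve \<omega>) \<and>
         interaction \<Xi> h \<gamma> \<in> borel_measurable Q \<and> (\<integral>\<^sup>+\<omega>. interaction \<Xi> h \<gamma> \<omega> \<partial>Q) < \<infinity>
      then running_cost l \<gamma> + exit_cost \<Psi> (exit_time \<Xi> \<gamma>) + (\<integral>\<^sup>+\<omega>. interaction \<Xi> h \<gamma> \<omega> \<partial>Q)
      else \<infinity>)"

definition optimal_curve ::
  "'a::euclidean_space set \<Rightarrow> 'a set \<Rightarrow> (real \<Rightarrow> 'a \<Rightarrow> 'a \<Rightarrow> real) \<Rightarrow>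
   (real \<Rightarrow> 'a \<Rightarrow> 'a \<Rightarrow> 'a \<Rightarrow> 'a \<Rightarrow> real) \<Rightarrow> (real \<Rightarrow> real) \<Rightarrow>
   (real \<Rightarrow> 'a) measure \<Rightarrow> (real \<Rightarrow> 'a) \<Rightarrow> bool" where
  "optimal_curve X \<Xi> l h \<Psi> Q \<gamma> \<longleftrightarrow>
     mfg_cost \<Xi> l h \<Psi> \<gamma> Q = (INF \<omega> \<in> {\<omega> \<in> curves X. \<omega> 0 = \<gamma> 0}. mfg_cost \<Xi> l h \<Psi> \<omega> Q)"

definition mfg_equilibrium ::
  "'a::euclidean_space set \<Rightarrow> 'a set \<Rightarrow> (real \<Rightarrow> 'a \<Rightarrow> 'a \<Rightarrow> real) \<Rightarrow>
   (real \<Rightarrow> 'a \<Rightarrow> 'a \<Rightarrow> 'a \<Rightarrow> 'a \<Rightarrow> real) \<Rightarrow> (real \<Rightarrow> real) \<Rightarrow>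
   'a measure \<Rightarrow> (real \<Rightarrow> 'a) measure \<Rightarrow> bool" where
  "mfg_equilibrium X \<Xi> l h \<Psi> m0 Q \<longleftrightarrow>
     Q \<in> space (prob_algebra (curve_borel X)) \<and>
     distr Q (restrict_space borel X) (\<lambda>\<gamma>. \<gamma> 0) = m0 \<and>
     (\<integral>\<^sup>+\<gamma>. mfg_cost \<Xi> l h \<Psi> \<gamma> Q \<partial>Q) < \<infinity> \<and>
     (AE \<gamma> in Q. optimal_curve X \<Xi> l h \<Psi> Q \<gamma>)"

definition mfg_strong_equilibrium ::
  "'a::euclidean_space set \<Rightarrow> 'a set \<Rightarrow> (real \<Rightarrow> 'a \<Rightarrow> 'a \<Rightarrow> real) \<Rightarrow>
   (real \<Rightarrow> 'a \<Rightarrow> 'a \<Rightarrow> 'a \<Rightarrow> 'a \<Rightarrow> real) \<Rightarrow> (real \<Rightarrow> real) \<Rightarrow>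
   'a measure \<Rightarrow> (real \<Rightarrow> 'a) measure \<Rightarrow> bool" where
  "mfg_strong_equilibrium X \<Xi> l h \<Psi> m0 Q \<longleftrightarrow>
     Q \<in> space (prob_algebra (curve_borel X)) \<and>
     distr Q (restrict_space borel X) (\<lambda>\<gamma>. \<gamma> 0) = m0 \<and>
     (\<integral>\<^sup>+\<gamma>. mfg_cost \<Xi> l h \<Psi> \<gamma> Q \<partial>Q) < \<infinity> \<and>
     (\<forall>\<gamma>\<in>curve_support X Q. optimal_curve X \<Xi> l h \<Psi> Q \<gamma>)"

end

theory Submission
  imports Defs
begin

text \<open>
  A strong equilibrium is an equilibrium because the topology of the space of curves has a countable base, so
  that the support carries full measure.

  Conversely, let \<open>\<gamma>\<close> be in the support of an equilibrium \<open>Q\<close>. It is a locally uniform limit of optimal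
  curves \<open>\<gamma>\<^sub>n\<close>. The cost is lower semicontinuous along \<open>\<gamma>\<^sub>n\<close>, since the velocities have bounded
  \<open>L\<^sup>\<theta>\<close> norms and the integrands are convex in them. A competitor \<open>\<omega>\<close> of \<open>\<gamma>\<close> is turned into a competitor of
  \<open>\<gamma>\<^sub>n\<close> without shifting time, on which the costs depend in a merely measurable way: join \<open>\<gamma>\<^sub>n 0\<close> to \<open>\<gamma> 0\<close> by a
  path of length less than \<open>L\<close> during \<open>[0, L]\<close>, run through \<open>\<omega>\<close> on \<open>[0, 2L]\<close> at double speed, and follow \<open>\<omega>\<close>
  from time \<open>2L\<close> on. By the upper growth bounds the additional cost vanishes as \<open>L\<close> tends to \<open>0\<close>, and the exit
  time does not increase as soon as \<open>2L\<close> lies below the exit time of \<open>\<omega>\<close>.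

  This fails if \<open>\<gamma> 0 \<in> \<Xi>\<close>, because \<open>\<Psi>\<close> may jump at \<open>0\<close>. In that case \<open>\<gamma>\<^sub>n\<close> is compared with curves
  which rest at \<open>\<gamma>\<^sub>n 0\<close> or at \<open>\<gamma> 0\<close>. This shows that the energies of \<open>\<gamma>\<^sub>n\<close> tend to \<open>0\<close>; hence \<open>\<gamma>\<close> is constant and
  therefore optimal.
\<close>

subsection \<open>Absolutely continuous functions\<close>

text \<open>Moreover \<open>mfg_cost\<close> is infinite if the interaction term is not measurable,
  so a competitor is of use only once measurability is known; this rests on the velocity being
  jointly measurable in curve and time.

  Double speed makes up for the time \<open>L\<close> spent on the joining path within another
  \<open>L\<close>. On \<open>[0, 2L]\<close> the detour has energy at most \<open>L\<close> plus
  \<open>2 powr \<theta>\<close> times the energy of \<omega> there, hence little. Exit times are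
  merely lower semicontinuous in the curve; this is enough for the limit because \<Psi> is
  nondecreasing and the interaction is a nonnegative quantity.

  If \<open>\<gamma> 0 \<in> \<Xi>\<close>, a curve \<open>\<gamma>\<^sub>n\<close> that starts
  outside \<Xi> exits at a positive time and pays at least the right limit of \<Psi> at
  \<open>0\<close>, whereas competitors of \<gamma> pay \<open>\<Psi> 0\<close> on exit. The detour
  into \<open>\<gamma> 0\<close> costs no more than that right limit in the limit, so the terminal
  parts of the two bounds cancel and only the energy is left to be small.\<close>

definition variation :: "(real \<Rightarrow> 'a::euclidean_space) \<Rightarrow> real \<Rightarrow> real \<Rightarrow> ennreal" where
  "variation f u v = (SUP (n, s) \<in> {(n::nat, s::nat \<Rightarrow> real). mono s \<and> range s \<subseteq> {u..v}}.
        \<Sum>i<n. ennreal (dist (f (s i)) (f (s (Suc i)))))"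

text \<open>One notion serves two purposes: the arc length of the paths that join initial points,
  and the monotone majorant of an absolutely continuous function.\<close>

lemma curve_length_eq_variation: "curve_length g = variation g 0 1"
  by (simp add: curve_length_def variation_def)

lemma variation_upper:
  "mono s \<Longrightarrow> range s \<subseteq> {u..v} \<Longrightarrow> (\<Sum>i<n. ennreal (dist (f (s i)) (f (s (Suc i))))) \<le> variation f u v"
  unfolding variation_def by (rule SUP_upper2[of "(n, s)"]) auto

lemma variation_least:
  "(\<And>n s. mono s \<Longrightarrow> range s \<subseteq> {u..v} \<Longrightarrow> (\<Sum>i<n. ennreal (dist (f (s i)) (f (s (Suc i))))) \<le> c) \<Longrightarrow>
    variation f u v \<le> c"
  unfolding variation_def by (rule SUP_least) auto

lemma dist_le_variation:
  assumes "u \<le> v"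
  shows "ennreal (dist (f u) (f v)) \<le> variation f u v"
proof -
  let ?s = "\<lambda>i::nat. if i = 0 then u else v"
  have "(\<Sum>i<1. ennreal (dist (f (?s i)) (f (?s (Suc i))))) \<le> variation f u v"
    using assms by (intro variation_upper) (auto simp: mono_def)
  then show ?thesis by simp
qed

lemma variation_mono: "u' \<le> u \<Longrightarrow> v \<le> v' \<Longrightarrow> variation f u v \<le> variation f u' v'"
  by (rule variation_least, rule variation_upper) (auto intro: order_trans)

lemma variation_subadditive:
  assumes "u \<le> v" "v \<le> w"
  shows "variation f u w \<le> variation f u v + variation f v w"
proof (rule variation_least)
  fix n and s :: "nat \<Rightarrow> real" assume s: "mono s" "range s \<subseteq> {u..w}"
  \<comment> \<open>Clipping at \<open>v\<close> yields a partition on either side. A step that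
    straddles \<open>v\<close> is split there by the triangle inequality; any other step survives in
    one of the two and degenerates in the other.\<close>
  let ?p = "\<lambda>i. min (s i) v" and ?q = "\<lambda>i. max (s i) v"
  have "(\<Sum>i<n. ennreal (dist (f (s i)) (f (s (Suc i))))) \<le>
    (\<Sum>i<n. ennreal (dist (f (?p i)) (f (?p (Suc i)))) + ennreal (dist (f (?q i)) (f (?q (Suc i)))))"
  proof (rule sum_mono)
    fix i
    have le: "s i \<le> s (Suc i)" using s(1) by (simp add: mono_def)
    have "dist (f (s i)) (f (s (Suc i))) \<le>
      dist (f (?p i)) (f (?p (Suc i))) + dist (f (?q i)) (f (?q (Suc i)))"
    proof (cases "s (Suc i) \<le> v \<or> v \<le> s i")
      case True
      then show ?thesis using le by (auto simp: min_def max_def)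
    next
      case False
      then show ?thesis using dist_triangle[of "f (s i)" "f (s (Suc i))" "f v"]
        by (auto simp: min_def max_def)
    qed
    then show "ennreal (dist (f (s i)) (f (s (Suc i)))) \<le>
      ennreal (dist (f (?p i)) (f (?p (Suc i)))) + ennreal (dist (f (?q i)) (f (?q (Suc i))))"
      by (metis ennreal_leI ennreal_plus zero_le_dist)
  qed
  also have "\<dots> \<le> variation f u v + variation f v w"
    unfolding sum.distrib
    using s assms by (intro add_mono variation_upper) (force simp: mono_def min_def max_def image_subset_iff)+
  finally show "(\<Sum>i<n. ennreal (dist (f (s i)) (f (s (Suc i))))) \<le> variation f u v + variation f v w" .
qed

lemma variation_superadditive:
  assumes "u \<le> v" "v \<le> w"
  shows "variation f u v + variation f v w \<le> variation f u w"
proof -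
  define A where "A = (\<lambda>u v. {(n::nat, s::nat \<Rightarrow> real). mono s \<and> range s \<subseteq> {u..v}})"
  define \<phi> where "\<phi> = (\<lambda>(n::nat, s::nat \<Rightarrow> real). \<Sum>i<n. ennreal (dist (f (s i)) (f (s (Suc i)))))"
  have V: "variation f u v = (SUP x\<in>A u v. \<phi> x)" for u v by (simp add: variation_def A_def \<phi>_def)
  have ne: "A u v \<noteq> {}" "A v w \<noteq> {}"
    using assms by (auto simp: A_def mono_def intro!: exI[of _ "\<lambda>_. v"])
  have add: "\<phi> x + \<phi> y \<le> variation f u w" if xy: "x \<in> A u v" "y \<in> A v w" for x y
  proof -
    obtain n s m r where x: "x = (n, s)" and y: "y = (m, r)" by (cases x, cases y) auto
    have s: "mono s" "\<And>i. s i \<in> {u..v}" and r: "mono r" "\<And>i. r i \<in> {v..w}"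
      using xy by (auto simp: A_def x y image_subset_iff)
    \<comment> \<open>The partitions are concatenated. Of the \<open>n + Suc m\<close> steps the one
      from \<open>s n\<close> to \<open>r 0\<close> belongs to neither; it is nonnegative and gets
      dropped.\<close>
    let ?t = "\<lambda>i. if i \<le> n then s i else r (i - Suc n)"
    have sr: "s i \<le> r j" for i j using s(2)[of i] r(2)[of j] by auto
    have split: "(\<Sum>i<n + k. g i) = (\<Sum>i<n. g i) + (\<Sum>i<k. g (n + i))" for k and g :: "nat \<Rightarrow> ennreal"
      by (induction k) (auto simp: ac_simps)
    have "\<phi> x + \<phi> y \<le> (\<Sum>i<n + Suc m. ennreal (dist (f (?t i)) (f (?t (Suc i)))))"
      unfolding split sum.lessThan_Suc_shift by (simp add: \<phi>_def x y add.assoc add_left_mono)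
    also have "\<dots> \<le> variation f u w"
    proof (rule variation_upper)
      show "mono ?t" using s(1) r(1) sr unfolding mono_def by (auto intro: sr)
      show "range ?t \<subseteq> {u..w}"
        using s(2) r(2) assms by (auto simp: image_subset_iff intro: order_trans)
    qed
    finally show ?thesis .
  qed
  have "\<phi> x + variation f v w \<le> variation f u w" if "x \<in> A u v" for x
    unfolding V[of v w] add.commute[of "\<phi> x"] ennreal_SUP_add_left[OF ne(2), symmetric]
    using add[OF that] by (intro SUP_least) (simp add: add.commute)
  then show ?thesis
    unfolding V[of u v] ennreal_SUP_add_left[OF ne(1), symmetric] by (intro SUP_least)
qed

section \<open>Partitions as divisions into intervals\<close>

lemma partition_division:
  fixes s :: "nat \<Rightarrow> real" and n :: nat and f :: "real \<Rightarrow> 'a::euclidean_space"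
  assumes s: "mono s" "range s \<subseteq> {u..v}"
  defines "D \<equiv> (\<lambda>i. {s i..s (Suc i)}) ` {i. i < n \<and> s i < s (Suc i)}"
  shows "D division_of \<Union>D" "\<Union>D \<subseteq> {u..v}" "\<And>K. K \<in> D \<Longrightarrow> interior K \<noteq> {}"
    "(\<Sum>i<n. dist (f (s i)) (f (s (Suc i)))) = (\<Sum>K\<in>D. norm (f (Sup K) - f (Inf K)))"
    "u \<le> v \<Longrightarrow> (\<Sum>K\<in>D. Sup K - Inf K) \<le> v - u"
proof -
  \<comment> \<open>Only steps of positive length are kept: a repeated point contributes nothing,
    and without degenerate intervals distinct indices give distinct members of the set
    \<open>D\<close>.\<close>
  let ?I = "{i. i < n \<and> s i < s (Suc i)}"
  have le: "s i \<le> s j" if "i \<le> j" for i j using s(1) that by (simp add: mono_def)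
  have lt: "s (Suc i) \<le> s j" if "i < j" for i j using le[of "Suc i" j] that by simp
  have inj: "inj_on (\<lambda>i. {s i..s (Suc i)}) ?I"
  proof (rule inj_onI)
    fix i j assume ij: "i \<in> ?I" "j \<in> ?I" "{s i..s (Suc i)} = {s j..s (Suc j)}"
    then have "s i = s j" using Icc_eq_Icc[of "s i" "s (Suc i)" "s j" "s (Suc j)"] by auto
    then show "i = j" using ij lt[of i j] lt[of j i] by (cases i j rule: linorder_cases) auto
  qed
  show D: "D division_of \<Union>D"
  proof (rule division_ofI)
    fix K L assume "K \<in> D" "L \<in> D" and ne: "K \<noteq> L"
    then obtain i j where K: "K = {s i..s (Suc i)}" and L: "L = {s j..s (Suc j)}" by (auto simp: D_def)
    then have "i \<noteq> j" using ne by auto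
    then show "interior K \<inter> interior L = {}"
      using lt[of i j] lt[of j i] by (cases i j rule: linorder_cases) (auto simp: K L)
  qed (auto simp: D_def cbox_interval)
  show "\<Union>D \<subseteq> {u..v}"
  proof
    fix x assume "x \<in> \<Union>D"
    then obtain i where "s i \<le> x" "x \<le> s (Suc i)" by (auto simp: D_def)
    moreover have "u \<le> s i" "s (Suc i) \<le> v" using s(2) by (auto simp: image_subset_iff)
    ultimately show "x \<in> {u..v}" by auto
  qed
  show "interior K \<noteq> {}" if "K \<in> D" for K using that by (auto simp: D_def)
  have red: "(\<Sum>i<n. g (s i) (s (Suc i))) = (\<Sum>K\<in>D. g (Inf K) (Sup K))"
    if g: "\<And>x. g x x = 0" for g :: "real \<Rightarrow> real \<Rightarrow> real"
  proof -
    have "(\<Sum>K\<in>D. g (Inf K) (Sup K)) = (\<Sum>i\<in>?I. g (s i) (s (Suc i)))"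
      unfolding D_def by (subst sum.reindex[OF inj]) (auto intro!: sum.cong)
    also have "\<dots> = (\<Sum>i<n. g (s i) (s (Suc i)))"
    proof (rule sum.mono_neutral_left)
      show "\<forall>i\<in>{..<n} - ?I. g (s i) (s (Suc i)) = 0"
      proof
        fix i assume "i \<in> {..<n} - ?I"
        then have "s i = s (Suc i)" using le[of i "Suc i"] by auto
        then show "g (s i) (s (Suc i)) = 0" using g by simp
      qed
    qed auto
    finally show ?thesis by simp
  qed
  show "(\<Sum>i<n. dist (f (s i)) (f (s (Suc i)))) = (\<Sum>K\<in>D. norm (f (Sup K) - f (Inf K)))"
    using red[of "\<lambda>x y. dist (f x) (f y)"] by (simp add: dist_norm norm_minus_commute)
  assume "u \<le> v"
  have "(\<Sum>K\<in>D. Sup K - Inf K) = (\<Sum>i<n. s (Suc i) - s i)" using red[of "\<lambda>x y. y - x"] by simp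
  also have "\<dots> = s n - s 0" by (simp add: sum_lessThan_telescope)
  also have "\<dots> \<le> v - u" using s(2) by (auto simp: image_subset_iff intro: diff_mono)
  finally show "(\<Sum>K\<in>D. Sup K - Inf K) \<le> v - u" .
qed

text \<open>One index is treated at a time; the summand \<open>e\<close> collects the terms already
  chosen, so that the induction hypothesis applies to the remaining ones.\<close>

lemma sum_SUP_le:
  fixes \<phi> :: "'k \<Rightarrow> 'x \<Rightarrow> ennreal"
  assumes "finite D" "\<And>K. K \<in> D \<Longrightarrow> A K \<noteq> {}"
    "\<And>x. (\<And>K. K \<in> D \<Longrightarrow> x K \<in> A K) \<Longrightarrow> e + (\<Sum>K\<in>D. \<phi> K (x K)) \<le> c"
  shows "e + (\<Sum>K\<in>D. SUP x\<in>A K. \<phi> K x) \<le> c"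
  using assms
proof (induction D arbitrary: e rule: finite_induct)
  case empty
  then show ?case by simp
next
  case (insert K0 D)
  have "\<phi> K0 x0 + (e + (\<Sum>K\<in>D. SUP x\<in>A K. \<phi> K x)) \<le> c" if x0: "x0 \<in> A K0" for x0
  proof -
    have "(\<phi> K0 x0 + e) + (\<Sum>K\<in>D. SUP x\<in>A K. \<phi> K x) \<le> c"
    proof (rule insert.IH)
      fix x assume x: "\<And>K. K \<in> D \<Longrightarrow> x K \<in> A K"
      have "(\<Sum>K\<in>D. \<phi> K (if K = K0 then x0 else x K)) = (\<Sum>K\<in>D. \<phi> K (x K))"
        using insert.hyps by (intro sum.cong) auto
      moreover have "(if K = K0 then x0 else x K) \<in> A K" if "K \<in> insert K0 D" for K
        using x x0 that by auto
      ultimately show "\<phi> K0 x0 + e + (\<Sum>K\<in>D. \<phi> K (x K)) \<le> c"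
        using insert.prems(2)[of "\<lambda>K. if K = K0 then x0 else x K"] insert.hyps
        by (simp add: ac_simps)
    qed (use insert.prems in auto)
    then show ?thesis by (simp add: ac_simps)
  qed
  then have "(SUP x\<in>A K0. \<phi> K0 x) + (e + (\<Sum>K\<in>D. SUP x\<in>A K. \<phi> K x)) \<le> c"
    using insert.prems(1)[of K0] by (subst ennreal_SUP_add_left[symmetric]) (auto intro: SUP_least)
  then show ?case using insert.hyps by (simp add: ac_simps)
qed

text \<open>Nonempty interiors guarantee that the refinements of different intervals share no
  member, since such a member would have an interior disjoint from itself. Hence the sum over the
  union splits.\<close>

lemma sum_division_Union:
  fixes g :: "real set \<Rightarrow> 'b::comm_monoid_add" and D :: "real set set"
  assumes D: "D division_of S" and F: "\<And>K. K \<in> D \<Longrightarrow> F K division_of \<Union>(F K)"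
    "\<And>K. K \<in> D \<Longrightarrow> \<Union>(F K) \<subseteq> K" "\<And>K J. K \<in> D \<Longrightarrow> J \<in> F K \<Longrightarrow> interior J \<noteq> {}"
  shows "(\<Union>K\<in>D. F K) division_of \<Union>(\<Union>K\<in>D. F K)" "\<Union>(\<Union>K\<in>D. F K) \<subseteq> S"
    "(\<Sum>J\<in>(\<Union>K\<in>D. F K). g J) = (\<Sum>K\<in>D. \<Sum>J\<in>F K. g J)"
proof -
  have sub: "J \<subseteq> K" if "K \<in> D" "J \<in> F K" for J K using F(2)[OF that(1)] that(2) by auto
  have disj: "interior J \<inter> interior J' = {}" if "K \<in> D" "K' \<in> D" "K \<noteq> K'" "J \<in> F K" "J' \<in> F K'" for J J' K K'
    using division_ofD(5)[OF D that(1,2,3)] sub[of K J] sub[of K' J'] that interior_mono by blast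
  show "(\<Union>K\<in>D. F K) division_of \<Union>(\<Union>K\<in>D. F K)"
  proof (rule division_ofI)
    show "finite (\<Union>K\<in>D. F K)" using D F(1) by (auto dest: division_ofD(1))
    fix J assume "J \<in> (\<Union>K\<in>D. F K)"
    then obtain K where K: "K \<in> D" "J \<in> F K" by auto
    then show "J \<subseteq> \<Union>(\<Union>K\<in>D. F K)" "J \<noteq> {}" "\<exists>a b. J = cbox a b"
      using division_ofD(3,4)[OF F(1)[OF K(1)] K(2)] by blast+
    fix J' assume "J' \<in> (\<Union>K\<in>D. F K)" and ne: "J \<noteq> J'"
    then obtain K' where K': "K' \<in> D" "J' \<in> F K'" by auto
    show "interior J \<inter> interior J' = {}"
      using disj[OF K(1) K'(1) _ K(2) K'(2)] division_ofD(5)[OF F(1)[OF K(1)] K(2)] K'(2) ne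
      by (cases "K = K'") auto
  qed auto
  show "\<Union>(\<Union>K\<in>D. F K) \<subseteq> S" using sub division_ofD(2)[OF D] by blast
  show "(\<Sum>J\<in>(\<Union>K\<in>D. F K). g J) = (\<Sum>K\<in>D. \<Sum>J\<in>F K. g J)"
  proof (rule sum.UNION_disjoint)
    show "finite D" "\<forall>K\<in>D. finite (F K)" using D F(1) by (auto dest: division_ofD(1))
    show "\<forall>K\<in>D. \<forall>K'\<in>D. K \<noteq> K' \<longrightarrow> F K \<inter> F K' = {}"
      using disj F(3) by (metis disjoint_iff_not_equal inf.idem)
  qed
qed

lemma division_interval:
  assumes "D division_of S" "K \<in> D"
  shows "K = {Inf K..Sup K}" "Inf K \<le> (Sup K :: real)"
proof -
  obtain u v where "K = cbox u v" "K \<noteq> {}" using division_ofD(3,4)[OF assms] by blast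
  then show "K = {Inf K..Sup K}" "Inf K \<le> (Sup K :: real)" by auto
qed

text \<open>Subdividing the members of a division and keeping the proper pieces gives a division of
  no greater total length, to which the same \<open>\<delta>\<close> applies. The suprema over all
  subdivisions turn the strict bound into a weak one.\<close>

lemma abs_continuous_on_variation:
  fixes f :: "real \<Rightarrow> 'a::euclidean_space"
  assumes "abs_continuous_on a b f" "\<epsilon> > 0"
  obtains \<delta> where "\<delta> > 0"
    "\<And>D S. D division_of S \<Longrightarrow> S \<subseteq> {a..b} \<Longrightarrow> (\<Sum>K\<in>D. Sup K - Inf K) < \<delta> \<Longrightarrow>
      (\<Sum>K\<in>D. variation f (Inf K) (Sup K)) \<le> ennreal \<epsilon>"
proof -
  obtain \<delta> where \<delta>: "\<delta> > 0" and ac: "\<And>D S. D division_of S \<Longrightarrow> S \<subseteq> {a..b} \<Longrightarrow> (\<Sum>K\<in>D. Sup K - Inf K) < \<delta> \<Longrightarrow>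
        (\<Sum>K\<in>D. norm (f (Sup K) - f (Inf K))) < \<epsilon>"
    using assms unfolding abs_continuous_on_def by meson
  have "(\<Sum>K\<in>D. variation f (Inf K) (Sup K)) \<le> ennreal \<epsilon>"
    if D: "D division_of S" and S: "S \<subseteq> {a..b}" and small: "(\<Sum>K\<in>D. Sup K - Inf K) < \<delta>" for D S
  proof -
    have "0 + (\<Sum>K\<in>D. variation f (Inf K) (Sup K)) \<le> ennreal \<epsilon>"
      unfolding variation_def
    proof (rule sum_SUP_le)
      show "finite D" using D by (rule division_ofD(1))
      show "{(n::nat, s::nat \<Rightarrow> real). mono s \<and> range s \<subseteq> {Inf K..Sup K}} \<noteq> {}" if "K \<in> D" for K
        using division_interval(2)[OF D that] by (auto simp: mono_def intro!: exI[of _ "\<lambda>_. Inf K"])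
      fix x assume x: "\<And>K. K \<in> D \<Longrightarrow> x K \<in> {(n::nat, s::nat \<Rightarrow> real). mono s \<and> range s \<subseteq> {Inf K..Sup K}}"
      define F where "F K = (\<lambda>i. {snd (x K) i..snd (x K) (Suc i)}) `
        {i. i < fst (x K) \<and> snd (x K) i < snd (x K) (Suc i)}" for K
      have s: "mono (snd (x K))" "range (snd (x K)) \<subseteq> {Inf K..Sup K}" if "K \<in> D" for K
        using x[OF that] by (auto simp: split_beta)
      note F = partition_division[where s = "snd (x K)" and n = "fst (x K)" and u = "Inf K"
        and v = "Sup K" for K, OF s, folded F_def]
      have F2: "\<Union> (F K) \<subseteq> K" if "K \<in> D" for K
        using F(2)[OF that that] unfolding division_interval(1)[OF D that, symmetric] .
      have U: "(\<Union>K\<in>D. F K) division_of \<Union>(\<Union>K\<in>D. F K)" "\<Union>(\<Union>K\<in>D. F K) \<subseteq> S"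
        "(\<Sum>J\<in>(\<Union>K\<in>D. F K). g J) = (\<Sum>K\<in>D. \<Sum>J\<in>F K. g J)" for g :: "real set \<Rightarrow> real"
        by (rule sum_division_Union[OF D]; use F(1,3) F2 in blast)+
      have "(\<Sum>J\<in>\<Union>(F ` D). Sup J - Inf J) = (\<Sum>K\<in>D. \<Sum>J\<in>F K. Sup J - Inf J)"
        by (rule U(3))
      also have "\<dots> \<le> (\<Sum>K\<in>D. Sup K - Inf K)"
        using division_interval[OF D] by (intro sum_mono F(5)) auto
      finally have "(\<Sum>J\<in>\<Union>(F ` D). Sup J - Inf J) < \<delta>" using small by simp
      then have less: "(\<Sum>J\<in>\<Union>(F ` D). norm (f (Sup J) - f (Inf J))) < \<epsilon>"
        using ac[OF U(1) order_trans[OF U(2) S]] by simp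
      have "(\<Sum>K\<in>D. case x K of (n, s) \<Rightarrow> \<Sum>i<n. ennreal (dist (f (s i)) (f (s (Suc i))))) =
        (\<Sum>K\<in>D. ennreal (\<Sum>J\<in>F K. norm (f (Sup J) - f (Inf J))))"
        by (intro sum.cong refl) (simp add: split_beta F(4)[symmetric] sum_ennreal)
      also have "\<dots> = ennreal (\<Sum>J\<in>\<Union>(F ` D). norm (f (Sup J) - f (Inf J)))"
        by (subst U(3)) (auto simp: sum_ennreal sum_nonneg)
      finally show "0 + (\<Sum>K\<in>D. case x K of (n, s) \<Rightarrow> \<Sum>i<n. ennreal (dist (f (s i)) (f (s (Suc i))))) \<le> ennreal \<epsilon>"
        using less by (simp add: ennreal_leI)
    qed
    then show ?thesis by simp
  qed
  with \<delta> that show ?thesis by blast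
qed

text \<open>The Stieltjes measure of \<open>F\<close> is absolutely continuous, and its Radon-Nikodym derivative is the
  density sought.\<close>

lemma mono_abs_continuous_density:
  fixes F :: "real \<Rightarrow> real"
  assumes mono: "\<And>x y. x \<le> y \<Longrightarrow> F x \<le> F y" and cd: "c < d"
    and const: "\<And>t. t \<le> c \<Longrightarrow> F t = F c" "\<And>t. t \<ge> d \<Longrightarrow> F t = F d"
    and ac: "\<And>\<epsilon>. \<epsilon> > 0 \<Longrightarrow> \<exists>\<delta>>0. \<forall>D S. D division_of S \<and> S \<subseteq> {c..d} \<and> (\<Sum>K\<in>D. Sup K - Inf K) < \<delta> \<longrightarrow>
        (\<Sum>K\<in>D. F (Sup K) - F (Inf K)) \<le> \<epsilon>"
  obtains g :: "real \<Rightarrow> real" where "\<And>x. 0 \<le> g x" "\<And>u v. u \<le> v \<Longrightarrow> (g has_integral (F v - F u)) {u..v}"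
proof -
  \<comment> \<open>Absolute continuity is assumed on \<open>{c..d}\<close> only; clamping the time
    moves every increment of \<open>F\<close> there.\<close>
  define cl where "cl t = max c (min d t)" for t
  have F_cl: "F (cl t) = F t" for t
    using const(1)[of t] const(2)[of t] cd by (cases "t \<le> c"; cases "d \<le> t"; simp add: cl_def)
  have cont: "continuous_on UNIV F"
    unfolding continuous_on_iff
  proof (intro ballI allI impI)
    fix x e :: real assume "e > 0"
    obtain \<delta> where \<delta>: "\<delta> > 0" "\<And>D S. D division_of S \<Longrightarrow> S \<subseteq> {c..d} \<Longrightarrow> (\<Sum>K\<in>D. Sup K - Inf K) < \<delta> \<Longrightarrow>
        (\<Sum>K\<in>D. F (Sup K) - F (Inf K)) \<le> e / 2"
      using ac[of "e / 2"] \<open>e > 0\<close> by (meson half_gt_zero)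
    have *: "F y - F x \<le> e / 2" if "x \<le> y" "y - x < \<delta>" for x y
    proof -
      have le: "cl x \<le> cl y" "cl y - cl x < \<delta>" "{cl x..cl y} \<subseteq> {c..d}"
        using that cd \<delta>(1) by (auto simp: cl_def)
      have "{{cl x..cl y}} division_of {cl x..cl y}"
        using le by (intro division_of_self[of "cl x" "cl y", unfolded cbox_interval]) auto
      then show ?thesis using \<delta>(2)[of "{{cl x..cl y}}" "{cl x..cl y}"] le by (simp add: F_cl)
    qed
    have "dist (F x') (F x) < e" if "dist x' x < \<delta>" for x'
      using *[of x x'] *[of x' x] that \<open>e > 0\<close> mono[of x x'] mono[of x' x]
      by (cases "x \<le> x'") (auto simp: dist_real_def)
    then show "\<exists>d>0. \<forall>x'\<in>UNIV. dist x' x < d \<longrightarrow> dist (F x') (F x) < e" using \<delta>(1) by auto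
  qed
  let ?\<mu> = "interval_measure F"
  have Icc: "emeasure ?\<mu> {u..v} = ennreal (F v - F u)" if "u \<le> v" for u v
    by (rule emeasure_interval_measure_Icc[OF that mono cont])
  have ac_\<mu>: "absolutely_continuous lborel ?\<mu>"
    unfolding absolutely_continuous_def
  proof
    fix N :: "real set" assume N: "N \<in> null_sets lborel"
    \<comment> \<open>\<open>F\<close> is constant outside \<open>{c..d}\<close>, so both half-lines
      carry no mass and only the part of \<open>N\<close> in between remains.\<close>
    have left: "{..c} \<in> null_sets ?\<mu>"
    proof -
      have "{c - real n..c} \<in> null_sets ?\<mu>" for n
        using const(1)[of "c - real n"] by (simp add: null_sets_def Icc)
      then have "(\<Union>n::nat. {c - real n..c}) \<in> null_sets ?\<mu>" by (rule null_sets_UN)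
      also have "(\<Union>n::nat. {c - real n..c}) = {..c}"
      proof (intro subset_antisym subsetI)
        fix x assume "x \<in> {..c}"
        moreover obtain n :: nat where "c - x \<le> real n" using real_arch_simple by blast
        ultimately have "x \<in> {c - real n..c}" by auto
        then show "x \<in> (\<Union>n::nat. {c - real n..c})" by blast
      qed auto
      finally show ?thesis .
    qed
    have right: "{d..} \<in> null_sets ?\<mu>"
    proof -
      have "{d..d + real n} \<in> null_sets ?\<mu>" for n
        using const(2)[of "d + real n"] by (simp add: null_sets_def Icc)
      then have "(\<Union>n::nat. {d..d + real n}) \<in> null_sets ?\<mu>" by (rule null_sets_UN)
      also have "(\<Union>n::nat. {d..d + real n}) = {d..}"
      proof (intro subset_antisym subsetI)
        fix x assume "x \<in> {d..}"
        moreover obtain n :: nat where "x - d \<le> real n" using real_arch_simple by blast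
        ultimately have "x \<in> {d..d + real n}" by auto
        then show "x \<in> (\<Union>n::nat. {d..d + real n})" by blast
      qed auto
      finally show ?thesis .
    qed
    have N_borel: "N \<in> sets borel" using N by auto
    let ?N = "N \<inter> {c..d}"
    have small: "emeasure ?\<mu> ?N \<le> ennreal \<epsilon>" if \<epsilon>: "\<epsilon> > 0" for \<epsilon>
    proof -
      obtain \<delta> where \<delta>: "\<delta> > 0" "\<And>D S. D division_of S \<Longrightarrow> S \<subseteq> {c..d} \<Longrightarrow> (\<Sum>K\<in>D. Sup K - Inf K) < \<delta> \<Longrightarrow>
        (\<Sum>K\<in>D. F (Sup K) - F (Inf K)) \<le> \<epsilon>"
        using ac[OF \<epsilon>] by meson
      have null: "?N \<in> null_sets lborel" using N by (auto intro: null_set_Int2)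
      then have leb: "?N \<in> sets lebesgue" by auto
      obtain T where T: "open T" "?N \<subseteq> T" "emeasure lebesgue (T - ?N) < ennreal \<delta>"
        using sets_lebesgue_outer_open[OF leb \<open>\<delta> > 0\<close>] by metis
      have null': "?N \<in> null_sets lebesgue"
        using null null_sets_completionI by blast
      have "emeasure lebesgue T = emeasure lebesgue (T - ?N)"
        using emeasure_Diff_null_set[OF null', of T] T(1) by (simp add: borel_open)
      then have T_small: "emeasure lborel T < ennreal \<delta>"
        using T(1,3) by (simp add: borel_open)
      \<comment> \<open>Every member of the covering contains a point of \<open>?N\<close>, hence of
        \<open>T\<close>, at which the gauge confines it to \<open>T\<close>; and \<open>T\<close>
        has measure below \<open>\<delta>\<close>.\<close>
      let ?g = "\<lambda>x. if x \<in> T then T else UNIV"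
      have g: "gauge ?g" using T(1) by (auto simp: gauge_def)
      have sub: "?N \<subseteq> cbox c d" "box c d \<noteq> {}" using cd by auto
      obtain \<D> where \<D>: "countable \<D>" "\<Union>\<D> \<subseteq> cbox c d"
          "\<And>K. K \<in> \<D> \<Longrightarrow> interior K \<noteq> {} \<and> (\<exists>c d. K = cbox c d)"
          "pairwise (\<lambda>A B. interior A \<inter> interior B = {}) \<D>"
          "\<And>K. K \<in> \<D> \<Longrightarrow> \<exists>x \<in> ?N \<inter> K. K \<subseteq> ?g x"
          "\<And>u v. cbox u v \<in> \<D> \<Longrightarrow> \<exists>n. \<forall>i \<in> Basis. v \<bullet> i - u \<bullet> i = (d \<bullet> i - c \<bullet> i) / 2^n"
          "?N \<subseteq> \<Union>\<D>"
        by (rule covering_lemma[OF sub g]) (rule that; assumption)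
      have KT: "K \<subseteq> T" if "K \<in> \<D>" for K using \<D>(5)[OF that] T(2) by (auto split: if_splits)
      \<comment> \<open>Absolute continuity speaks of finite families only; the bound reaches the
        countable covering by continuity of the measure from below.\<close>
      have fin: "emeasure ?\<mu> (\<Union>E) \<le> ennreal \<epsilon>" if E: "finite E" "E \<subseteq> \<D>" for E
      proof -
        have div: "E division_of \<Union>E"
        proof (rule division_ofI)
          fix K L assume "K \<in> E" "L \<in> E" "K \<noteq> L"
          then show "interior K \<inter> interior L = {}" using \<D>(4) E by (auto simp: pairwise_def)
        next
          fix K assume K: "K \<in> E"
          then have "interior K \<noteq> {}" "\<exists>a b. K = cbox a b" using \<D>(3)[of K] E by auto
          then show "K \<noteq> {}" "\<exists>a b. K = cbox a b" by auto
        qed (use E in auto)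
        note int = division_interval[OF div]
        \<comment> \<open>Members may share endpoints, so their lengths are added up through the
          disjoint interiors.\<close>
        have "(\<Sum>K\<in>E. emeasure lborel (interior K)) = emeasure lborel (\<Union>K\<in>E. interior K)"
          using E \<D>(4) by (intro sum_emeasure) (auto simp: disjoint_family_on_def pairwise_def)
        also have "\<dots> \<le> emeasure lborel T"
          using KT E T(1) interior_subset by (intro emeasure_mono) (blast, simp add: borel_open)
        finally have "(\<Sum>K\<in>E. emeasure lborel (interior K)) < ennreal \<delta>" using T_small by simp
        also have "(\<Sum>K\<in>E. emeasure lborel (interior K)) = (\<Sum>K\<in>E. ennreal (Sup K - Inf K))"
        proof (rule sum.cong[OF refl])
          fix K assume "K \<in> E"
          have "interior K = interior {Inf K..Sup K}" by (rule arg_cong[OF int(1)[OF \<open>K \<in> E\<close>]])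
          then have "interior K = {Inf K<..<Sup K}" "Inf K \<le> Sup K"
            using int(2)[OF \<open>K \<in> E\<close>] by simp_all
          then show "emeasure lborel (interior K) = ennreal (Sup K - Inf K)" by simp
        qed
        also have "\<dots> = ennreal (\<Sum>K\<in>E. Sup K - Inf K)" using int(2) by (intro sum_ennreal) auto
        finally have "(\<Sum>K\<in>E. Sup K - Inf K) < \<delta>" using \<delta>(1) by (simp add: ennreal_less_iff sum_nonneg int(2))
        then have le: "(\<Sum>K\<in>E. F (Sup K) - F (Inf K)) \<le> \<epsilon>"
          using \<delta>(2)[OF div] \<D>(2) E by (auto simp: cbox_interval)
        have "emeasure ?\<mu> (\<Union>E) \<le> (\<Sum>K\<in>E. emeasure ?\<mu> K)"
        proof -
          have "K \<in> sets borel" if "K \<in> E" for K by (subst int(1)[OF that]) simp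
          then show ?thesis using emeasure_subadditive_finite[of E id ?\<mu>] E by (auto simp: image_subset_iff)
        qed
        also have "\<dots> = (\<Sum>K\<in>E. ennreal (F (Sup K) - F (Inf K)))"
        proof (rule sum.cong[OF refl])
          fix K assume "K \<in> E"
          show "emeasure ?\<mu> K = ennreal (F (Sup K) - F (Inf K))"
            using Icc[OF int(2)[OF \<open>K \<in> E\<close>]] unfolding int(1)[OF \<open>K \<in> E\<close>, symmetric] .
        qed
        also have "\<dots> = ennreal (\<Sum>K\<in>E. F (Sup K) - F (Inf K))"
          using int(2) mono by (intro sum_ennreal) auto
        finally show ?thesis using le by (meson ennreal_leI order_trans)
      qed
      have "emeasure ?\<mu> (\<Union>\<D>) \<le> ennreal \<epsilon>"
      proof (cases "\<D> = {}")
        case False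
        have K_sets: "K \<in> sets borel" if "K \<in> \<D>" for K using \<D>(3)[OF that] by auto
        define A where "A n = \<Union>(from_nat_into \<D> ` {..n::nat})" for n
        have A_sets: "A n \<in> sets ?\<mu>" for n
          unfolding A_def using K_sets from_nat_into[OF False]
          by (intro sets.finite_Union) (auto simp: image_subset_iff)
        have "\<Union>\<D> = (\<Union>n. A n)"
          unfolding A_def using range_from_nat_into[OF False \<D>(1)] by blast
        then have "emeasure ?\<mu> (\<Union>\<D>) = (SUP n. emeasure ?\<mu> (A n))"
          using A_sets by (subst SUP_emeasure_incseq) (auto simp: A_def incseq_def intro!: Union_mono image_mono)
        also have "\<dots> \<le> ennreal \<epsilon>"
          unfolding A_def using from_nat_into[OF False] by (intro SUP_least fin) auto
        finally show ?thesis .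
      qed simp
      moreover have "emeasure ?\<mu> ?N \<le> emeasure ?\<mu> (\<Union>\<D>)"
      proof (rule emeasure_mono[OF \<D>(7)])
        have "K \<in> sets borel" if "K \<in> \<D>" for K using \<D>(3)[OF that] by auto
        then show "\<Union>\<D> \<in> sets ?\<mu>" using \<D>(1) by (simp add: sets.countable_Union subsetI)
      qed
      ultimately show ?thesis by simp
    qed
    have "emeasure ?\<mu> ?N \<le> 0"
      by (rule ennreal_le_epsilon) (unfold add_0, rule small)
    then have "?N \<in> null_sets ?\<mu>" using N_borel by (auto simp: null_sets_def)
    then have "?N \<union> {..c} \<union> {d..} \<in> null_sets ?\<mu>" using left right by auto
    then show "N \<in> null_sets ?\<mu>" by (rule null_sets_subset) (use N_borel in auto)
  qed
  obtain g where g[measurable]: "g \<in> borel_measurable lborel" and dens: "density lborel g = ?\<mu>"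
    using sigma_finite_measure.Radon_Nikodym[OF sigma_finite_lborel ac_\<mu>] by auto
  show ?thesis
  proof
    show "0 \<le> enn2real (g x)" for x by simp
    fix u v :: real assume uv: "u \<le> v"
    \<comment> \<open>The density \<open>g\<close> has extended values. Its integral over a bounded
      interval is finite, so it is finite almost everywhere there and passing to
      \<open>enn2real\<close> changes no integral.\<close>
    have int: "(\<integral>\<^sup>+x. g x * indicator {u..v} x \<partial>lborel) = ennreal (F v - F u)"
      using Icc[OF uv] unfolding dens[symmetric] by (simp add: emeasure_density)
    then have "AE x in lborel. g x * indicator {u..v} x \<noteq> \<infinity>"
      by (intro nn_integral_PInf_AE) auto
    then have "(\<integral>\<^sup>+x. ennreal (enn2real (g x) * indicator {u..v} x) \<partial>lborel) = ennreal (F v - F u)"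
      unfolding int[symmetric]
      by (intro nn_integral_cong_AE) (auto elim!: eventually_mono simp: indicator_def ennreal_enn2real less_top)
    then have "((\<lambda>x. enn2real (g x) * indicator {u..v} x) has_integral (F v - F u)) UNIV"
      using mono[OF uv] g by (intro nn_integral_has_integral) auto
    moreover have "(\<lambda>x. enn2real (g x) * indicator {u..v} x) = (\<lambda>x. if x \<in> {u..v} then enn2real (g x) else 0)"
      by auto
    ultimately show "((\<lambda>x. enn2real (g x)) has_integral (F v - F u)) {u..v}"
      by (simp only: has_integral_restrict_UNIV)
  qed
qed

section \<open>Differentiation of integrals and the fundamental theorem of calculus\<close>

lemma Lebesgue_differentiation:
  fixes g :: "real \<Rightarrow> 'a::euclidean_space"
  assumes g: "\<And>a b. g integrable_on {a..b}"
  obtains N where "negligible N"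
    "\<And>x c. x \<notin> N \<Longrightarrow> c < x \<Longrightarrow> ((\<lambda>t. integral {c..t} g) has_vector_derivative g x) (at x)"
proof -
  obtain N1 where N1: "negligible N1" "\<And>x e. x \<notin> N1 \<Longrightarrow> 0 < e \<Longrightarrow>
      \<exists>d>0. \<forall>h. 0 < h \<and> h < d \<longrightarrow> norm (integral {x..x + h} g /\<^sub>R h - g x) < e"
    using integrable_ccontinuous_explicit[of g] g by (auto simp: cbox_interval)
  \<comment> \<open>Averages over intervals to the right of a point converge almost everywhere;
    intervals to the left are treated by applying the same to the reflected function.\<close>
  have g': "(\<lambda>x. g (- x)) integrable_on {a..b}" for a b
    using Henstock_Kurzweil_Integration.integrable_reflect_real[where f = g and a = "- b" and b = "- a"] g[of "- b" "- a"] by simp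
  obtain N2 where N2: "negligible N2" "\<And>x e. x \<notin> N2 \<Longrightarrow> 0 < e \<Longrightarrow>
      \<exists>d>0. \<forall>h. 0 < h \<and> h < d \<longrightarrow> norm (integral {x..x + h} (\<lambda>x. g (- x)) /\<^sub>R h - g (- x)) < e"
    using integrable_ccontinuous_explicit[of "\<lambda>x. g (- x)"] g' by (auto simp: cbox_interval)
  show ?thesis
  proof
    show "negligible (N1 \<union> uminus ` N2)"
      using N1(1) N2(1) by (intro negligible_Un negligible_differentiable_image_negligible) (auto intro: derivative_intros)
    fix x c assume x: "x \<notin> N1 \<union> uminus ` N2" and c: "c < (x::real)"
    have x2: "- x \<notin> N2" using x by force
    show "((\<lambda>t. integral {c..t} g) has_vector_derivative g x) (at x)"
      unfolding has_vector_derivative_def has_derivative_within_alt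
    proof (intro conjI allI impI)
      show "bounded_linear (\<lambda>h. h *\<^sub>R g x)" by (rule bounded_linear_scaleR_left)
      fix e :: real assume e: "e > 0"
      obtain d1 where d1: "d1 > 0" "\<And>h. 0 < h \<Longrightarrow> h < d1 \<Longrightarrow> norm (integral {x..x + h} g /\<^sub>R h - g x) < e"
        using N1(2)[of x e] x e by auto
      obtain d2 where d2: "d2 > 0" "\<And>h. 0 < h \<Longrightarrow> h < d2 \<Longrightarrow>
          norm (integral {- x..- x + h} (\<lambda>x. g (- x)) /\<^sub>R h - g x) < e"
        using N2(2)[OF x2 e] by auto
      have "norm (integral {c..y} g - integral {c..x} g - (y - x) *\<^sub>R g x) \<le> e * norm (y - x)"
        if y: "norm (y - x) < min (min d1 d2) (x - c)" for y
      proof (cases y x rule: linorder_cases)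
        case equal
        then show ?thesis by simp
      next
        case greater
        define h where "h = y - x"
        have h: "0 < h" "h < d1" "y = x + h" using greater y by (auto simp: h_def)
        have "integral {c..x} g + integral {x..y} g = integral {c..y} g"
          using greater c g by (intro Henstock_Kurzweil_Integration.integral_combine) auto
        then have "integral {c..y} g - integral {c..x} g - (y - x) *\<^sub>R g x =
            h *\<^sub>R (integral {x..x + h} g /\<^sub>R h - g x)"
          using h by (simp add: algebra_simps)
        then show ?thesis using d1(2)[OF h(1,2)] h(1) by (simp add: h(3))
      next
        case less
        define h where "h = x - y"
        have h: "0 < h" "h < d2" "y = x - h" "c < y" using less y by (auto simp: h_def)
        have I: "integral {c..x} g = integral {c..y} g + integral {y..x} g"
          using less h c g
          by (intro Henstock_Kurzweil_Integration.integral_combine[symmetric]) auto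
        have J: "integral {- x..- x + h} (\<lambda>x. g (- x)) = integral {y..x} g"
          using Henstock_Kurzweil_Integration.integral_reflect_real[where a = y and b = x and f = g]
          by (simp add: h(3) add.commute)
        have "y - x = - h" by (simp add: h_def)
        then have "integral {c..y} g - integral {c..x} g - (y - x) *\<^sub>R g x =
            - (h *\<^sub>R (integral {- x..- x + h} (\<lambda>x. g (- x)) /\<^sub>R h - g x))"
          unfolding I J using h(1) by (simp add: scaleR_diff_right)
        then show ?thesis using d2(2)[OF h(1,2)] h(1) by (simp add: h(3))
      qed
      then show "\<exists>d>0. \<forall>y\<in>UNIV. norm (y - x) < d \<longrightarrow>
          norm (integral {c..y} g - integral {c..x} g - (y - x) *\<^sub>R g x) \<le> e * norm (y - x)"
        using d1(1) d2(1) c by (intro exI[of _ "min (min d1 d2) (x - c)"]) auto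
    qed
  qed
qed

text \<open>Both the variation \<open>V\<close> and \<open>V + f \<bullet> i\<close> are increasing and absolutely continuous. Finiteness of the
  variation holds on short intervals, to which the argument is confined.\<close>

lemma abs_continuous_on_density:
  fixes f :: "real \<Rightarrow> 'a::euclidean_space"
  assumes ac: "abs_continuous_on c d f" and cd: "c < d" and fin: "variation f c d < \<infinity>"
  obtains G :: "real \<Rightarrow> 'a" where "\<And>a b. G absolutely_integrable_on {a..b}"
    "\<And>u v. c \<le> u \<Longrightarrow> u \<le> v \<Longrightarrow> v \<le> d \<Longrightarrow> (G has_integral (f v - f u)) {u..v}"
proof -
  define cl where "cl t = max c (min d t)" for t
  have cl: "c \<le> cl t" "cl t \<le> d" "s \<le> t \<Longrightarrow> cl s \<le> cl t" for s t using cd by (auto simp: cl_def)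
  have cl_id: "cl t = t" if "c \<le> t" "t \<le> d" for t using that by (auto simp: cl_def)
  have fin': "variation f u v < \<infinity>" if "c \<le> u" "v \<le> d" for u v
    using variation_mono[OF that, of f] fin by (rule le_less_trans)
  define V where "V t = enn2real (variation f c (cl t))" for t
  have V_diff: "V v - V u = enn2real (variation f u v)" if "c \<le> u" "u \<le> v" "v \<le> d" for u v
  proof -
    have "variation f c v = variation f c u + variation f u v"
      using that by (intro antisym variation_subadditive variation_superadditive)
    then have "V v = V u + enn2real (variation f u v)"
      using that fin'[of c u] fin'[of u v] by (simp add: V_def cl_id enn2real_plus)
    then show ?thesis by simp
  qed
  have V_mono: "V u \<le> V v" if "u \<le> v" for u v
  proof -
    have "V (cl v) - V (cl u) \<ge> 0" using V_diff[of "cl u" "cl v"] cl that by simp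
    then show ?thesis using cl_id[OF cl(1,2)] by (simp add: V_def)
  qed
  have f_V: "norm (f v - f u) \<le> V v - V u" if "c \<le> u" "u \<le> v" "v \<le> d" for u v
  proof -
    have "norm (f v - f u) = enn2real (ennreal (dist (f u) (f v)))"
      by (simp add: dist_norm norm_minus_commute)
    also have "\<dots> \<le> enn2real (variation f u v)"
      using dist_le_variation[of u v f] fin'[of u v] that by (intro enn2real_mono) auto
    finally show ?thesis using V_diff[OF that] by simp
  qed
  have V_ac: "\<exists>\<delta>>0. \<forall>D S. D division_of S \<and> S \<subseteq> {c..d} \<and> (\<Sum>K\<in>D. Sup K - Inf K) < \<delta> \<longrightarrow>
        (\<Sum>K\<in>D. V (Sup K) - V (Inf K)) \<le> \<epsilon>" if \<epsilon>: "\<epsilon> > 0" for \<epsilon>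
  proof -
    obtain \<delta> where \<delta>: "\<delta> > 0" "\<And>D S. D division_of S \<Longrightarrow> S \<subseteq> {c..d} \<Longrightarrow> (\<Sum>K\<in>D. Sup K - Inf K) < \<delta> \<Longrightarrow>
      (\<Sum>K\<in>D. variation f (Inf K) (Sup K)) \<le> ennreal \<epsilon>"
      using abs_continuous_on_variation[OF ac \<epsilon>] by metis
    have "(\<Sum>K\<in>D. V (Sup K) - V (Inf K)) \<le> \<epsilon>"
      if D: "D division_of S" "S \<subseteq> {c..d}" "(\<Sum>K\<in>D. Sup K - Inf K) < \<delta>" for D S
    proof -
      have K: "c \<le> Inf K" "Inf K \<le> Sup K" "Sup K \<le> d" if "K \<in> D" for K
        using division_interval[OF D(1) that] division_ofD(2)[OF D(1) that] D(2)
          atLeastatMost_subset_iff[of "Inf K" "Sup K" c d] by (metis order_trans)+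
      have "ennreal (\<Sum>K\<in>D. V (Sup K) - V (Inf K)) = (\<Sum>K\<in>D. ennreal (V (Sup K) - V (Inf K)))"
        using K V_mono by (intro sum_ennreal[symmetric]) auto
      also have "\<dots> = (\<Sum>K\<in>D. variation f (Inf K) (Sup K))"
        using K fin' V_diff by (intro sum.cong) (auto simp: less_top)
      also have "\<dots> \<le> ennreal \<epsilon>" by (rule \<delta>(2)[OF D])
      finally show ?thesis using \<epsilon> by simp
    qed
    with \<delta>(1) show ?thesis by blast
  qed
  have const: "cl t = cl c" if "t \<le> c" for t using that cd by (auto simp: cl_def)
  have const': "cl t = cl d" if "t \<ge> d" for t using that cd by (auto simp: cl_def)
  obtain g where g: "\<And>x. 0 \<le> g x" "\<And>u v. u \<le> v \<Longrightarrow> (g has_integral (V v - V u)) {u..v}"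
  proof (rule mono_abs_continuous_density[of V c d])
    show "V t = V c" if "t \<le> c" for t unfolding V_def const[OF that] ..
    show "V t = V d" if "t \<ge> d" for t unfolding V_def const'[OF that] ..
  qed (use V_mono cd V_ac in auto)
  \<comment> \<open>\<open>V\<close> dominates the increments of every component of
    \<open>f\<close>, which makes \<open>W i\<close> increasing; the clamp keeps it constant outside
    \<open>{c..d}\<close>.\<close>
  define W where "W i t = V t + f (cl t) \<bullet> i" for i t
  have fi: "\<bar>f (cl v) \<bullet> i - f (cl u) \<bullet> i\<bar> \<le> V v - V u" if "u \<le> v" "i \<in> Basis" for u v i
  proof -
    have "\<bar>(f (cl v) - f (cl u)) \<bullet> i\<bar> \<le> norm (f (cl v) - f (cl u))" by (rule Basis_le_norm[OF that(2)])
    also have "\<dots> \<le> V (cl v) - V (cl u)" using cl that by (intro f_V) auto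
    also have "\<dots> = V v - V u" using cl_id[OF cl(1,2)] by (simp add: V_def)
    finally show ?thesis by (simp add: inner_diff_left)
  qed
  have "\<exists>g. (\<forall>x. 0 \<le> g x) \<and> (\<forall>u v. u \<le> v \<longrightarrow> (g has_integral (W i v - W i u)) {u..v})" if i: "i \<in> Basis" for i
  proof -
    obtain g where "\<And>x. 0 \<le> g x" "\<And>u v. u \<le> v \<Longrightarrow> (g has_integral (W i v - W i u)) {u..v}"
    proof (rule mono_abs_continuous_density[of "W i" c d])
      show "W i t = W i c" if "t \<le> c" for t unfolding W_def V_def const[OF that] ..
      show "W i t = W i d" if "t \<ge> d" for t unfolding W_def V_def const'[OF that] ..
      show "W i u \<le> W i v" if "u \<le> v" for u v using fi[OF that i] by (auto simp: W_def)
      fix \<epsilon> :: real assume "\<epsilon> > 0"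
      then obtain \<delta> where \<delta>: "\<delta> > 0" "\<And>D S. D division_of S \<Longrightarrow> S \<subseteq> {c..d} \<Longrightarrow> (\<Sum>K\<in>D. Sup K - Inf K) < \<delta> \<Longrightarrow>
        (\<Sum>K\<in>D. V (Sup K) - V (Inf K)) \<le> \<epsilon> / 2"
        using V_ac[of "\<epsilon> / 2"] by (meson half_gt_zero)
      have "(\<Sum>K\<in>D. W i (Sup K) - W i (Inf K)) \<le> \<epsilon>"
        if D: "D division_of S" "S \<subseteq> {c..d}" "(\<Sum>K\<in>D. Sup K - Inf K) < \<delta>" for D S
      proof -
        have "(\<Sum>K\<in>D. W i (Sup K) - W i (Inf K)) \<le> (\<Sum>K\<in>D. 2 * (V (Sup K) - V (Inf K)))"
        proof (rule sum_mono)
          fix K assume "K \<in> D"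
          then have "Inf K \<le> Sup K" using division_interval(2)[OF D(1)] by blast
          then show "W i (Sup K) - W i (Inf K) \<le> 2 * (V (Sup K) - V (Inf K))"
            using fi[of "Inf K" "Sup K" i] i by (auto simp: W_def)
        qed
        also have "\<dots> \<le> \<epsilon>" unfolding sum_distrib_left[symmetric] using \<delta>(2)[OF D] by simp
        finally show ?thesis .
      qed
      with \<delta>(1) show "\<exists>\<delta>>0. \<forall>D S. D division_of S \<and> S \<subseteq> {c..d} \<and> (\<Sum>K\<in>D. Sup K - Inf K) < \<delta> \<longrightarrow>
        (\<Sum>K\<in>D. W i (Sup K) - W i (Inf K)) \<le> \<epsilon>" by blast
    qed (use cd in auto)
    then show ?thesis by blast
  qed
  then obtain w where w: "\<And>i x. i \<in> Basis \<Longrightarrow> 0 \<le> w i x"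
      "\<And>i u v. i \<in> Basis \<Longrightarrow> u \<le> v \<Longrightarrow> (w i has_integral (W i v - W i u)) {u..v}"
    by metis
  \<comment> \<open>Subtracting the density of \<open>V\<close> from that of \<open>W i\<close>
    leaves the density of the component \<open>f \<bullet> i\<close>.\<close>
  define G where "G t = (\<Sum>i\<in>Basis. (w i t - g t) *\<^sub>R (i :: 'a))" for t
  have "w i absolutely_integrable_on {a..b}" if "i \<in> Basis" for i a b
    using w[OF that] by (cases "a \<le> b") (auto intro!: nonnegative_absolutely_integrable_1)
  moreover have "g absolutely_integrable_on {a..b}" for a b
    using g by (cases "a \<le> b") (auto intro!: nonnegative_absolutely_integrable_1)
  ultimately have G_int: "G absolutely_integrable_on {a..b}" for a b
    unfolding G_def
    by (intro absolutely_integrable_sum finite_Basis absolutely_integrable_scaleR_right set_integral_diff(1))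
  have "(G has_integral (f v - f u)) {u..v}" if uv: "c \<le> u" "u \<le> v" "v \<le> d" for u v
  proof -
    have "(G has_integral (\<Sum>i\<in>Basis. ((W i v - W i u) - (V v - V u)) *\<^sub>R i)) {u..v}"
      unfolding G_def
      by (intro has_integral_sum finite_Basis has_integral_scaleR_left has_integral_diff w g uv) auto
    also have "(\<Sum>i\<in>Basis. ((W i v - W i u) - (V v - V u)) *\<^sub>R i) = (\<Sum>i\<in>Basis. ((f v - f u) \<bullet> i) *\<^sub>R i)"
      using uv by (intro sum.cong refl) (simp add: W_def cl_id inner_diff_left)
    also have "\<dots> = f v - f u" by (rule euclidean_representation)
    finally show ?thesis .
  qed
  with G_int that show ?thesis by blast
qed

text \<open>The fundamental theorem of calculus for \<open>f\<close> on one interval, packed into a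
  predicate that is additive over adjacent intervals. Differentiability is asked for in the
  interior, the derivative being two-sided.\<close>

definition velocity_integral :: "(real \<Rightarrow> 'a::euclidean_space) \<Rightarrow> real \<Rightarrow> real \<Rightarrow> bool" where
  "velocity_integral f u v \<longleftrightarrow> velocity f absolutely_integrable_on {u..v} \<and>
     negligible {t \<in> {u<..<v}. \<not> (f has_vector_derivative velocity f t) (at t)} \<and>
     (velocity f has_integral (f v - f u)) {u..v}"

lemma velocity_integral_combine:
  assumes "velocity_integral f u v" "velocity_integral f v w" "u \<le> v" "v \<le> w"
  shows "velocity_integral f u w"
  unfolding velocity_integral_def
proof (intro conjI)
  have "velocity f absolutely_integrable_on ({u..v} \<union> {v..w})"
    using assms(1,2) by (intro set_integrable_Un) (auto simp: velocity_integral_def)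
  then show "velocity f absolutely_integrable_on {u..w}"
    using assms(3,4) by (simp add: ivl_disj_un)
  have "negligible ({v} \<union> {t \<in> {u<..<v}. \<not> (f has_vector_derivative velocity f t) (at t)} \<union>
      {t \<in> {v<..<w}. \<not> (f has_vector_derivative velocity f t) (at t)})"
    using assms(1,2) by (auto simp: velocity_integral_def)
  then show "negligible {t \<in> {u<..<w}. \<not> (f has_vector_derivative velocity f t) (at t)}"
    by (rule negligible_subset) auto
  have "(velocity f has_integral ((f v - f u) + (f w - f v))) {u..w}"
    using assms by (intro has_integral_combine[where c = v]) (auto simp: velocity_integral_def)
  then show "(velocity f has_integral (f w - f u)) {u..w}" by simp
qed

lemma velocity_integral_refl: "velocity_integral f u u"
  using absolutely_integrable_on_null[of u u "velocity f"] has_integral_refl(2)[of "velocity f" u]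
  by (simp add: velocity_integral_def)

lemma abs_continuous_on_subset:
  "abs_continuous_on a b f \<Longrightarrow> a \<le> c \<Longrightarrow> d \<le> b \<Longrightarrow> abs_continuous_on c d f"
  unfolding abs_continuous_on_def by (meson atLeastatMost_subset_iff order_trans)

text \<open>Off the exceptional set of the differentiation theorem the density \<open>G\<close> of
  \<open>f\<close> is its derivative and thus equals \<open>velocity f\<close>; a null set affects
  neither integrability nor the integral.\<close>

lemma velocity_integral_local:
  fixes f :: "real \<Rightarrow> 'a::euclidean_space"
  assumes ac: "abs_continuous_on c d f" and cd: "c \<le> d" and fin: "variation f c d < \<infinity>"
  shows "velocity_integral f c d"
proof (cases "c = d")
  case True
  then show ?thesis using velocity_integral_refl by simp
next
  case False
  then have cd': "c < d" using cd by simp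
  obtain G :: "real \<Rightarrow> 'a" where G: "\<And>a b. G absolutely_integrable_on {a..b}"
    "\<And>u v. c \<le> u \<Longrightarrow> u \<le> v \<Longrightarrow> v \<le> d \<Longrightarrow> (G has_integral (f v - f u)) {u..v}"
    using abs_continuous_on_density[OF ac cd' fin] by metis
  have "G integrable_on {a..b}" for a b
    using G(1) set_lebesgue_integral_eq_integral(1) by blast
  then obtain N where N: "negligible N"
    "\<And>x. x \<notin> N \<Longrightarrow> c < x \<Longrightarrow> ((\<lambda>t. integral {c..t} G) has_vector_derivative G x) (at x)"
    using Lebesgue_differentiation[of G] by metis
  have der: "(f has_vector_derivative G x) (at x)" if x: "x \<in> {c<..<d}" "x \<notin> N" for x
  proof (rule has_vector_derivative_transform_within_open[where S = "{c<..<d}"])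
    show "((\<lambda>t. f c + integral {c..t} G) has_vector_derivative G x) (at x)"
      using N(2)[of x] x by (auto intro!: derivative_eq_intros)
    show "f c + integral {c..t} G = f t" if "t \<in> {c<..<d}" for t
      using G(2)[of c t] that by (auto dest!: integral_unique)
  qed (use x in auto)
  have vel: "velocity f x = G x" if "x \<in> {c<..<d}" "x \<notin> N" for x
    using vector_derivative_at[OF der[OF that]] .
  have N': "negligible (N \<union> {c, d})" using N(1) by auto
  have vel': "velocity f x = G x" if "x \<in> {c..d} - (N \<union> {c, d})" for x
    using vel[of x] that by auto
  show ?thesis
    unfolding velocity_integral_def
  proof (intro conjI)
    show "velocity f absolutely_integrable_on {c..d}"
      using G(1) N' vel' by (rule absolutely_integrable_spike)
    show "negligible {t \<in> {c<..<d}. \<not> (f has_vector_derivative velocity f t) (at t)}"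
    proof (rule negligible_subset[OF N(1)], rule subsetI)
      fix x assume x: "x \<in> {t \<in> {c<..<d}. \<not> (f has_vector_derivative velocity f t) (at t)}"
      then show "x \<in> N" using der[of x] vel[of x] by (cases "x \<in> N") auto
    qed
    show "(velocity f has_integral (f d - f c)) {c..d}"
      by (rule has_integral_spike[OF N' vel' G(2)]) (use cd in auto)
  qed
qed

text \<open>For the tolerance \<open>1\<close> in absolute continuity, the variation is at most
  \<open>1\<close> on every interval shorter than \<open>\<delta>\<close>, so the local version
  applies there; finitely many such intervals make up \<open>{a..b}\<close>.\<close>

theorem abs_continuous_on_velocity_integral:
  fixes f :: "real \<Rightarrow> 'a::euclidean_space"
  assumes ac: "abs_continuous_on a b f" and ab: "a \<le> b"
  shows "velocity_integral f a b"
proof -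
  obtain \<delta> where \<delta>: "\<delta> > 0" "\<And>D S. D division_of S \<Longrightarrow> S \<subseteq> {a..b} \<Longrightarrow> (\<Sum>K\<in>D. Sup K - Inf K) < \<delta> \<Longrightarrow>
      (\<Sum>K\<in>D. variation f (Inf K) (Sup K)) \<le> ennreal 1"
    using abs_continuous_on_variation[OF ac zero_less_one] by metis
  have small: "velocity_integral f u v" if uv: "a \<le> u" "u \<le> v" "v \<le> b" "v - u < \<delta>" for u v
  proof (rule velocity_integral_local[OF abs_continuous_on_subset[OF ac]])
    have "{{u..v}} division_of {u..v}"
      using uv by (intro division_of_self[of u v, unfolded cbox_interval]) auto
    then have "variation f u v \<le> 1" using \<delta>(2)[of "{{u..v}}" "{u..v}"] uv by simp
    then show "variation f u v < \<infinity>" by (rule le_less_trans) simp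
  qed (use uv in auto)
  obtain n :: nat where n: "b - a < real n * \<delta>" using \<delta>(1) reals_Archimedean3 by blast
  \<comment> \<open>Steps of length \<open>\<delta> / 2\<close> stay strictly below
    \<open>\<delta>\<close>; \<open>2 * n\<close> of them go beyond \<open>b\<close>, where
    \<open>min\<close> stops.\<close>
  have "velocity_integral f a (min b (a + real k * (\<delta> / 2)))" for k
  proof (induction k)
    case 0
    then show ?case using ab velocity_integral_refl by simp
  next
    case (Suc k)
    have "velocity_integral f (min b (a + real k * (\<delta> / 2))) (min b (a + real (Suc k) * (\<delta> / 2)))"
      using ab \<delta>(1) by (intro small) (auto simp: min_def field_simps add_nonneg_nonneg)
    then show ?case
      using ab \<delta>(1) by (intro velocity_integral_combine[OF Suc.IH]) (auto simp: min_def field_simps)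
  qed
  from this[of "2 * n"] show ?thesis using n by (simp add: min_def)
qed

subsection \<open>Measurability on the space of curves\<close>

text \<open>\<open>g\<close> is approximated by functions with countably many values:
  \<open>d (idx k s)\<close> is the first point of a dense sequence in \<open>Z\<close> within
  \<open>1 / (k + 1)\<close> of \<open>g s\<close>. Along such functions \<open>f\<close> is
  measurable case by case, and continuity in the second argument passes to the limit.\<close>

lemma Caratheodory_measurable:
  fixes f :: "'m \<Rightarrow> 'z::euclidean_space \<Rightarrow> 'b::metric_space"
  assumes f: "\<And>z. z \<in> Z \<Longrightarrow> (\<lambda>s. f s z) \<in> borel_measurable M"
    and cont: "\<And>s. s \<in> space M \<Longrightarrow> continuous_on Z (f s)"
    and g: "g \<in> borel_measurable M" "\<And>s. s \<in> space M \<Longrightarrow> g s \<in> Z"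
  shows "(\<lambda>s. f s (g s)) \<in> borel_measurable M"
proof (cases "Z = {}")
  case True
  then have "space M = {}" using g(2) by auto
  then show ?thesis by (auto simp: measurable_def)
next
  case False
  obtain D where D: "countable D" "D \<subseteq> Z" "Z \<subseteq> closure D"
    using separable by blast
  then have ne: "D \<noteq> {}" using False by auto
  define d where "d = from_nat_into D"
  have d: "d n \<in> Z" for n using from_nat_into[OF ne] D(2) by (auto simp: d_def)
  have dense: "\<exists>n. dist (d n) (g s) < inverse (real (Suc k))" if "s \<in> space M" for s k
  proof -
    have "g s \<in> closure D" using g(2)[OF that] D(3) by auto
    then obtain y where y: "y \<in> D" "dist y (g s) < inverse (real (Suc k))"
      unfolding closure_approachable by (metis inverse_positive_iff_positive of_nat_0_less_iff zero_less_Suc)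
    then obtain n where "d n = y" using from_nat_into_surj[OF D(1)] by (auto simp: d_def)
    then show ?thesis using y by auto
  qed
  define idx where "idx k s = (LEAST n. dist (d n) (g s) < inverse (real (Suc k)))" for k s
  note g(1)[measurable]
  have [measurable]: "idx k \<in> measurable M (count_space UNIV)" for k
    unfolding idx_def by measurable
  have idx: "dist (d (idx k s)) (g s) < inverse (real (Suc k))" if "s \<in> space M" for k s
    unfolding idx_def using dense[OF that, of k] by (rule LeastI_ex)
  show ?thesis
  proof (rule borel_measurable_LIMSEQ_metric)
    show "(\<lambda>s. f s (d (idx k s))) \<in> borel_measurable M" for k
      using f[OF d] by (rule measurable_compose_countable) measurable
    fix s assume s: "s \<in> space M"
    have "(\<lambda>k. d (idx k s)) \<longlonglongrightarrow> g s"
    proof (rule metric_tendsto_imp_tendsto[OF LIMSEQ_inverse_real_of_nat])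
      show "\<forall>\<^sub>F k in sequentially. dist (d (idx k s)) (g s) \<le> dist (inverse (real (Suc k))) 0"
      proof (rule always_eventually, rule allI)
        fix k
        have "dist (d (idx k s)) (g s) \<le> inverse (real (Suc k))" using idx[OF s, of k] by simp
        then show "dist (d (idx k s)) (g s) \<le> dist (inverse (real (Suc k))) 0" by (simp add: dist_real_def)
      qed
    qed
    then show "(\<lambda>k. f s (d (idx k s))) \<longlonglongrightarrow> f s (g s)"
      by (rule continuous_on_tendsto_compose[OF cont[OF s]]) (simp_all add: d g(2) s)
  qed
qed

lemma space_curve_borel: "space (curve_borel X) = curves X"
  unfolding curve_borel_def by (rule space_measure_of) (auto simp: openin_curve_topology)

lemma openin_sets_curve_borel: "openin (curve_topology X) U \<Longrightarrow> U \<in> sets (curve_borel X)"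
  unfolding curve_borel_def by (subst sets_measure_of) (auto simp: openin_curve_topology)

lemma curvesD:
  assumes "\<gamma> \<in> curves X"
  shows "continuous_on {0..} \<gamma>" "t \<ge> 0 \<Longrightarrow> \<gamma> t \<in> X" "t < 0 \<Longrightarrow> \<gamma> t = undefined"
  using assms by (auto simp: curves_def PiE_def extensional_def)

lemma eval_measurable:
  assumes "t \<ge> 0"
  shows "(\<lambda>\<omega>. \<omega> t) \<in> borel_measurable (curve_borel (X :: 'a::euclidean_space set))"
proof (rule borel_measurableI)
  fix S :: "'a set" assume S: "open S"
  have "openin (curve_topology X) ((\<lambda>\<omega>. \<omega> t) -` S \<inter> curves X)"
    unfolding openin_curve_topology
  proof (intro conjI ballI)
    fix \<gamma> assume "\<gamma> \<in> (\<lambda>\<omega>. \<omega> t) -` S \<inter> curves X"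
    then obtain e where "e > 0" "\<And>y. dist y (\<gamma> t) < e \<Longrightarrow> y \<in> S"
      using S by (auto simp: open_dist)
    then show "\<exists>T\<ge>0. \<exists>\<epsilon>>0. \<forall>\<omega>\<in>curves X. (\<forall>t\<in>{0..T}. dist (\<omega> t) (\<gamma> t) < \<epsilon>) \<longrightarrow>
        \<omega> \<in> (\<lambda>\<omega>. \<omega> t) -` S \<inter> curves X"
      using assms by (intro exI[of _ t] conjI exI[of _ e]) auto
  qed auto
  then show "(\<lambda>\<omega>. \<omega> t) -` S \<inter> space (curve_borel X) \<in> sets (curve_borel X)"
    by (simp add: space_curve_borel openin_sets_curve_borel)
qed

text \<open>Time takes the place of the continuous argument, the curve that of the measurable one.
  \<open>max 0\<close> is there because a curve is \<open>undefined\<close> at negative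
  times.\<close>

lemma eval_joint_measurable:
  "(\<lambda>p. fst p (max 0 (snd p))) \<in> borel_measurable (curve_borel (X :: 'a::euclidean_space set) \<Otimes>\<^sub>M borel)"
proof (rule Caratheodory_measurable[where Z = "{0..}"])
  fix t :: real assume "t \<in> {0..}"
  then show "(\<lambda>p. fst p t) \<in> borel_measurable (curve_borel X \<Otimes>\<^sub>M borel)"
    using measurable_compose[OF measurable_fst eval_measurable] by auto
next
  fix p assume "p \<in> space (curve_borel X \<Otimes>\<^sub>M (borel :: real measure))"
  then show "continuous_on {0..} (fst p)" using curvesD(1) by (auto simp: space_pair_measure space_curve_borel)
qed auto

section \<open>Lower semicontinuity and measurability of the exit time\<close>

lemma exit_time_ge:
  assumes "\<And>t. 0 \<le> t \<Longrightarrow> t \<le> s \<Longrightarrow> \<gamma> t \<notin> \<Xi>"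
  shows "ennreal s \<le> exit_time \<Xi> \<gamma>"
  unfolding exit_time_def
proof (rule INF_greatest)
  fix t assume "t \<in> {t. 0 \<le> t \<and> \<gamma> t \<in> \<Xi>}"
  then show "ennreal s \<le> ennreal t" using assms[of t] by (cases "s \<le> t") (auto intro: ennreal_leI)
qed

lemma exit_time_le: "0 \<le> t \<Longrightarrow> \<gamma> t \<in> \<Xi> \<Longrightarrow> exit_time \<Xi> \<gamma> \<le> ennreal t"
  unfolding exit_time_def by (rule INF_lower) auto

lemma before_exit_time: "0 \<le> t \<Longrightarrow> ennreal t < exit_time \<Xi> \<gamma> \<Longrightarrow> \<gamma> t \<notin> \<Xi>"
  using exit_time_le leD by blast

text \<open>The curve up to time \<open>s\<close> is compact and misses the closed set
  \<open>\<Xi>\<close>, hence so does a tube around it. This is lower semicontinuity of the exit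
  time, in a form that serves measurability as well as limits of curves.\<close>

lemma exit_time_tube:
  fixes \<Xi> :: "'a::euclidean_space set"
  assumes \<gamma>: "\<gamma> \<in> curves X" and "closed \<Xi>" and s: "0 \<le> s" "ennreal s < exit_time \<Xi> \<gamma>"
  obtains \<epsilon> where "\<epsilon> > 0" "\<And>\<omega>. (\<And>t. 0 \<le> t \<Longrightarrow> t \<le> s \<Longrightarrow> dist (\<omega> t) (\<gamma> t) < \<epsilon>) \<Longrightarrow> ennreal s \<le> exit_time \<Xi> \<omega>"
proof -
  have "compact (\<gamma> ` {0..s})"
    using curvesD(1)[OF \<gamma>] by (intro compact_continuous_image) (auto elim: continuous_on_subset)
  moreover have "\<gamma> ` {0..s} \<inter> \<Xi> = {}"
  proof -
    have "\<gamma> t \<notin> \<Xi>" if "0 \<le> t" "t \<le> s" for t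
      by (rule before_exit_time[OF that(1)]) (rule le_less_trans[OF ennreal_leI[OF that(2)] s(2)])
    then show ?thesis by auto
  qed
  ultimately obtain d where d: "d > 0" "\<And>x y. x \<in> \<gamma> ` {0..s} \<Longrightarrow> y \<in> \<Xi> \<Longrightarrow> d \<le> dist x y"
    using separate_compact_closed[OF _ \<open>closed \<Xi>\<close>] by metis
  show ?thesis
  proof (rule that[OF d(1)])
    fix \<omega> assume \<omega>: "\<And>t. 0 \<le> t \<Longrightarrow> t \<le> s \<Longrightarrow> dist (\<omega> t) (\<gamma> t) < d"
    show "ennreal s \<le> exit_time \<Xi> \<omega>"
    proof (rule exit_time_ge)
      fix t assume t: "0 \<le> t" "t \<le> s"
      show "\<omega> t \<notin> \<Xi>" using d(2)[of "\<gamma> t" "\<omega> t"] \<omega>[OF t] t by (auto simp: dist_commute)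
    qed
  qed
qed

lemma exit_time_measurable:
  assumes "closed \<Xi>"
  shows "exit_time \<Xi> \<in> borel_measurable (curve_borel X)"
proof (rule borel_measurableI_greater)
  fix y
  have "openin (curve_topology X) {\<omega> \<in> curves X. y < exit_time \<Xi> \<omega>}"
    unfolding openin_curve_topology
  proof (intro conjI ballI)
    fix \<gamma> assume "\<gamma> \<in> {\<omega> \<in> curves X. y < exit_time \<Xi> \<omega>}"
    then have \<gamma>: "\<gamma> \<in> curves X" "y < exit_time \<Xi> \<gamma>" by auto
    \<comment> \<open>A value strictly in between is needed, as the tube guarantees only a weak
      inequality for the neighbouring curves.\<close>
    obtain z where z: "y < z" "z < exit_time \<Xi> \<gamma>" using dense[OF \<gamma>(2)] by auto
    then obtain s where s: "0 \<le> s" "z = ennreal s" by (cases z) auto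
    obtain \<epsilon> where \<epsilon>: "\<epsilon> > 0" "\<And>\<omega>. (\<And>t. 0 \<le> t \<Longrightarrow> t \<le> s \<Longrightarrow> dist (\<omega> t) (\<gamma> t) < \<epsilon>) \<Longrightarrow> ennreal s \<le> exit_time \<Xi> \<omega>"
      using exit_time_tube[OF \<gamma>(1) assms s(1)] z(2) s(2) by metis
    show "\<exists>T\<ge>0. \<exists>\<epsilon>>0. \<forall>\<omega>\<in>curves X. (\<forall>t\<in>{0..T}. dist (\<omega> t) (\<gamma> t) < \<epsilon>) \<longrightarrow>
        \<omega> \<in> {\<omega> \<in> curves X. y < exit_time \<Xi> \<omega>}"
      using \<epsilon> s z(1) by (intro exI[of _ s] conjI exI[of _ \<epsilon>]) (auto intro: less_le_trans)
  qed auto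
  then show "{\<omega> \<in> space (curve_borel X). y < exit_time \<Xi> \<omega>} \<in> sets (curve_borel X)"
    by (simp add: space_curve_borel openin_sets_curve_borel)
qed

text \<open>For continuous functions it suffices to test rational increments, so that differentiability becomes
  a measurable condition on the pair of curve and time.\<close>

definition rational_quotients_Cauchy :: "(real \<Rightarrow> 'a::euclidean_space) \<Rightarrow> real \<Rightarrow> bool" where
  "rational_quotients_Cauchy f t \<longleftrightarrow> (\<forall>k::nat. \<exists>m::nat. \<forall>r r'::rat.
     0 < \<bar>of_rat r :: real\<bar> \<and> \<bar>of_rat r :: real\<bar> < inverse (Suc m) \<and>
     0 < \<bar>of_rat r' :: real\<bar> \<and> \<bar>of_rat r' :: real\<bar> < inverse (Suc m) \<longrightarrow>
     norm ((f (max 0 (t + of_rat r)) - f (max 0 t)) /\<^sub>R of_rat r -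
       (f (max 0 (t + of_rat r')) - f (max 0 t)) /\<^sub>R of_rat r') \<le> inverse (Suc k))"

lemma has_vector_derivative_iff_quotient:
  fixes f :: "real \<Rightarrow> 'a::euclidean_space"
  shows "(f has_vector_derivative v) (at t) \<longleftrightarrow> ((\<lambda>h. (f (t + h) - f t) /\<^sub>R h) \<longlongrightarrow> v) (at 0)"
proof -
  have "(f has_vector_derivative v) (at t) \<longleftrightarrow>
      ((\<lambda>h. norm (f (t + h) - f t - h *\<^sub>R v) / norm h) \<longlongrightarrow> 0) (at 0)"
    by (simp add: has_vector_derivative_def has_derivative_at bounded_linear_scaleR_left)
  also have "\<dots> \<longleftrightarrow> ((\<lambda>h. norm ((f (t + h) - f t) /\<^sub>R h - v)) \<longlongrightarrow> 0) (at 0)"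
  proof (rule tendsto_cong)
    have "norm (f (t + h) - f t - h *\<^sub>R v) / norm h = norm ((f (t + h) - f t) /\<^sub>R h - v)" if "h \<noteq> 0" for h
    proof -
      have "f (t + h) - f t - h *\<^sub>R v = h *\<^sub>R ((f (t + h) - f t) /\<^sub>R h - v)"
        using that by (simp add: scaleR_diff_right)
      then show ?thesis using that by (metis nonzero_mult_div_cancel_left norm_eq_zero norm_scaleR real_norm_def)
    qed
    then show "\<forall>\<^sub>F h in at 0. norm (f (t + h) - f t - h *\<^sub>R v) / norm h = norm ((f (t + h) - f t) /\<^sub>R h - v)"
      by (auto simp: eventually_at_filter)
  qed
  also have "\<dots> \<longleftrightarrow> ((\<lambda>h. (f (t + h) - f t) /\<^sub>R h) \<longlongrightarrow> v) (at 0)"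
    by (simp add: tendsto_norm_zero_iff LIM_zero_iff)
  finally show ?thesis .
qed

text \<open>By continuity the estimate for rational increments extends to real ones, and
  completeness then supplies the derivative. The second statement exhibits it as a limit along one
  fixed sequence, which makes its measurability visible.\<close>

lemma rational_quotients_Cauchy_iff:
  fixes f :: "real \<Rightarrow> 'a::euclidean_space"
  assumes t: "t > 0" and cont: "continuous_on {0..} f"
  shows "rational_quotients_Cauchy f t \<longleftrightarrow> (\<exists>v. (f has_vector_derivative v) (at t))"
    (is "?C \<longleftrightarrow> ?D")
    "rational_quotients_Cauchy f t \<Longrightarrow>
      velocity f t = lim (\<lambda>n. (f (max 0 (t + inverse (Suc n))) - f (max 0 t)) /\<^sub>R inverse (Suc n))"
proof -
  let ?q = "\<lambda>r. (f (max 0 (t + r)) - f (max 0 t)) /\<^sub>R r"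
  have q_iff: "(f has_vector_derivative v) (at t) \<longleftrightarrow> (?q \<longlongrightarrow> v) (at 0)" for v
    unfolding has_vector_derivative_iff_quotient
  proof (rule tendsto_cong)
    have "\<forall>\<^sub>F h in at 0. h \<in> {- t<..}" using t by (intro eventually_at_in_open') auto
    then show "\<forall>\<^sub>F h in at 0. (f (t + h) - f t) /\<^sub>R h = ?q h"
      by eventually_elim (use t in auto)
  qed
  have inv: "filterlim (\<lambda>n. inverse (real (Suc n))) (at 0) sequentially"
    unfolding filterlim_at using LIMSEQ_inverse_real_of_nat by auto
  have lim: "(\<lambda>n. ?q (inverse (Suc n))) \<longlonglongrightarrow> v" if "(?q \<longlongrightarrow> v) (at 0)" for v
    using filterlim_compose[OF that inv] .
  have 1: ?C if v: "(f has_vector_derivative v) (at t)" for v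
    unfolding rational_quotients_Cauchy_def
  proof
    fix k :: nat
    have "(?q \<longlongrightarrow> v) (at 0)" using v q_iff by simp
    then obtain d where d: "d > 0" "\<And>r. r \<noteq> 0 \<Longrightarrow> \<bar>r\<bar> < d \<Longrightarrow> dist (?q r) v < inverse (Suc k) / 2"
      unfolding tendsto_iff eventually_at
      by (metis (no_types, lifting) UNIV_I dist_0_norm dist_commute half_gt_zero inverse_positive_iff_positive of_nat_0_less_iff real_norm_def zero_less_Suc)
    obtain m where m: "inverse (real (Suc m)) < d" using reals_Archimedean[OF d(1)] by auto
    have "norm (?q r - ?q r') \<le> inverse (Suc k)"
      if "0 < \<bar>r\<bar>" "\<bar>r\<bar> < inverse (Suc m)" "0 < \<bar>r'\<bar>" "\<bar>r'\<bar> < inverse (Suc m)" for r r'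
      using dist_triangle_half_l[of "?q r" v "inverse (Suc k)" "?q r'"] d(2)[of r] d(2)[of r'] that m
      unfolding dist_norm by (auto simp: norm_minus_commute less_imp_le)
    then show "\<exists>m::nat. \<forall>r r'::rat.
     0 < \<bar>of_rat r :: real\<bar> \<and> \<bar>of_rat r :: real\<bar> < inverse (Suc m) \<and>
     0 < \<bar>of_rat r' :: real\<bar> \<and> \<bar>of_rat r' :: real\<bar> < inverse (Suc m) \<longrightarrow>
     norm (?q (of_rat r) - ?q (of_rat r')) \<le> inverse (Suc k)" by blast
  qed
  have 2: "(f has_vector_derivative lim (\<lambda>n. ?q (inverse (Suc n)))) (at t)" if ?C
  proof -
    let ?s = "\<lambda>n::nat. inverse (real (Suc n))"
    have C: "\<exists>m. \<forall>r r'::rat. 0 < \<bar>of_rat r :: real\<bar> \<and> \<bar>of_rat r :: real\<bar> < ?s m \<and>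
        0 < \<bar>of_rat r' :: real\<bar> \<and> \<bar>of_rat r' :: real\<bar> < ?s m \<longrightarrow>
        norm (?q (of_rat r) - ?q (of_rat r')) \<le> ?s k" for k
      using that unfolding rational_quotients_Cauchy_def by blast
    have C': "\<exists>m. \<forall>r r'. 0 < \<bar>r\<bar> \<and> \<bar>r\<bar> < ?s m \<and> 0 < \<bar>r'\<bar> \<and> \<bar>r'\<bar> < ?s m \<longrightarrow> norm (?q r - ?q r') \<le> ?s k" for k
    proof -
      obtain m where m: "\<And>r r'::rat. 0 < \<bar>of_rat r :: real\<bar> \<and> \<bar>of_rat r :: real\<bar> < ?s m \<and>
        0 < \<bar>of_rat r' :: real\<bar> \<and> \<bar>of_rat r' :: real\<bar> < ?s m \<longrightarrow>
        norm (?q (of_rat r) - ?q (of_rat r')) \<le> ?s k" using C[of k] by blast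
      \<comment> \<open>The admissible increments form an open set, so a real one is the limit of
        admissible rational ones, and the quotients converge along them.\<close>
      have approx: "\<exists>R. (\<forall>n. 0 < \<bar>of_rat (R n) :: real\<bar> \<and> \<bar>of_rat (R n) :: real\<bar> < ?s m) \<and>
          (\<lambda>n. ?q (of_rat (R n))) \<longlonglongrightarrow> ?q r" if r: "0 < \<bar>r\<bar>" "\<bar>r\<bar> < ?s m" for r
      proof -
        let ?U = "{x. 0 < \<bar>x\<bar> \<and> \<bar>x\<bar> < ?s m}"
        have "?U = ({- ?s m<..<?s m} - {0})" by auto
        then have U: "open ?U" by (metis closed_singleton open_Diff open_greaterThanLessThan)
        then obtain e where e: "e > 0" "ball r e \<subseteq> ?U" using r open_contains_ball by blast
        have "\<exists>x::rat. r < of_rat x \<and> of_rat x < r + min e (?s n)" for n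
          using of_rat_dense[of r "r + min e (?s n)"] e(1) by auto
        then obtain R where R: "\<And>n. r < of_rat (R n)" "\<And>n. of_rat (R n) < r + min e (?s n)" by metis
        have in_U: "of_rat (R n) \<in> ?U" for n
        proof -
          have "real_of_rat (R n) \<in> ball r e" using R[of n] by (simp add: dist_real_def)
          then show ?thesis using e(2) by blast
        qed
        have lim: "(\<lambda>n. real_of_rat (R n)) \<longlonglongrightarrow> r"
        proof (rule metric_tendsto_imp_tendsto[OF LIMSEQ_inverse_real_of_nat])
          show "\<forall>\<^sub>F n in sequentially. dist (real_of_rat (R n)) r \<le> dist (?s n) 0"
            using R by (auto intro!: always_eventually simp: dist_real_def less_imp_le) (smt (verit))
        qed
        have "(\<lambda>n. f (max 0 (t + of_rat (R n)))) \<longlonglongrightarrow> f (max 0 (t + r))"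
          by (rule continuous_on_tendsto_compose[OF cont]) (auto intro!: tendsto_intros lim)
        then have "(\<lambda>n. ?q (of_rat (R n))) \<longlonglongrightarrow> ?q r"
          using r lim by (intro tendsto_intros) auto
        then show ?thesis using in_U by blast
      qed
      have "norm (?q r - ?q r') \<le> ?s k" if r: "0 < \<bar>r\<bar>" "\<bar>r\<bar> < ?s m" "0 < \<bar>r'\<bar>" "\<bar>r'\<bar> < ?s m" for r r'
      proof -
        obtain R where R: "\<And>n. 0 < \<bar>of_rat (R n) :: real\<bar> \<and> \<bar>of_rat (R n) :: real\<bar> < ?s m"
            "(\<lambda>n. ?q (of_rat (R n))) \<longlonglongrightarrow> ?q r" using approx[OF r(1,2)] by blast
        obtain R' where R': "\<And>n. 0 < \<bar>of_rat (R' n) :: real\<bar> \<and> \<bar>of_rat (R' n) :: real\<bar> < ?s m"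
            "(\<lambda>n. ?q (of_rat (R' n))) \<longlonglongrightarrow> ?q r'" using approx[OF r(3,4)] by blast
        have "(\<lambda>n. norm (?q (of_rat (R n)) - ?q (of_rat (R' n)))) \<longlonglongrightarrow> norm (?q r - ?q r')"
          by (intro tendsto_intros R R')
        then show ?thesis by (rule LIMSEQ_le_const2) (use m R(1) R'(1) in blast)
      qed
      then show ?thesis by blast
    qed
    have less: "?s i < ?s m" if "i \<ge> Suc m" for i m :: nat
      using that by (intro less_imp_inverse_less) auto
    have "Cauchy (\<lambda>n. ?q (?s n))"
    proof (rule metric_CauchyI)
      fix e :: real assume "e > 0"
      then obtain k where k: "?s k < e" using reals_Archimedean by blast
      obtain m where m: "\<And>r r'. 0 < \<bar>r\<bar> \<and> \<bar>r\<bar> < ?s m \<and> 0 < \<bar>r'\<bar> \<and> \<bar>r'\<bar> < ?s m \<Longrightarrow> norm (?q r - ?q r') \<le> ?s k"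
        using C'[of k] by blast
      have "dist (?q (?s i)) (?q (?s j)) < e" if "i \<ge> Suc m" "j \<ge> Suc m" for i j
        using le_less_trans[OF m[of "?s i" "?s j"] k] less[OF that(1)] less[OF that(2)] by (simp add: dist_norm)
      then show "\<exists>M. \<forall>i\<ge>M. \<forall>j\<ge>M. dist (?q (?s i)) (?q (?s j)) < e" by blast
    qed
    then have L: "(\<lambda>n. ?q (?s n)) \<longlonglongrightarrow> lim (\<lambda>n. ?q (?s n))"
      by (simp add: Cauchy_convergent_iff convergent_LIMSEQ_iff)
    have "(?q \<longlongrightarrow> lim (\<lambda>n. ?q (?s n))) (at 0)"
      unfolding tendsto_iff eventually_at
    proof (intro allI impI)
      fix e :: real assume "e > 0"
      then obtain k where k: "?s k < e" using reals_Archimedean by blast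
      obtain m where m: "\<And>r r'. 0 < \<bar>r\<bar> \<and> \<bar>r\<bar> < ?s m \<and> 0 < \<bar>r'\<bar> \<and> \<bar>r'\<bar> < ?s m \<Longrightarrow> norm (?q r - ?q r') \<le> ?s k"
        using C'[of k] by blast
      have "dist (?q r) (lim (\<lambda>n. ?q (?s n))) < e" if r: "r \<noteq> 0" "\<bar>r\<bar> < ?s m" for r
      proof -
        have "(\<lambda>n. norm (?q r - ?q (?s n))) \<longlonglongrightarrow> norm (?q r - lim (\<lambda>n. ?q (?s n)))"
          by (intro tendsto_intros L)
        moreover have "norm (?q r - ?q (?s n)) \<le> ?s k" if "n \<ge> Suc m" for n
          using m[of r "?s n"] r less[OF that] by simp
        ultimately have "norm (?q r - lim (\<lambda>n. ?q (?s n))) \<le> ?s k" by (intro LIMSEQ_le_const2) blast+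
        then show ?thesis using k by (simp add: dist_norm)
      qed
      then show "\<exists>d>0. \<forall>x\<in>UNIV. x \<noteq> 0 \<and> dist x 0 < d \<longrightarrow> dist (?q x) (lim (\<lambda>n. ?q (?s n))) < e"
        by (intro exI[of _ "?s m"]) auto
    qed
    then show ?thesis using q_iff by simp
  qed
  show "?C \<longleftrightarrow> ?D" using 1 2 by blast
  show "velocity f t = lim (\<lambda>n. ?q (inverse (Suc n)))" if ?C
    by (rule vector_derivative_at[OF 2[OF that]])
qed

text \<open>Both the existence of the derivative and its value are obtained from evaluations of the
  curve by countably many operations. The restriction to positive times accounts for the derivative
  being two-sided.\<close>

lemma velocity_joint_measurable:
  "(\<lambda>p. if 0 < snd p then velocity (fst p) (snd p) else 0)
    \<in> borel_measurable (curve_borel (X :: 'a::euclidean_space set) \<Otimes>\<^sub>M borel)"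
proof -
  let ?M = "curve_borel X \<Otimes>\<^sub>M (borel :: real measure)"
  \<comment> \<open>Where no derivative exists, \<open>vector_derivative\<close> chooses from an
    empty predicate; the outcome is always this one constant, hence measurable too.\<close>
  let ?c = "SOME v::'a. False"
  have ev[measurable]: "(\<lambda>p. fst p (max 0 (snd p + r))) \<in> borel_measurable ?M" for r
  proof -
    have "(\<lambda>p. (fst p, snd p + r)) \<in> measurable ?M ?M" by measurable
    from measurable_compose[OF this eval_joint_measurable] show ?thesis by simp
  qed
  have [measurable]: "(\<lambda>p. fst p (max 0 (snd p))) \<in> borel_measurable ?M" by (rule eval_joint_measurable)
  have eq: "(if 0 < snd p then velocity (fst p) (snd p) else 0) =
      (if 0 < snd p then if rational_quotients_Cauchy (fst p) (snd p)
        then lim (\<lambda>n. (fst p (max 0 (snd p + inverse (Suc n))) - fst p (max 0 (snd p))) /\<^sub>R inverse (Suc n))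
        else ?c else 0)" if "p \<in> space ?M" for p
  proof -
    have cont: "continuous_on {0..} (fst p)"
      using that curvesD(1) by (auto simp: space_pair_measure space_curve_borel)
    show ?thesis
    proof (cases "0 < snd p \<and> \<not> rational_quotients_Cauchy (fst p) (snd p)")
      case True
      then have "\<not> (fst p has_vector_derivative v) (at (snd p))" for v
        using rational_quotients_Cauchy_iff(1)[OF _ cont] by blast
      then show ?thesis using True by (simp add: vector_derivative_def)
    next
      case False
      then show ?thesis using rational_quotients_Cauchy_iff(2)[OF _ cont] by auto
    qed
  qed
  have "(\<lambda>p. if 0 < snd p then if rational_quotients_Cauchy (fst p) (snd p)
        then lim (\<lambda>n. (fst p (max 0 (snd p + inverse (Suc n))) - fst p (max 0 (snd p))) /\<^sub>R inverse (Suc n))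
        else ?c else 0) \<in> borel_measurable ?M"
    unfolding rational_quotients_Cauchy_def by measurable
  then show ?thesis by (subst measurable_cong[OF eq]) auto
qed

lemma velocity_measurable:
  assumes "\<gamma> \<in> curves X"
  shows "(\<lambda>t. if 0 < t then velocity \<gamma> t else 0) \<in> borel_measurable borel"
proof -
  have "(\<lambda>t. (\<gamma>, t)) \<in> measurable borel (curve_borel X \<Otimes>\<^sub>M (borel :: real measure))"
    using assms by (intro measurable_Pair measurable_const) (auto simp: space_curve_borel)
  from measurable_compose[OF this velocity_joint_measurable] show ?thesis unfolding fst_conv snd_conv .
qed

section \<open>Measurability of the interaction\<close>

lemma sigma_finite_lebesgue: "sigma_finite_measure (lebesgue :: 'a::euclidean_space measure)"
proof
  obtain A :: "'a set set" where "countable A" "A \<subseteq> sets lborel" "\<Union>A = space lborel" "\<forall>a\<in>A. emeasure lborel a \<noteq> \<infinity>"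
    using lborel.sigma_finite_countable by auto
  then show "\<exists>A :: 'a set set. countable A \<and> A \<subseteq> sets lebesgue \<and> \<Union>A = space lebesgue \<and> (\<forall>a\<in>A. emeasure lebesgue a \<noteq> \<infinity>)"
    by (intro exI[of _ A]) (auto simp: subset_iff)
qed

text \<open>\<open>mfg_cost\<close> is infinite wherever this measurability fails, so it has to be
  secured for every curve. The integrand is jointly measurable in the other curve and time by
  \<open>Caratheodory_measurable\<close>; positions and velocities are collected in
  \<open>g\<close>.\<close>

lemma interaction_measurable:
  fixes h :: "real \<Rightarrow> 'a::euclidean_space \<Rightarrow> 'a \<Rightarrow> 'a \<Rightarrow> 'a \<Rightarrow> real"
  assumes meas: "\<And>x y p q. x \<in> X \<Longrightarrow> y \<in> X \<Longrightarrow> (\<lambda>t. h t x y p q) \<in> borel_measurable (lebesgue_on {0..})"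
    and cont: "AE t in lebesgue_on {0..}. continuous_on (X \<times> X \<times> UNIV \<times> UNIV) (\<lambda>(x, y, p, q). h t x y p q)"
    and \<gamma>: "\<gamma> \<in> curves X" and \<Xi>: "closed \<Xi>"
  shows "interaction \<Xi> h \<gamma> \<in> borel_measurable (curve_borel X)"
proof -
  interpret sigma_finite_measure "lebesgue :: real measure" by (rule sigma_finite_lebesgue)
  let ?M = "curve_borel X \<Otimes>\<^sub>M (lebesgue :: real measure)"
  let ?Z = "X \<times> X \<times> (UNIV :: 'a set) \<times> (UNIV :: 'a set)"
  have "AE t in lebesgue. t \<in> {0..} \<longrightarrow> continuous_on ?Z (\<lambda>(x, y, p, q). h t x y p q)"
    using cont by (subst (asm) AE_restrict_space_iff) auto
  then obtain N where N: "N \<in> null_sets lebesgue"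
      "\<And>t. 0 \<le> t \<Longrightarrow> t \<notin> N \<Longrightarrow> continuous_on ?Z (\<lambda>(x, y, p, q). h t x y p q)"
    by (auto simp: eventually_ae_filter)
  have [measurable]: "N \<in> sets lebesgue" using N(1) by auto
  \<comment> \<open>Time carries the Lebesgue sets, because \<open>h\<close> is assumed Lebesgue
    measurable in it; positions and velocities are jointly Borel measurable and are pulled back
    along this map.\<close>
  have to_borel: "(\<lambda>p. (fst p, snd p)) \<in> measurable ?M (curve_borel X \<Otimes>\<^sub>M borel)"
  proof (rule measurable_Pair)
    show "snd \<in> measurable ?M borel"
      by (rule measurable_compose[OF measurable_snd measurable_completion]) simp
  qed auto
  have snd_m[measurable]: "snd \<in> borel_measurable ?M"
    using measurable_compose[OF to_borel measurable_snd] by simp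
  have const: "(\<lambda>p. (\<gamma>, snd p)) \<in> measurable ?M (curve_borel X \<Otimes>\<^sub>M borel)"
    using \<gamma> by (intro measurable_Pair measurable_const snd_m) (auto simp: space_curve_borel)
  define v where "v = (\<lambda>p :: (real \<Rightarrow> 'a) \<times> real. if 0 < snd p then velocity (fst p) (snd p) else (0 :: 'a))"
  define e where "e = (\<lambda>p :: (real \<Rightarrow> 'a) \<times> real. fst p (max 0 (snd p)))"
  have v: "v \<in> borel_measurable (curve_borel X \<Otimes>\<^sub>M borel)"
    unfolding v_def by (rule velocity_joint_measurable)
  have e: "e \<in> borel_measurable (curve_borel X \<Otimes>\<^sub>M borel)"
    unfolding e_def by (rule eval_joint_measurable)
  have [measurable]: "v \<in> borel_measurable ?M" "e \<in> borel_measurable ?M"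
      "(\<lambda>p. v (\<gamma>, snd p)) \<in> borel_measurable ?M" "(\<lambda>p. e (\<gamma>, snd p)) \<in> borel_measurable ?M"
    using measurable_compose[OF to_borel v] measurable_compose[OF to_borel e]
      measurable_compose[OF const v] measurable_compose[OF const e] by simp_all
  define g where "g p = (e (\<gamma>, snd p), e p, v (\<gamma>, snd p), v p)" for p
  \<comment> \<open>Putting \<open>0\<close> on the null set where \<open>h\<close> is not known to
    be continuous makes \<open>f p\<close> continuous for every \<open>p\<close>. Times up to
    \<open>0\<close> are treated alike, as positions and velocities have been replaced
    there.\<close>
  define f where "f p = (\<lambda>(x, y, a, b). if snd p \<in> N \<or> snd p \<le> 0 then 0 else h (snd p) x y a b)" for p :: "(real \<Rightarrow> 'a) \<times> real"
  have fg: "(\<lambda>p. f p (g p)) \<in> borel_measurable ?M"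
  proof (rule Caratheodory_measurable[where Z = ?Z])
    fix z assume "z \<in> ?Z"
    then obtain x y a b where z: "z = (x, y, a, b)" "x \<in> X" "y \<in> X" by auto
    have "(\<lambda>t. if t \<in> {0..} then h t x y a b else 0) \<in> borel_measurable lebesgue"
      using meas[OF z(2,3), of a b] by (intro borel_measurable_if_I) auto
    then have [measurable]: "(\<lambda>p. if snd p \<in> {0..} then h (snd p) x y a b else 0) \<in> borel_measurable ?M"
      by (rule measurable_compose[OF measurable_snd])
    have "(\<lambda>p. f p z) = (\<lambda>p. if snd p \<in> N \<or> snd p \<le> 0 then 0 else if snd p \<in> {0..} then h (snd p) x y a b else 0)"
      by (auto simp: f_def z)
    also have "\<dots> \<in> borel_measurable ?M"
    proof -
      have [measurable]: "{p \<in> space ?M. snd p \<in> N} \<in> sets ?M"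
        using measurable_sets[OF measurable_snd[of "curve_borel X" lebesgue] \<open>N \<in> sets lebesgue\<close>]
        by (simp add: vimage_def Int_def conj_commute)
      show ?thesis by measurable
    qed
    finally show "(\<lambda>p. f p z) \<in> borel_measurable ?M" .
  next
    fix p assume "p \<in> space ?M"
    show "continuous_on ?Z (f p)"
    proof (cases "snd p \<in> N \<or> snd p \<le> 0")
      case True
      then have "f p = (\<lambda>_. 0)" by (auto simp: f_def)
      then show ?thesis by simp
    next
      case False
      then have "f p = (\<lambda>(x, y, a, b). h (snd p) x y a b)" by (auto simp: f_def)
      then show ?thesis using N(2)[of "snd p"] False by simp
    qed
  next
    show "g \<in> borel_measurable ?M" unfolding g_def by measurable
    show "g p \<in> ?Z" if "p \<in> space ?M" for p
      using that \<gamma> by (auto simp: g_def e_def space_pair_measure space_curve_borel intro!: curvesD(2))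
  qed
  note fg[measurable]
  have [measurable]: "(\<lambda>p. exit_time \<Xi> (fst p)) \<in> borel_measurable ?M"
    using exit_time_measurable[OF \<Xi>] by (rule measurable_compose[OF measurable_fst])
  have "(\<lambda>\<omega>. \<integral>\<^sup>+t. ennreal (f (\<omega>, t) (g (\<omega>, t))) *
      indicator {t. ennreal t \<le> min (exit_time \<Xi> \<gamma>) (exit_time \<Xi> \<omega>)} t \<partial>lebesgue) \<in> borel_measurable (curve_borel X)"
  proof (rule borel_measurable_nn_integral)
    have "(\<lambda>p. ennreal (f p (g p)) * (if ennreal (snd p) \<le> min (exit_time \<Xi> \<gamma>) (exit_time \<Xi> (fst p)) then 1 else 0))
      \<in> borel_measurable ?M" by measurable
    then show "(\<lambda>(\<omega>, t). ennreal (f (\<omega>, t) (g (\<omega>, t))) *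
      indicator {t. ennreal t \<le> min (exit_time \<Xi> \<gamma>) (exit_time \<Xi> \<omega>)} t) \<in> borel_measurable ?M"
      by (simp add: split_beta indicator_def of_bool_def)
  qed
  moreover have "interaction \<Xi> h \<gamma> = (\<lambda>\<omega>. \<integral>\<^sup>+t. ennreal (f (\<omega>, t) (g (\<omega>, t))) *
      indicator {t. ennreal t \<le> min (exit_time \<Xi> \<gamma>) (exit_time \<Xi> \<omega>)} t \<partial>lebesgue)"
    unfolding interaction_def fun_eq_iff
  proof (intro allI nn_integral_cong_AE)
    fix \<omega>
    have "{0} \<in> null_sets lebesgue" using null_sets_completionI[of "{0}" lborel] by simp
    then have "AE t in lebesgue. t \<notin> {0}" by (rule AE_not_in)
    with AE_not_in[OF N(1)] show "AE t in lebesgue. ennreal (h t (\<gamma> t) (\<omega> t) (velocity \<gamma> t) (velocity \<omega> t)) *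
      indicator {t. 0 \<le> t \<and> ennreal t \<le> min (exit_time \<Xi> \<gamma>) (exit_time \<Xi> \<omega>)} t =
      ennreal (f (\<omega>, t) (g (\<omega>, t))) * indicator {t. ennreal t \<le> min (exit_time \<Xi> \<gamma>) (exit_time \<Xi> \<omega>)} t"
    proof eventually_elim
      case (elim t)
      show ?case
      proof (cases "t > 0")
        case True
        then show ?thesis using elim by (simp add: f_def g_def e_def v_def indicator_def)
      next
        case False
        then show ?thesis using elim by (simp add: f_def g_def indicator_def)
      qed
    qed
  qed
  ultimately show ?thesis by (simp only:)
qed

subsection \<open>Lower semicontinuity of convex integrals\<close>

lemma powr_superlinear:
  fixes K \<eta> \<theta> :: real
  assumes "\<theta> > 1" "\<eta> > 0" "K \<ge> 0"
  obtains R where "R \<ge> 1" "\<And>r. r \<ge> R \<Longrightarrow> K * r \<le> \<eta> * r powr \<theta>"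
proof -
  \<comment> \<open>The second entry solves \<open>K = \<eta> * r powr (\<theta> - 1)\<close> for
    \<open>r\<close>; beyond it the power outgrows the linear function.\<close>
  define R where "R = max 1 ((K / \<eta>) powr (1 / (\<theta> - 1)))"
  show ?thesis
  proof
    show "R \<ge> 1" by (simp add: R_def)
    fix r assume r: "r \<ge> R"
    then have r1: "r \<ge> 1" by (simp add: R_def)
    have "K / \<eta> = ((K / \<eta>) powr (1 / (\<theta> - 1))) powr (\<theta> - 1)"
      using assms by (simp add: powr_powr)
    also have "\<dots> \<le> r powr (\<theta> - 1)" using r assms by (intro powr_mono2) (auto simp: R_def)
    finally have "K \<le> \<eta> * r powr (\<theta> - 1)" using assms by (simp add: field_simps)
    then have "K * r \<le> \<eta> * r powr (\<theta> - 1) * r" using r1 by (intro mult_right_mono) auto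
    also have "\<dots> = \<eta> * r powr \<theta>" using r1 by (simp add: powr_diff)
    finally show "K * r \<le> \<eta> * r powr \<theta>" .
  qed
qed

text \<open>The point \<open>(u, \<phi> u - \<epsilon>)\<close> lies below the graph and is strictly
  separated from the closed convex epigraph. The vertical component \<open>\<sigma>\<close> of the
  normal is positive, because \<open>(u, \<phi> u)\<close> lies straight above that point on the
  other side; dividing by it gives the affine function.\<close>

lemma convex_affine_minorant:
  fixes \<phi> :: "'a::euclidean_space \<Rightarrow> real"
  assumes conv: "convex_on UNIV \<phi>" and cont: "continuous_on UNIV \<phi>" and "\<epsilon> > 0"
  obtains q c where "\<And>p. c + q \<bullet> p < \<phi> p" "\<phi> u - \<epsilon> < c + q \<bullet> u"
proof -
  define S where "S = {z. \<phi> (fst z) \<le> snd z}"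
  have "convex S"
  proof (rule convexI)
    fix x y :: "'a \<times> real" and a b :: real
    assume *: "x \<in> S" "y \<in> S" "0 \<le> a" "0 \<le> b" "a + b = 1"
    have "\<phi> (a *\<^sub>R fst x + b *\<^sub>R fst y) \<le> a * \<phi> (fst x) + b * \<phi> (fst y)"
      using convex_onD[OF conv, of b "fst x" "fst y"] * by (auto simp: eq_diff_eq[symmetric])
    also have "\<dots> \<le> a * snd x + b * snd y"
      using * by (intro add_mono mult_left_mono) (auto simp: S_def)
    finally show "a *\<^sub>R x + b *\<^sub>R y \<in> S" by (simp add: S_def)
  qed
  moreover have "closed S"
    unfolding S_def
    by (intro closed_Collect_le continuous_on_compose2[OF cont] continuous_intros) auto
  moreover have "(u, \<phi> u - \<epsilon>) \<notin> S" using \<open>\<epsilon> > 0\<close> by (simp add: S_def)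
  ultimately have "\<exists>w d. w \<bullet> (u, \<phi> u - \<epsilon>) < d \<and> (\<forall>z\<in>S. w \<bullet> z > d)"
    by (rule separating_hyperplane_closed_point)
  then obtain w d where wd: "w \<bullet> (u, \<phi> u - \<epsilon>) < d" "\<forall>z\<in>S. w \<bullet> z > d" by blast
  obtain a \<sigma> where w: "w = (a, \<sigma>)" by (cases w)
  have S: "(p, \<phi> p) \<in> S" for p by (simp add: S_def)
  have below: "a \<bullet> p + \<sigma> * \<phi> p > d" for p using bspec[OF wd(2) S[of p]] by (simp add: w)
  have at: "a \<bullet> u + \<sigma> * (\<phi> u - \<epsilon>) < d" using wd(1) by (simp add: w)
  have "\<sigma> * \<epsilon> > 0" using below[of u] at by (simp add: algebra_simps)
  then have \<sigma>: "\<sigma> > 0" using \<open>\<epsilon> > 0\<close> by (simp add: zero_less_mult_iff)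
  show ?thesis
  proof
    show "d / \<sigma> + (- (a /\<^sub>R \<sigma>)) \<bullet> p < \<phi> p" for p
      using below[of p] \<sigma> by (simp add: field_simps)
    show "\<phi> u - \<epsilon> < d / \<sigma> + (- (a /\<^sub>R \<sigma>)) \<bullet> u"
      using at \<sigma> by (simp add: field_simps)
  qed
qed

text \<open>The superlinear term makes an affine minorant at \<open>x\<close> robust under perturbations of both \<open>x\<close> and
  its coefficients, which therefore range over a countable set.\<close>

lemma robust_affine_minorant:
  fixes f :: "'a::euclidean_space \<Rightarrow> 'a \<Rightarrow> real"
  assumes X: "compact X" "x \<in> X"
    and cont: "continuous_on (X \<times> UNIV) (\<lambda>(x, p). f x p)" and conv: "convex_on UNIV (f x)"
    and nonneg: "\<And>y p. y \<in> X \<Longrightarrow> 0 \<le> f y p"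
    and "\<eta> > 0" "\<theta> > 1" "\<epsilon> > 0"
    and dense: "\<And>z e. e > 0 \<Longrightarrow> \<exists>w\<in>D. dist w z < e"
  obtains q c m where "(q, c) \<in> D"
    "\<And>y p. y \<in> X \<Longrightarrow> dist y x < inverse (real (Suc m)) \<Longrightarrow> c + q \<bullet> p \<le> f y p + \<eta> * norm p powr \<theta>"
    "f x u - \<epsilon> < c + q \<bullet> u"
proof -
  have cont_x: "continuous_on UNIV (f x)"
  proof -
    have "continuous_on UNIV (\<lambda>p. (\<lambda>(x, p). f x p) (x, p))"
      using X(2) by (intro continuous_on_compose2[OF cont]) (auto intro!: continuous_intros)
    then show ?thesis by simp
  qed
  obtain q0 c0 where q0: "\<And>p. c0 + q0 \<bullet> p < f x p" "f x u - \<epsilon> / 2 < c0 + q0 \<bullet> u"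
    using convex_affine_minorant[OF conv cont_x, of "\<epsilon> / 2"] \<open>\<epsilon> > 0\<close> by (metis half_gt_zero)
  \<comment> \<open>For \<open>norm p \<ge> 1\<close> an affine function whose coefficients are
    within \<open>1\<close> of those of \<open>c0\<close> and \<open>q0\<close> is at most this
    constant times \<open>norm p\<close>. Beyond \<open>R\<close> the superlinear term alone
    therefore dominates it.\<close>
  obtain R where R: "R \<ge> 1" "\<And>r. r \<ge> R \<Longrightarrow> (\<bar>c0\<bar> + norm q0 + 2) * r \<le> \<eta> * r powr \<theta>"
    using powr_superlinear[OF \<open>\<theta> > 1\<close> \<open>\<eta> > 0\<close>, of "\<bar>c0\<bar> + norm q0 + 2"] by (metis abs_ge_zero add_nonneg_nonneg norm_ge_zero zero_le_numeral)
  \<comment> \<open>On the ball the strict inequality leaves a gap \<open>\<mu>\<close> by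
    compactness; one half of it pays for moving the position, the other for changing the
    coefficients.\<close>
  obtain \<mu> where \<mu>: "\<mu> > 0" "\<And>p. norm p \<le> R \<Longrightarrow> \<mu> \<le> f x p - (c0 + q0 \<bullet> p)"
  proof -
    have "\<exists>p0\<in>cball 0 R. \<forall>p\<in>cball 0 R. f x p0 - (c0 + q0 \<bullet> p0) \<le> f x p - (c0 + q0 \<bullet> p)"
      using R(1) by (intro continuous_attains_inf continuous_intros continuous_on_subset[OF cont_x]) auto
    then show ?thesis using that q0(1) by (metis diff_gt_0_iff_gt mem_cball_0)
  qed
  have "uniformly_continuous_on (X \<times> cball 0 R) (\<lambda>(x, p). f x p)"
    using X(1) by (intro compact_uniformly_continuous continuous_on_subset[OF cont] compact_Times) auto
  then obtain \<delta> where \<delta>: "\<delta> > 0" "\<And>z z'. z \<in> X \<times> cball 0 R \<Longrightarrow> z' \<in> X \<times> cball 0 R \<Longrightarrow> dist z' z < \<delta> \<Longrightarrow>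
      dist ((\<lambda>(x, p). f x p) z') ((\<lambda>(x, p). f x p) z) < \<mu> / 2"
    unfolding uniformly_continuous_on_def using \<mu>(1) by (meson half_gt_zero)
  obtain m where m: "inverse (real (Suc m)) < \<delta>" using reals_Archimedean[OF \<delta>(1)] by auto
  \<comment> \<open>Each bound has its task: \<open>1\<close> serves large \<open>p\<close>, the
    second keeps the change of the affine function on the ball within half the gap, the third keeps
    the loss at \<open>u\<close> within \<open>\<epsilon> / 2\<close>.\<close>
  define r where "r = min 1 (min (\<mu> / (2 * (1 + R))) (\<epsilon> / (2 * (1 + norm u))))"
  have u1: "1 + norm u > 0" by (rule add_pos_nonneg) auto
  have r01: "r > 0" "r \<le> 1" using R(1) \<mu>(1) \<open>\<epsilon> > 0\<close> u1 by (auto simp: r_def)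
  have "r \<le> \<mu> / (2 * (1 + R))" "r \<le> \<epsilon> / (2 * (1 + norm u))" by (simp_all add: r_def)
  then have "r * (2 * (1 + R)) \<le> \<mu>" "r * (2 * (1 + norm u)) \<le> \<epsilon>"
    using R(1) u1 by (simp_all add: pos_le_divide_eq)
  then have r: "r > 0" "r \<le> 1" "r * (1 + R) \<le> \<mu> / 2" "r * (1 + norm u) \<le> \<epsilon> / 2"
    using r01 by (simp_all add: algebra_simps)
  obtain w where w: "w \<in> D" "dist w (q0, c0) < r" using dense[OF r(1)] by blast
  obtain q c where qc: "w = (q, c)" by (cases w)
  have q: "norm (q - q0) \<le> r" "\<bar>c - c0\<bar> \<le> r"
    using w(2) dist_fst_le[of w "(q0, c0)"] dist_snd_le[of w "(q0, c0)"]
    by (auto simp: qc dist_norm)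
  have close: "\<bar>(c + q \<bullet> p) - (c0 + q0 \<bullet> p)\<bar> \<le> r * (1 + norm p)" for p
  proof -
    have "\<bar>(c + q \<bullet> p) - (c0 + q0 \<bullet> p)\<bar> \<le> \<bar>c - c0\<bar> + \<bar>(q - q0) \<bullet> p\<bar>" by (simp add: inner_diff_left)
    also have "\<bar>(q - q0) \<bullet> p\<bar> \<le> norm (q - q0) * norm p" by (rule Cauchy_Schwarz_ineq2)
    also have "\<dots> \<le> r * norm p" using q(1) by (intro mult_right_mono) auto
    finally show ?thesis using q(2) by (simp add: algebra_simps)
  qed
  show ?thesis
  proof
    show "(q, c) \<in> D" using w(1) qc by simp
    show "f x u - \<epsilon> < c + q \<bullet> u" using q0(2) close[of u] r(4) by linarith
    fix y p assume y: "y \<in> X" "dist y x < inverse (real (Suc m))"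
    show "c + q \<bullet> p \<le> f y p + \<eta> * norm p powr \<theta>"
    proof (cases "norm p \<le> R")
      case True
      have "dist (f y p) (f x p) < \<mu> / 2"
        using \<delta>(2)[of "(x, p)" "(y, p)"] X y m True by (simp add: dist_Pair_Pair)
      moreover have "r * (1 + norm p) \<le> r * (1 + R)" using True r(1) by simp
      ultimately have "c + q \<bullet> p \<le> f y p"
        using close[of p] \<mu>(2)[OF True] r(3) unfolding dist_real_def by linarith
      then show ?thesis using \<open>\<eta> > 0\<close> by (simp add: add_increasing2)
    next
      case False
      then have p: "norm p \<ge> R" "norm p \<ge> 1" using R(1) by auto
      have "q0 \<bullet> p \<le> norm q0 * norm p" by (rule norm_cauchy_schwarz)
      moreover have "\<bar>c0\<bar> * 1 \<le> \<bar>c0\<bar> * norm p" using p by (intro mult_left_mono) auto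
      moreover have "r * (1 + norm p) \<le> 1 * (1 + norm p)" using r p by (intro mult_right_mono) auto
      ultimately have "c + q \<bullet> p \<le> (\<bar>c0\<bar> + norm q0 + 2) * norm p"
        using close[of p] p by (simp add: algebra_simps)
      also have "\<dots> \<le> \<eta> * norm p powr \<theta>" by (rule R(2)[OF p(1)])
      finally show ?thesis using nonneg[OF y(1), of p] by simp
    qed
  qed
qed

lemma ennreal_integral_le_nn_integral:
  assumes "integrable M f"
  shows "ennreal (integral\<^sup>L M f) \<le> (\<integral>\<^sup>+x. ennreal (f x) \<partial>M)"
proof -
  have "integral\<^sup>L M f \<le> (\<integral>x. max 0 (f x) \<partial>M)" using assms by (intro integral_mono) auto
  then have "ennreal (integral\<^sup>L M f) \<le> ennreal (\<integral>x. max 0 (f x) \<partial>M)" by (rule ennreal_leI)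
  also have "\<dots> = (\<integral>\<^sup>+x. ennreal (max 0 (f x)) \<partial>M)"
    using assms by (intro nn_integral_eq_integral[symmetric]) auto
  also have "\<dots> = (\<integral>\<^sup>+x. ennreal (f x) \<partial>M)"
    by (intro nn_integral_cong) (simp add: max_def ennreal_neg)
  finally show ?thesis .
qed

text \<open>This inequality, with \<open>\<kappa>\<close> free, takes the place of Hoelder's inequality below.\<close>

lemma powr_Young:
  fixes r \<kappa> \<theta> :: real
  assumes "\<kappa> > 0" "\<theta> \<ge> 1" "r \<ge> 0"
  shows "r \<le> \<kappa> + \<kappa> powr (1 - \<theta>) * r powr \<theta>"
proof (cases "r \<le> \<kappa>")
  case True
  then show ?thesis by (simp add: add_increasing2)
next
  case False
  then have r: "r > 0" "r \<ge> \<kappa>" using assms by auto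
  have "r = r powr (1 - \<theta>) * r powr \<theta>" using r(1) by (simp add: powr_add[symmetric])
  also have "\<dots> \<le> \<kappa> powr (1 - \<theta>) * r powr \<theta>"
    using assms r by (intro mult_right_mono powr_mono2') auto
  finally show ?thesis using assms by simp
qed

text \<open>The Young inequality \<open>powr_Young\<close> with \<open>\<kappa> = 1\<close>;
  constants are integrable for a finite measure.\<close>

lemma (in finite_measure) integrable_powr_bound:
  fixes u :: "'a \<Rightarrow> 'b::euclidean_space"
  assumes [measurable]: "u \<in> borel_measurable M" and "\<theta> \<ge> 1"
    and fin: "(\<integral>\<^sup>+t. ennreal (norm (u t) powr \<theta>) \<partial>M) < \<infinity>"
  shows "integrable M u"
proof (rule integrableI_bounded)
  have "(\<integral>\<^sup>+t. ennreal (norm (u t)) \<partial>M) \<le> (\<integral>\<^sup>+t. 1 + ennreal (norm (u t) powr \<theta>) \<partial>M)"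
    using powr_Young[of 1 \<theta>] \<open>\<theta> \<ge> 1\<close>
    by (intro nn_integral_mono) (simp add: ennreal_1[symmetric] ennreal_plus[symmetric] del: ennreal_1 ennreal_plus)
  also have "\<dots> = emeasure M (space M) + (\<integral>\<^sup>+t. ennreal (norm (u t) powr \<theta>) \<partial>M)"
    by (subst nn_integral_add) auto
  also have "\<dots> < \<infinity>" using fin by (simp add: less_top[symmetric])
  finally show "(\<integral>\<^sup>+t. ennreal (norm (u t)) \<partial>M) < \<infinity>" .
qed fact

text \<open>Up to the small term \<open>\<eta> |p|\<^sup>\<theta>\<close>, the integrand at \<open>x t\<close> is a supremum of countably many affine
  functions of \<open>p\<close>, the \<open>j\<close>-th of which is a minorant for all positions near \<open>x t\<close> if \<open>t \<in> A j\<close>. Splitting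
  the domain according to which of the first \<open>N\<close> is the largest leaves integrals that are linear in the
  velocity, and these converge weakly.\<close>

theorem (in finite_measure) convex_integral_lsc:
  fixes L :: "'a \<Rightarrow> 'b::euclidean_space \<Rightarrow> 'b \<Rightarrow> real"
  assumes X: "compact X"
    and L_meas: "\<And>x p. x \<in> X \<Longrightarrow> (\<lambda>t. L t x p) \<in> borel_measurable M"
    and L_cont: "AE t in M. continuous_on (X \<times> UNIV) (\<lambda>(x, p). L t x p)"
    and L_conv: "AE t in M. \<forall>x\<in>X. convex_on UNIV (L t x)"
    and L_nonneg: "\<And>t x p. t \<in> space M \<Longrightarrow> x \<in> X \<Longrightarrow> 0 \<le> L t x p"
    and x: "x \<in> borel_measurable M" "\<And>t. t \<in> space M \<Longrightarrow> x t \<in> X" "\<And>n t. t \<in> space M \<Longrightarrow> xs n t \<in> X"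
    and unif: "\<And>\<epsilon>. \<epsilon> > 0 \<Longrightarrow> eventually (\<lambda>n. \<forall>t\<in>space M. dist (xs n t) (x t) < \<epsilon>) sequentially"
    and us: "\<And>n. us n \<in> borel_measurable M" and u: "integrable M u"
    and \<theta>: "\<theta> > 1" and energy: "\<And>n. (\<integral>\<^sup>+t. ennreal (norm (us n t) powr \<theta>) \<partial>M) \<le> ennreal E"
    and weak: "\<And>B. B \<in> sets M \<Longrightarrow> (\<lambda>n. LINT t:B|M. us n t) \<longlonglongrightarrow> (LINT t:B|M. u t)"
  shows "(\<integral>\<^sup>+t. ennreal (L t (x t) (u t)) \<partial>M) \<le> liminf (\<lambda>n. \<integral>\<^sup>+t. ennreal (L t (xs n t) (us n t)) \<partial>M)"
proof -
  note x(1)[measurable] us[measurable]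
  have um[measurable]: "u \<in> borel_measurable M" using u by auto
  have us_int: "integrable M (us n)" for n
    using energy[of n] \<theta> by (intro integrable_powr_bound[of _ \<theta>]) (auto intro: le_less_trans)
  have main: "(\<integral>\<^sup>+t. ennreal (L t (x t) (u t)) \<partial>M) \<le>
      liminf (\<lambda>n. \<integral>\<^sup>+t. ennreal (L t (xs n t) (us n t)) \<partial>M) + ennreal (\<eta> * E)" if \<eta>: "\<eta> > 0" for \<eta>
  proof -
    obtain D :: "('b \<times> real) set" where D: "countable D" "\<And>S. open S \<Longrightarrow> S \<noteq> {} \<Longrightarrow> \<exists>d\<in>D. d \<in> S"
      using countable_dense_setE by blast
    have D_dense: "\<exists>w\<in>D. dist w z < e" if "e > 0" for z e
      using D(2)[of "ball z e"] that by (auto simp: dist_commute)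
    have D_ne: "D \<times> (UNIV :: nat set) \<noteq> {}" using D_dense[of 1] by auto
    \<comment> \<open>Enumerates the coefficients of affine functions together with an index
      \<open>m\<close> for the radius \<open>1 / (m + 1)\<close> around the position within which
      they are to be minorants.\<close>
    define J where "J = from_nat_into (D \<times> (UNIV :: nat set))"
    define q where "q j = fst (fst (J j))" for j
    define c where "c j = snd (fst (J j))" for j
    define m where "m j = snd (J j)" for j
    have J_surj: "\<exists>j. q j = q' \<and> c j = c' \<and> m j = m'" if "(q', c') \<in> D" for q' c' m'
    proof -
      have "((q', c'), m') \<in> D \<times> (UNIV :: nat set)" using that by simp
      then obtain j where "J j = ((q', c'), m')"
        using from_nat_into_surj[of "D \<times> (UNIV :: nat set)" "((q', c'), m')"] D(1) by (auto simp: J_def)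
      then show ?thesis by (intro exI[of _ j]) (simp add: q_def c_def m_def)
    qed
    \<comment> \<open>Testing countably many positions and velocities makes \<open>A j\<close>
      measurable; in \<open>A_all\<close> continuity of the integrand extends the inequality to all
      of them.\<close>
    obtain Y where Y: "countable Y" "Y \<subseteq> X" "X \<subseteq> closure Y" by (rule separable)
    obtain P :: "'b set" where P: "countable P" "UNIV \<subseteq> closure P" by (rule separable[of UNIV])
    define A where "A j = {t \<in> space M. \<forall>y\<in>Y. \<forall>p\<in>P. dist y (x t) < inverse (real (Suc (m j))) \<longrightarrow>
        c j + q j \<bullet> p \<le> L t y p + \<eta> * norm p powr \<theta>}" for j
    have A_meas[measurable]: "A j \<in> sets M" for j
    proof -
      have "Measurable.pred M (\<lambda>t. dist y (x t) < inverse (real (Suc (m j))) \<longrightarrow>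
          c j + q j \<bullet> p \<le> L t y p + \<eta> * norm p powr \<theta>)" if "y \<in> Y" "p \<in> P" for y p
      proof -
        have [measurable]: "(\<lambda>t. L t y p) \<in> borel_measurable M" using L_meas that Y(2) by auto
        show ?thesis by measurable
      qed
      then show ?thesis
        unfolding A_def by (intro sets.sets_Collect_countable_All' Y(1) P(1) predE)
    qed
    define a where "a j t = (if t \<in> A j then max 0 (c j + q j \<bullet> u t) else 0)" for j t
    have [measurable]: "a j \<in> borel_measurable M" for j unfolding a_def by measurable
    have a_nonneg: "0 \<le> a j t" for j t by (simp add: a_def)
    have A_all: "AE t in M. \<forall>j. t \<in> A j \<longrightarrow> (\<forall>y\<in>X. \<forall>p. dist y (x t) < inverse (real (Suc (m j))) \<longrightarrow>
        c j + q j \<bullet> p \<le> L t y p + \<eta> * norm p powr \<theta>)"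
      using L_cont
    proof eventually_elim
      case (elim t)
      show ?case
      proof (intro allI impI ballI)
        fix j y p assume t: "t \<in> A j" and y: "y \<in> X" "dist y (x t) < inverse (real (Suc (m j)))"
        have "y \<in> closure Y" "p \<in> closure P" using Y(3) P(2) y by auto
        then obtain ys ps where ys: "\<And>n. ys n \<in> Y" "ys \<longlonglongrightarrow> y" and ps: "\<And>n. ps n \<in> P" "ps \<longlonglongrightarrow> p"
          unfolding closure_sequential by blast
        have lim: "(\<lambda>n. L t (ys n) (ps n)) \<longlonglongrightarrow> L t y p"
          using continuous_on_tendsto_compose[OF elim tendsto_Pair[OF ys(2) ps(2)]] y(1) subsetD[OF Y(2) ys(1)]
          by simp
        \<comment> \<open>The condition on the radius is open, so the approximating positions
          inherit it eventually.\<close>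
        have ev: "\<forall>\<^sub>F n in sequentially. dist (ys n) (x t) < inverse (real (Suc (m j)))"
          by (rule order_tendstoD(2)[OF tendsto_dist[OF ys(2) tendsto_const] y(2)])
        have "(\<lambda>n. L t (ys n) (ps n) + \<eta> * norm (ps n) powr \<theta> - (c j + q j \<bullet> ps n)) \<longlonglongrightarrow>
            L t y p + \<eta> * norm p powr \<theta> - (c j + q j \<bullet> p)"
          using \<theta> by (intro tendsto_intros lim ps(2) tendsto_powr2) auto
        then have "0 \<le> L t y p + \<eta> * norm p powr \<theta> - (c j + q j \<bullet> p)"
        proof (rule tendsto_lowerbound)
          show "\<forall>\<^sub>F n in sequentially. 0 \<le> L t (ys n) (ps n) + \<eta> * norm (ps n) powr \<theta> - (c j + q j \<bullet> ps n)"
            using ev by eventually_elim (use t ys(1) ps(1) in \<open>auto simp: A_def\<close>)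
        qed simp
        then show "c j + q j \<bullet> p \<le> L t y p + \<eta> * norm p powr \<theta>" by simp
      qed
    qed
    have L_sup: "AE t in M. ennreal (L t (x t) (u t)) \<le> (SUP j. ennreal (a j t))"
      using L_cont L_conv AE_space
    proof eventually_elim
      case (elim t)
      show ?case
      proof (rule ennreal_le_epsilon)
        fix e :: real assume e: "e > 0"
        obtain q' c' m' where *: "(q', c') \<in> D"
          "\<And>y p. y \<in> X \<Longrightarrow> dist y (x t) < inverse (real (Suc m')) \<Longrightarrow> c' + q' \<bullet> p \<le> L t y p + \<eta> * norm p powr \<theta>"
          "L t (x t) (u t) - e < c' + q' \<bullet> u t"
          using robust_affine_minorant[OF X x(2)[OF elim(3)] elim(1) _ L_nonneg[OF elim(3)] \<eta> \<theta> e D_dense]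
            elim(2) x(2)[OF elim(3)] by metis
        obtain j where j: "q j = q'" "c j = c'" "m j = m'" using J_surj[OF *(1)] by blast
        have "t \<in> A j" using *(2) Y(2) elim(3) by (auto simp: A_def j)
        then have "L t (x t) (u t) \<le> a j t + e" using *(3) by (auto simp: a_def j)
        then have "ennreal (L t (x t) (u t)) \<le> ennreal (a j t) + ennreal e"
          using a_nonneg e by (metis ennreal_leI ennreal_plus less_imp_le)
        also have "\<dots> \<le> (SUP j. ennreal (a j t)) + ennreal e" by (intro add_right_mono SUP_upper) auto
        finally show "ennreal (L t (x t) (u t)) \<le> (SUP j. ennreal (a j t)) + ennreal e" .
      qed
    qed
    define \<phi> where "\<phi> N t = (SUP j\<in>{..N}. ennreal (a j t))" for N :: nat and t
    have [measurable]: "\<phi> N \<in> borel_measurable M" for N unfolding \<phi>_def by measurable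
    have \<phi>_le: "(\<integral>\<^sup>+t. \<phi> N t \<partial>M) \<le>
        liminf (\<lambda>n. \<integral>\<^sup>+t. ennreal (L t (xs n t) (us n t)) \<partial>M) + ennreal (\<eta> * E)" for N
    proof -
      \<comment> \<open>For \<open>j \<le> N\<close> this is where \<open>j\<close> is the least
        index at which the first \<open>N + 1\<close> functions attain a positive maximum; breaking
        ties in this way makes the sets disjoint.\<close>
      define B where "B j = {t \<in> A j. 0 < a j t \<and> (\<forall>i<j. a i t < a j t) \<and> (\<forall>i\<le>N. a i t \<le> a j t)}" for j
      have B_meas[measurable]: "B j \<in> sets M" for j
      proof -
        have "B j = A j \<inter> {t \<in> space M. 0 < a j t \<and> (\<forall>i<j. a i t < a j t) \<and> (\<forall>i\<le>N. a i t \<le> a j t)}"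
          using A_meas[THEN sets.sets_into_space] by (auto simp: B_def)
        also have "\<dots> \<in> sets M" by measurable
        finally show ?thesis .
      qed
      have B_disj: "i = j" if "t \<in> B i" "t \<in> B j" "i \<le> N" "j \<le> N" for i j t
      proof (rule ccontr)
        have *: "\<forall>i<j. a i t < a j t" "\<forall>j<i. a j t < a i t" "a i t \<le> a j t" "a j t \<le> a i t"
          using that unfolding B_def by blast+
        assume "i \<noteq> j"
        then consider "i < j" | "j < i" by linarith
        then show False using * by cases (meson not_less)+
      qed
      \<comment> \<open>On each \<open>B j\<close> this is the affine function number
        \<open>j\<close> of the velocity, with \<open>B j\<close> determined by the limit
        \<open>u\<close> alone. The integral is therefore affine in \<open>v\<close>, and weak
        convergence applies.\<close>
      define \<psi> where "\<psi> v t = (\<Sum>j\<le>N. indicator (B j) t *\<^sub>R (c j + q j \<bullet> v t))" for v t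
      have \<psi>_in: "\<psi> v t = c j + q j \<bullet> v t" if "t \<in> B j" "j \<le> N" for v t j
      proof -
        have out: "t \<notin> B i" if "i \<le> N" "i \<noteq> j" for i
          using B_disj[OF \<open>t \<in> B j\<close> _ \<open>j \<le> N\<close> that(1)] that(2) by blast
        have "\<psi> v t = (\<Sum>i\<in>{j}. indicator (B i) t *\<^sub>R (c i + q i \<bullet> v t))"
          unfolding \<psi>_def using that(2) out
          by (intro sum.mono_neutral_right) (auto simp: indicator_def)
        then show ?thesis using that by simp
      qed
      have \<psi>_out: "\<psi> v t = 0" if "\<And>j. j \<le> N \<Longrightarrow> t \<notin> B j" for v t
        unfolding \<psi>_def using that by (intro sum.neutral) auto
      have \<psi>_int: "integrable M (\<psi> v)"
        "integral\<^sup>L M (\<psi> v) = (\<Sum>j\<le>N. c j * measure M (B j) + q j \<bullet> (LINT t:B j|M. v t))"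
        if v: "integrable M v" for v
      proof -
        have vB: "integrable M (\<lambda>t. indicator (B j) t *\<^sub>R v t)" for j
          using v by (intro integrable_mult_indicator) auto
        have eq: "\<psi> v = (\<lambda>t. \<Sum>j\<le>N. c j * indicator (B j) t + q j \<bullet> (indicator (B j) t *\<^sub>R v t))"
          by (auto simp: \<psi>_def algebra_simps intro!: sum.cong)
        have fin: "emeasure M (B j) < \<infinity>" for j by (simp add: less_top[symmetric])
        have cB: "integrable M (\<lambda>t. c j * indicator (B j) t)" for j
          using fin by (intro integrable_mult_right integrable_real_indicator) auto
        have qB: "integrable M (\<lambda>t. q j \<bullet> (indicator (B j) t *\<^sub>R v t))" for j
          using vB by (intro integrable_inner_right) auto
        show "integrable M (\<psi> v)"
          unfolding eq by (intro Bochner_Integration.integrable_sum Bochner_Integration.integrable_add cB qB)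
        show "integral\<^sup>L M (\<psi> v) = (\<Sum>j\<le>N. c j * measure M (B j) + q j \<bullet> (LINT t:B j|M. v t))"
          unfolding eq
          by (subst Bochner_Integration.integral_sum, rule Bochner_Integration.integrable_add[OF cB qB])
            (simp only: Bochner_Integration.integral_add[OF cB qB] integral_inner_right[OF vB]
              integral_mult_right_zero Bochner_Integration.integral_indicator set_lebesgue_integral_def sets.Int_space_eq2 B_meas)
      qed
      have "\<phi> N t \<le> ennreal (\<psi> u t)" for t
      proof (cases "\<exists>j\<le>N. 0 < a j t")
        case False
        then have "\<phi> N t \<le> 0" unfolding \<phi>_def by (intro SUP_least) (auto simp: not_less ennreal_neg)
        then show ?thesis by simp
      next
        case True
        define S where "S = Max ((\<lambda>j. a j t) ` {..N})"
        have S_in: "S \<in> (\<lambda>j. a j t) ` {..N}" unfolding S_def by (intro Max_in) auto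
        have S_ge: "a j t \<le> S" if "j \<le> N" for j unfolding S_def using that by (intro Max_ge) auto
        define j where "j = (LEAST j. a j t = S)"
        obtain i where i: "i \<le> N" "a i t = S" using S_in by (metis atMost_iff imageE)
        have j: "a j t = S" unfolding j_def by (rule LeastI[of "\<lambda>j. a j t = S", OF i(2)])
        have least: "a i t \<noteq> S" if "i < j" for i using not_less_Least[of i "\<lambda>j. a j t = S"] that by (simp add: j_def)
        have jN: "j \<le> N" using Least_le[of "\<lambda>j. a j t = S", OF i(2)] i(1) by (simp add: j_def)
        obtain k where "k \<le> N" "0 < a k t" using True by blast
        then have pos: "0 < a j t" using S_ge[of k] j by simp
        then have "t \<in> A j" by (cases "t \<in> A j") (simp_all add: a_def)
        have "a i t < S" if "i < j" for i using S_ge[of i] least[OF that] that jN by simp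
        then have tB: "t \<in> B j" using pos S_ge \<open>t \<in> A j\<close> unfolding B_def by (simp add: j)
        have "\<phi> N t \<le> ennreal S" unfolding \<phi>_def using S_ge by (intro SUP_least ennreal_leI) auto
        moreover have "S = c j + q j \<bullet> u t"
          using pos \<open>t \<in> A j\<close> unfolding j[symmetric] by (simp add: a_def max_def split: if_splits)
        ultimately show ?thesis using \<psi>_in[OF tB jN] by simp
      qed
      then have "(\<integral>\<^sup>+t. \<phi> N t \<partial>M) \<le> (\<integral>\<^sup>+t. ennreal (\<psi> u t) \<partial>M)" by (intro nn_integral_mono)
      also have "\<dots> = ennreal (integral\<^sup>L M (\<psi> u))"
      proof (rule nn_integral_eq_integral[OF \<psi>_int(1)[OF u]])
        have "0 \<le> \<psi> u t" for t
        proof (cases "\<exists>j\<le>N. t \<in> B j")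
          case True
          then obtain j where j: "j \<le> N" "t \<in> B j" by blast
          then have "0 < a j t" "t \<in> A j" by (auto simp: B_def)
          then show ?thesis using \<psi>_in[OF j(2,1), of u] by (auto simp: a_def split: if_splits)
        next
          case False
          then show ?thesis using \<psi>_out[of t u] by auto
        qed
        then show "AE t in M. 0 \<le> \<psi> u t" by simp
      qed
      also have "\<dots> = liminf (\<lambda>n. ennreal (integral\<^sup>L M (\<psi> (us n))))"
      proof (rule lim_imp_Liminf[symmetric])
        have "(\<lambda>n. integral\<^sup>L M (\<psi> (us n))) \<longlonglongrightarrow> integral\<^sup>L M (\<psi> u)"
          unfolding \<psi>_int(2)[OF u] \<psi>_int(2)[OF us_int] by (intro tendsto_intros weak) simp
        then show "(\<lambda>n. ennreal (integral\<^sup>L M (\<psi> (us n)))) \<longlonglongrightarrow> ennreal (integral\<^sup>L M (\<psi> u))"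
          by (rule tendsto_ennrealI)
      qed simp
      also have "\<dots> \<le> liminf (\<lambda>n. (\<integral>\<^sup>+t. ennreal (L t (xs n t) (us n t)) \<partial>M) + ennreal (\<eta> * E))"
      proof (rule Liminf_mono)
        \<comment> \<open>The smallest of finitely many radii: as soon as the positions are
          uniformly closer than this, all minorants in play are valid at
          \<open>xs n t\<close>.\<close>
        define \<rho> where "\<rho> = Min ((\<lambda>j. inverse (real (Suc (m j)))) ` {..N})"
        have \<rho>: "\<rho> > 0" unfolding \<rho>_def by (subst Min_gr_iff) auto
        have \<rho>_le: "\<rho> \<le> inverse (real (Suc (m j)))" if "j \<le> N" for j
          unfolding \<rho>_def using that by (intro Min_le) auto
        show "\<forall>\<^sub>F n in sequentially. ennreal (integral\<^sup>L M (\<psi> (us n))) \<le>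
            (\<integral>\<^sup>+t. ennreal (L t (xs n t) (us n t)) \<partial>M) + ennreal (\<eta> * E)"
          using unif[OF \<rho>]
        proof eventually_elim
          case (elim n)
          let ?I = "\<integral>t. norm (us n t) powr \<theta> \<partial>M"
          have e_int: "integrable M (\<lambda>t. norm (us n t) powr \<theta>)"
            using energy[of n] by (intro integrableI_nonneg) (auto intro: le_less_trans)
          have "ennreal ?I \<le> ennreal E"
            using energy[of n] nn_integral_eq_integral[OF e_int] by simp
          then have I_le: "ennreal (\<eta> * ?I) \<le> ennreal (\<eta> * E)"
            using \<eta> by (simp add: ennreal_mult' mult_left_mono)
          have I_nonneg: "0 \<le> \<eta> * ?I" using \<eta> by simp
          \<comment> \<open>Subtracting the price of robustness gives a pointwise minorant of the
            integrand at \<open>xs n t\<close> and \<open>us n t\<close>; the energy bound limits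
            the loss to \<open>\<eta> * E\<close>.\<close>
          let ?\<chi> = "\<lambda>t. \<psi> (us n) t - \<eta> * norm (us n t) powr \<theta>"
          have \<chi>: "integrable M ?\<chi>" "integral\<^sup>L M ?\<chi> = integral\<^sup>L M (\<psi> (us n)) - \<eta> * ?I"
            using \<psi>_int(1)[OF us_int[of n]] e_int by simp_all
          have "ennreal (integral\<^sup>L M (\<psi> (us n))) = ennreal (integral\<^sup>L M ?\<chi> + \<eta> * ?I)" by (simp add: \<chi>(2))
          also have "\<dots> \<le> ennreal (integral\<^sup>L M ?\<chi>) + ennreal (\<eta> * ?I)"
            using I_nonneg by (cases "0 \<le> integral\<^sup>L M ?\<chi>") (auto simp: ennreal_neg simp flip: ennreal_plus intro: ennreal_leI)
          also have "\<dots> \<le> (\<integral>\<^sup>+t. ennreal (?\<chi> t) \<partial>M) + ennreal (\<eta> * E)"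
            by (intro add_mono ennreal_integral_le_nn_integral \<chi>(1) I_le)
          also have "\<dots> \<le> (\<integral>\<^sup>+t. ennreal (L t (xs n t) (us n t)) \<partial>M) + ennreal (\<eta> * E)"
          proof (rule add_right_mono, rule nn_integral_mono_AE)
            show "AE t in M. ennreal (?\<chi> t) \<le> ennreal (L t (xs n t) (us n t))"
              using A_all AE_space
            proof eventually_elim
              case (elim t)
              have "?\<chi> t \<le> L t (xs n t) (us n t)"
              proof (cases "\<exists>j\<le>N. t \<in> B j")
                case True
                then obtain j where j: "j \<le> N" "t \<in> B j" by blast
                then have "t \<in> A j" by (auto simp: B_def)
                moreover have "dist (xs n t) (x t) < inverse (real (Suc (m j)))"
                  using \<open>\<forall>t\<in>space M. dist (xs n t) (x t) < \<rho>\<close> \<rho>_le[OF j(1)] elim(2) by (meson less_le_trans)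
                ultimately have "c j + q j \<bullet> us n t \<le> L t (xs n t) (us n t) + \<eta> * norm (us n t) powr \<theta>"
                  using elim(1) x(3)[OF elim(2)] by blast
                then show ?thesis using \<psi>_in[OF j(2,1), of "us n"] by simp
              next
                case False
                then have "\<psi> (us n) t = 0" by (intro \<psi>_out) auto
                moreover have "0 \<le> \<eta> * norm (us n t) powr \<theta>" using \<eta> by simp
                ultimately show ?thesis using L_nonneg[OF elim(2) x(3)[OF elim(2)], of n "us n t"] by simp
              qed
              then show ?case by (rule ennreal_leI)
            qed
          qed
          finally show ?case .
        qed
      qed
      also have "\<dots> = liminf (\<lambda>n. \<integral>\<^sup>+t. ennreal (L t (xs n t) (us n t)) \<partial>M) + ennreal (\<eta> * E)"
        by (rule Liminf_add_const) auto
      finally show ?thesis .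
    qed
    have "(\<integral>\<^sup>+t. ennreal (L t (x t) (u t)) \<partial>M) \<le> (\<integral>\<^sup>+t. (SUP N. \<phi> N t) \<partial>M)"
    proof (rule nn_integral_mono_AE)
      show "AE t in M. ennreal (L t (x t) (u t)) \<le> (SUP N. \<phi> N t)"
        using L_sup
      proof eventually_elim
        case (elim t)
        have "ennreal (a j t) \<le> (SUP N. \<phi> N t)" for j
          by (rule SUP_upper2[of j]) (auto simp: \<phi>_def intro: SUP_upper)
        then have "(SUP j. ennreal (a j t)) \<le> (SUP N. \<phi> N t)" by (intro SUP_least)
        with elim show ?case by simp
      qed
    qed
    also have "\<dots> = (SUP N. \<integral>\<^sup>+t. \<phi> N t \<partial>M)"
      by (rule nn_integral_monotone_convergence_SUP)
        (auto simp: incseq_def le_fun_def \<phi>_def intro!: SUP_subset_mono)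
    also have "\<dots> \<le> liminf (\<lambda>n. \<integral>\<^sup>+t. ennreal (L t (xs n t) (us n t)) \<partial>M) + ennreal (\<eta> * E)"
      by (intro SUP_least \<phi>_le)
    finally show ?thesis .
  qed
  show ?thesis
  proof (rule ennreal_le_epsilon)
    fix e :: real assume e: "e > 0"
    \<comment> \<open>The choice of \<open>\<eta>\<close>: its denominator is positive whatever
      \<open>E\<close> is, and the loss is at most \<open>e\<close>.\<close>
    have "(e / (\<bar>E\<bar> + 1)) * E \<le> e"
    proof -
      have "e * E \<le> e * (\<bar>E\<bar> + 1)" using e by (intro mult_left_mono) auto
      then show ?thesis by (simp add: field_simps add_pos_nonneg)
    qed
    then have "ennreal ((e / (\<bar>E\<bar> + 1)) * E) \<le> ennreal e" by (rule ennreal_leI)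
    moreover have "e / (\<bar>E\<bar> + 1) > 0" using e by (intro divide_pos_pos) auto
    ultimately show "(\<integral>\<^sup>+t. ennreal (L t (x t) (u t)) \<partial>M) \<le>
        liminf (\<lambda>n. \<integral>\<^sup>+t. ennreal (L t (xs n t) (us n t)) \<partial>M) + ennreal e"
      using main[of "e / (\<bar>E\<bar> + 1)"] by (meson add_left_mono order_trans)
  qed
qed

text \<open>At negative times a curve takes the value \<^const>\<open>undefined\<close> and at time \<open>0\<close> its two-sided derivative is
  meaningless; replacing the velocity by \<open>0\<close> there makes it Borel measurable and changes no integral over
  nonnegative times.\<close>

definition pos_velocity :: "(real \<Rightarrow> 'a::euclidean_space) \<Rightarrow> real \<Rightarrow> 'a" where
  "pos_velocity \<gamma> t = (if 0 < t then velocity \<gamma> t else 0)"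

definition energy :: "real \<Rightarrow> (real \<Rightarrow> 'a::euclidean_space) \<Rightarrow> ennreal" where
  "energy \<theta> \<gamma> = (\<integral>\<^sup>+t\<in>{0..}. ennreal (norm (velocity \<gamma> t) powr \<theta>) \<partial>lebesgue)"

lemma pos_velocity_borel: "\<gamma> \<in> curves X \<Longrightarrow> pos_velocity \<gamma> \<in> borel_measurable borel"
  using velocity_measurable[of \<gamma> X] by (simp add: pos_velocity_def[abs_def])

lemma pos_velocity_measurable: "\<gamma> \<in> curves X \<Longrightarrow> pos_velocity \<gamma> \<in> borel_measurable lebesgue"
  by (rule measurable_completion) (simp add: pos_velocity_borel)

lemma AE_lebesgue_neq: "AE t in lebesgue. t \<noteq> (a :: real)"
proof -
  have "{a} \<in> null_sets lebesgue" using null_sets_completionI[of "{a}" lborel] by simp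
  from AE_not_in[OF this] show ?thesis by simp
qed

lemma nn_integral_pos_velocity:
  assumes "A \<subseteq> {0..}"
  shows "(\<integral>\<^sup>+t\<in>A. F t (velocity \<gamma> t) \<partial>lebesgue) = (\<integral>\<^sup>+t\<in>A. F t (pos_velocity \<gamma> t) \<partial>lebesgue)"
proof (rule nn_integral_cong_AE)
  show "AE t in lebesgue. F t (velocity \<gamma> t) * indicator A t = F t (pos_velocity \<gamma> t) * indicator A t"
    using AE_lebesgue_neq[of 0] by eventually_elim (use assms in \<open>auto simp: pos_velocity_def indicator_def\<close>)
qed

lemma energy_pos_velocity: "energy \<theta> \<gamma> = (\<integral>\<^sup>+t\<in>{0..}. ennreal (norm (pos_velocity \<gamma> t) powr \<theta>) \<partial>lebesgue)"
  unfolding energy_def by (rule nn_integral_pos_velocity) simp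

section \<open>Increments controlled by the energy\<close>

lemma increment_le_nn_integral:
  assumes "abs_continuous_curve \<gamma>" "0 \<le> u" "u \<le> v"
  shows "ennreal (norm (\<gamma> v - \<gamma> u)) \<le> (\<integral>\<^sup>+t\<in>{u..v}. ennreal (norm (pos_velocity \<gamma> t)) \<partial>lebesgue)"
proof -
  have vi: "velocity_integral \<gamma> u v"
    using assms by (intro abs_continuous_on_velocity_integral) (auto simp: abs_continuous_curve_def)
  then have int: "velocity \<gamma> integrable_on {u..v}" "(\<lambda>t. norm (velocity \<gamma> t)) integrable_on {u..v}"
    by (auto simp: velocity_integral_def absolutely_integrable_on_def)
  have "\<gamma> v - \<gamma> u = integral {u..v} (velocity \<gamma>)"
    using vi by (auto simp: velocity_integral_def dest!: integral_unique)
  then have "norm (\<gamma> v - \<gamma> u) \<le> integral {u..v} (\<lambda>t. norm (velocity \<gamma> t))"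
    using integral_norm_bound_integral[OF int] by simp
  then have "ennreal (norm (\<gamma> v - \<gamma> u)) \<le> ennreal (integral {u..v} (\<lambda>t. norm (velocity \<gamma> t)))"
    by (rule ennreal_leI)
  also have "\<dots> = (\<integral>\<^sup>+t\<in>{u..v}. ennreal (norm (velocity \<gamma> t)) \<partial>lebesgue)"
    unfolding nn_integral_completion
    by (rule nn_integral_has_integral_lebesgue'[symmetric]) (use int(2) in auto)
  also have "\<dots> = (\<integral>\<^sup>+t\<in>{u..v}. ennreal (norm (pos_velocity \<gamma> t)) \<partial>lebesgue)"
    using assms by (intro nn_integral_pos_velocity) auto
  finally show ?thesis .
qed

lemma nn_integral_Young:
  fixes \<rho> :: "real \<Rightarrow> real"
  assumes [measurable]: "\<rho> \<in> borel_measurable lebesgue" "B \<in> sets lebesgue"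
    and \<rho>: "\<And>t. 0 \<le> \<rho> t" and "\<kappa> > 0" "\<theta> \<ge> 1"
  shows "(\<integral>\<^sup>+t\<in>B. ennreal (\<rho> t) \<partial>lebesgue) \<le>
    ennreal \<kappa> * emeasure lebesgue B + ennreal (\<kappa> powr (1 - \<theta>)) * (\<integral>\<^sup>+t\<in>B. ennreal (\<rho> t powr \<theta>) \<partial>lebesgue)"
proof -
  have "(\<integral>\<^sup>+t\<in>B. ennreal (\<rho> t) \<partial>lebesgue) \<le>
      (\<integral>\<^sup>+t. ennreal \<kappa> * indicator B t + ennreal (\<kappa> powr (1 - \<theta>)) * (ennreal (\<rho> t powr \<theta>) * indicator B t) \<partial>lebesgue)"
  proof (rule nn_integral_mono)
    fix t
    have "ennreal (\<rho> t) \<le> ennreal \<kappa> + ennreal (\<kappa> powr (1 - \<theta>)) * ennreal (\<rho> t powr \<theta>)"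
      using powr_Young[OF \<open>\<kappa> > 0\<close> \<open>\<theta> \<ge> 1\<close> \<rho>[of t]] \<open>\<kappa> > 0\<close>
      by (simp add: ennreal_mult[symmetric] ennreal_plus[symmetric] ennreal_leI del: ennreal_plus)
    then show "ennreal (\<rho> t) * indicator B t \<le>
        ennreal \<kappa> * indicator B t + ennreal (\<kappa> powr (1 - \<theta>)) * (ennreal (\<rho> t powr \<theta>) * indicator B t)"
      by (simp add: indicator_def)
  qed
  also have "\<dots> = ennreal \<kappa> * emeasure lebesgue B + ennreal (\<kappa> powr (1 - \<theta>)) * (\<integral>\<^sup>+t\<in>B. ennreal (\<rho> t powr \<theta>) \<partial>lebesgue)"
    by (subst nn_integral_add) (auto simp: nn_integral_cmult nn_integral_cmult_indicator)
  finally show ?thesis .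
qed

text \<open>Members of a division overlap in endpoints at most, so replacing them by their disjoint
  interiors costs a null set.\<close>

lemma sum_nn_integral_division:
  fixes D :: "real set set"
  assumes D: "D division_of S" and [measurable]: "f \<in> borel_measurable lebesgue"
  shows "(\<Sum>K\<in>D. \<integral>\<^sup>+t\<in>K. f t \<partial>lebesgue) \<le> (\<integral>\<^sup>+t\<in>S. f t \<partial>lebesgue)"
proof -
  have fin: "finite D" using D by (rule division_ofD(1))
  have int_meas: "interior K \<in> sets lebesgue" for K :: "real set" by (simp add: borel_open)
  have "(\<Sum>K\<in>D. \<integral>\<^sup>+t\<in>K. f t \<partial>lebesgue) = (\<Sum>K\<in>D. \<integral>\<^sup>+t\<in>interior K. f t \<partial>lebesgue)"
  proof (rule sum.cong[OF refl], rule nn_integral_cong_AE)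
    fix K assume K: "K \<in> D"
    obtain u v where uv: "K = {u..v}" using division_interval(1)[OF D K] by blast
    show "AE t in lebesgue. f t * indicator K t = f t * indicator (interior K) t"
      using AE_lebesgue_neq[of u] AE_lebesgue_neq[of v]
      by eventually_elim (auto simp: uv indicator_def)
  qed
  also have "\<dots> = (\<integral>\<^sup>+t. (\<Sum>K\<in>D. f t * indicator (interior K) t) \<partial>lebesgue)"
    by (intro nn_integral_sum[symmetric] borel_measurable_times_ennreal borel_measurable_indicator
        int_meas assms(2))
  also have "\<dots> \<le> (\<integral>\<^sup>+t\<in>S. f t \<partial>lebesgue)"
  proof (rule nn_integral_mono)
    fix t
    show "(\<Sum>K\<in>D. f t * indicator (interior K) t) \<le> f t * indicator S t"
    proof (cases "\<exists>K\<in>D. t \<in> interior K")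
      case True
      then obtain K where K: "K \<in> D" "t \<in> interior K" by blast
      then have "t \<in> S" using division_ofD(2)[OF D] interior_subset by blast
      have "t \<notin> interior K'" if "K' \<in> D" "K' \<noteq> K" for K'
        using division_ofD(5)[OF D K(1) that(1)] that(2) K(2) by auto
      then have "(\<Sum>K'\<in>D. f t * indicator (interior K') t) = (\<Sum>K'\<in>{K}. f t * indicator (interior K') t)"
        using fin K(1) by (intro sum.mono_neutral_right) (auto simp: indicator_def)
      then show ?thesis using \<open>t \<in> S\<close> K by simp
    next
      case False
      then have "(\<Sum>K\<in>D. f t * indicator (interior K) t) = 0" by (intro sum.neutral) auto
      then show ?thesis by simp
    qed
  qed
  finally show ?thesis .
qed

text \<open>For \<open>\<theta> > 1\<close> a large \<open>\<kappa>\<close> makes the last term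
  small, and a short total length then makes the other one small: a common energy bound gives
  uniform absolute continuity. A dominating speed \<open>\<rho>\<close> stands in for the velocity,
  so that the estimate also covers curves whose differentiability is not yet known.\<close>

lemma division_increments_le:
  fixes f :: "real \<Rightarrow> 'a::euclidean_space" and \<rho> :: "real \<Rightarrow> real"
  assumes [measurable]: "\<rho> \<in> borel_measurable lebesgue" and \<rho>: "\<And>t. 0 \<le> \<rho> t"
    and inc: "\<And>u v. 0 \<le> u \<Longrightarrow> u \<le> v \<Longrightarrow> ennreal (norm (f v - f u)) \<le> (\<integral>\<^sup>+t\<in>{u..v}. ennreal (\<rho> t) \<partial>lebesgue)"
    and en: "(\<integral>\<^sup>+t\<in>{0..}. ennreal (\<rho> t powr \<theta>) \<partial>lebesgue) \<le> ennreal E" and "0 \<le> E" "\<kappa> > 0" "\<theta> \<ge> 1"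
    and D: "D division_of S" "S \<subseteq> {0..}"
  shows "(\<Sum>K\<in>D. norm (f (Sup K) - f (Inf K))) \<le> \<kappa> * (\<Sum>K\<in>D. Sup K - Inf K) + \<kappa> powr (1 - \<theta>) * E"
proof -
  note int = division_interval[OF D(1)]
  have K: "0 \<le> Inf K" if "K \<in> D" for K
  proof -
    have "Inf K \<in> K" by (subst int(1)[OF that]) (use int(2)[OF that] in simp)
    then show ?thesis using division_ofD(2)[OF D(1) that] D(2) by auto
  qed
  have len: "0 \<le> (\<Sum>K\<in>D. Sup K - Inf K)" using int(2) by (intro sum_nonneg) auto
  have "ennreal (\<Sum>K\<in>D. norm (f (Sup K) - f (Inf K))) = (\<Sum>K\<in>D. ennreal (norm (f (Sup K) - f (Inf K))))" by simp
  also have "\<dots> \<le> (\<Sum>K\<in>D. ennreal \<kappa> * ennreal (Sup K - Inf K) +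
      ennreal (\<kappa> powr (1 - \<theta>)) * (\<integral>\<^sup>+t\<in>K. ennreal (\<rho> t powr \<theta>) \<partial>lebesgue))"
  proof (rule sum_mono)
    fix K assume KD: "K \<in> D"
    have "ennreal (norm (f (Sup K) - f (Inf K))) \<le> (\<integral>\<^sup>+t\<in>{Inf K..Sup K}. ennreal (\<rho> t) \<partial>lebesgue)"
      using K[OF KD] int(2)[OF KD] by (rule inc)
    also have "\<dots> \<le> ennreal \<kappa> * emeasure lebesgue {Inf K..Sup K} +
        ennreal (\<kappa> powr (1 - \<theta>)) * (\<integral>\<^sup>+t\<in>{Inf K..Sup K}. ennreal (\<rho> t powr \<theta>) \<partial>lebesgue)"
      using \<rho> assms(6,7) by (intro nn_integral_Young) auto
    finally show "ennreal (norm (f (Sup K) - f (Inf K))) \<le> ennreal \<kappa> * ennreal (Sup K - Inf K) +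
      ennreal (\<kappa> powr (1 - \<theta>)) * (\<integral>\<^sup>+t\<in>K. ennreal (\<rho> t powr \<theta>) \<partial>lebesgue)"
      unfolding int(1)[OF KD, symmetric] using int(2)[OF KD] by (subst (asm) int(1)[OF KD]) simp
  qed
  also have "\<dots> = ennreal \<kappa> * ennreal (\<Sum>K\<in>D. Sup K - Inf K) +
      ennreal (\<kappa> powr (1 - \<theta>)) * (\<Sum>K\<in>D. \<integral>\<^sup>+t\<in>K. ennreal (\<rho> t powr \<theta>) \<partial>lebesgue)"
    using int(2) by (simp add: sum.distrib sum_distrib_left[symmetric])
  also have "\<dots> \<le> ennreal \<kappa> * ennreal (\<Sum>K\<in>D. Sup K - Inf K) + ennreal (\<kappa> powr (1 - \<theta>)) * ennreal E"
  proof -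
    have "(\<Sum>K\<in>D. \<integral>\<^sup>+t\<in>K. ennreal (\<rho> t powr \<theta>) \<partial>lebesgue) \<le> (\<integral>\<^sup>+t\<in>S. ennreal (\<rho> t powr \<theta>) \<partial>lebesgue)"
      by (rule sum_nn_integral_division[OF D(1)]) measurable
    also have "\<dots> \<le> (\<integral>\<^sup>+t\<in>{0..}. ennreal (\<rho> t powr \<theta>) \<partial>lebesgue)"
      using D(2) by (intro nn_integral_mono) (auto simp: indicator_def)
    also note en
    finally show ?thesis by (intro add_left_mono mult_left_mono) auto
  qed
  also have "\<dots> = ennreal (\<kappa> * (\<Sum>K\<in>D. Sup K - Inf K) + \<kappa> powr (1 - \<theta>) * E)"
    using len assms(5,6) by (simp add: ennreal_mult[symmetric] ennreal_plus[symmetric] del: ennreal_plus)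
  finally show ?thesis using len assms(5,6) by (subst (asm) ennreal_le_iff) auto
qed

lemma powr_coefficient_small:
  fixes E e \<theta> :: real
  assumes "0 \<le> E" "e > 0" "\<theta> > 1"
  obtains \<kappa> where "\<kappa> > 0" "\<kappa> powr (1 - \<theta>) * E < e"
proof
  \<comment> \<open>The solution of
    \<open>\<kappa> powr (1 - \<theta>) = e / (E + 1)\<close>.\<close>
  let ?\<kappa> = "(e / (E + 1)) powr (1 / (1 - \<theta>))"
  show "?\<kappa> > 0" using assms by simp
  have eq: "?\<kappa> powr (1 - \<theta>) = e / (E + 1)" using assms by (simp add: powr_powr)
  show "?\<kappa> powr (1 - \<theta>) * E < e" unfolding eq using assms by (simp add: field_simps)
qed

text \<open>\<open>\<kappa>\<close> is fixed before the length is restricted to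
  \<open>\<epsilon> / (2 * \<kappa>)\<close>. Unlike absolute continuity itself, the estimate
  survives pointwise limits as long as it holds with one \<open>E\<close>.\<close>

lemma abs_continuous_on_of_increments:
  assumes "0 \<le> E" "\<theta> > 1"
    and inc: "\<And>\<kappa> D S. \<kappa> > 0 \<Longrightarrow> D division_of S \<Longrightarrow> S \<subseteq> {a..b} \<Longrightarrow>
      (\<Sum>K\<in>D. norm (f (Sup K) - f (Inf K))) \<le> \<kappa> * (\<Sum>K\<in>D. Sup K - Inf K) + \<kappa> powr (1 - \<theta>) * E"
  shows "abs_continuous_on a b f"
  unfolding abs_continuous_on_def
proof (intro allI impI)
  fix \<epsilon> :: real assume \<epsilon>: "\<epsilon> > 0"
  obtain \<kappa> where \<kappa>: "\<kappa> > 0" "\<kappa> powr (1 - \<theta>) * E < \<epsilon> / 2"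
    using powr_coefficient_small[of E "\<epsilon> / 2" \<theta>] assms(1,2) \<epsilon> by (metis half_gt_zero)
  have "(\<Sum>K\<in>D. norm (f (Sup K) - f (Inf K))) < \<epsilon>"
    if "D division_of S" "S \<subseteq> {a..b}" "(\<Sum>K\<in>D. Sup K - Inf K) < \<epsilon> / (2 * \<kappa>)" for D S
  proof -
    have "\<kappa> * (\<Sum>K\<in>D. Sup K - Inf K) < \<epsilon> / 2" using that(3) \<kappa>(1) by (simp add: field_simps)
    then show ?thesis using inc[OF \<kappa>(1) that(1,2)] \<kappa>(2) by linarith
  qed
  moreover have "\<epsilon> / (2 * \<kappa>) > 0" using \<epsilon> \<kappa>(1) by simp
  ultimately show "\<exists>\<delta>>0. \<forall>D S. D division_of S \<and> S \<subseteq> {a..b} \<and> (\<Sum>K\<in>D. Sup K - Inf K) < \<delta> \<longrightarrow>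
        (\<Sum>K\<in>D. norm (f (Sup K) - f (Inf K))) < \<epsilon>" by blast
qed

lemma abs_continuous_curve_of_speed:
  fixes f :: "real \<Rightarrow> 'a::euclidean_space" and \<rho> :: "real \<Rightarrow> real"
  assumes "\<rho> \<in> borel_measurable lebesgue" "\<And>t. 0 \<le> \<rho> t"
    and "\<And>u v. 0 \<le> u \<Longrightarrow> u \<le> v \<Longrightarrow> ennreal (norm (f v - f u)) \<le> (\<integral>\<^sup>+t\<in>{u..v}. ennreal (\<rho> t) \<partial>lebesgue)"
    and "(\<integral>\<^sup>+t\<in>{0..}. ennreal (\<rho> t powr \<theta>) \<partial>lebesgue) < \<infinity>" "\<theta> > 1"
  shows "abs_continuous_curve f"
  unfolding abs_continuous_curve_def
proof (intro allI impI)
  fix a b :: real assume ab: "0 \<le> a \<and> a \<le> b"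
  obtain E where E: "0 \<le> E" "(\<integral>\<^sup>+t\<in>{0..}. ennreal (\<rho> t powr \<theta>) \<partial>lebesgue) = ennreal E"
    using assms(4) by (auto simp: less_top_ennreal)
  show "abs_continuous_on a b f"
  proof (rule abs_continuous_on_of_increments[OF E(1) \<open>\<theta> > 1\<close>])
    fix \<kappa> :: real and D S assume *: "\<kappa> > 0" "D division_of S" "S \<subseteq> {a..b}"
    then show "(\<Sum>K\<in>D. norm (f (Sup K) - f (Inf K))) \<le> \<kappa> * (\<Sum>K\<in>D. Sup K - Inf K) + \<kappa> powr (1 - \<theta>) * E"
      using ab E \<open>\<theta> > 1\<close> by (intro division_increments_le[OF assms(1-3)]) auto
  qed
qed

lemma curve_division_increments:
  assumes \<gamma>: "\<gamma> \<in> curves X" "abs_continuous_curve \<gamma>" and "energy \<theta> \<gamma> \<le> ennreal E"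
    and "0 \<le> E" "\<kappa> > 0" "\<theta> \<ge> 1" "D division_of S" "S \<subseteq> {0..}"
  shows "(\<Sum>K\<in>D. norm (\<gamma> (Sup K) - \<gamma> (Inf K))) \<le> \<kappa> * (\<Sum>K\<in>D. Sup K - Inf K) + \<kappa> powr (1 - \<theta>) * E"
proof (rule division_increments_le[where \<rho> = "\<lambda>t. norm (pos_velocity \<gamma> t)"])
  show "(\<lambda>t. norm (pos_velocity \<gamma> t)) \<in> borel_measurable lebesgue"
    using pos_velocity_measurable[OF \<gamma>(1)] by measurable
qed (use assms increment_le_nn_integral[OF \<gamma>(2)] in \<open>auto simp: energy_pos_velocity\<close>)

lemma curve_increment:
  assumes "\<gamma> \<in> curves X" "abs_continuous_curve \<gamma>" "energy \<theta> \<gamma> \<le> ennreal E"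
    and "0 \<le> E" "\<kappa> > 0" "\<theta> \<ge> 1" "0 \<le> u" "u \<le> v"
  shows "norm (\<gamma> v - \<gamma> u) \<le> \<kappa> * (v - u) + \<kappa> powr (1 - \<theta>) * E"
proof -
  have "{{u..v}} division_of {u..v}"
    using assms by (intro division_of_self[of u v, unfolded cbox_interval]) auto
  from curve_division_increments[OF assms(1-6) this] show ?thesis using assms(7,8) by simp
qed

text \<open>The increment estimate involves each curve at finitely many times and the common bound
  \<open>E\<close>, so it passes to the pointwise limit.\<close>

lemma abs_continuous_curve_limit:
  assumes \<gamma>s: "\<And>n. \<gamma>s n \<in> curves X" "\<And>n. abs_continuous_curve (\<gamma>s n)" "\<And>n. energy \<theta> (\<gamma>s n) \<le> ennreal E"
    and "0 \<le> E" "\<theta> > 1" and lim: "\<And>t. 0 \<le> t \<Longrightarrow> (\<lambda>n. \<gamma>s n t) \<longlonglongrightarrow> \<gamma> t"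
  shows "abs_continuous_curve \<gamma>"
  unfolding abs_continuous_curve_def
proof (intro allI impI)
  fix a b :: real assume ab: "0 \<le> a \<and> a \<le> b"
  show "abs_continuous_on a b \<gamma>"
  proof (rule abs_continuous_on_of_increments[OF \<open>0 \<le> E\<close> \<open>\<theta> > 1\<close>])
    fix \<kappa> :: real and D S assume *: "\<kappa> > 0" "D division_of S" "S \<subseteq> {a..b}"
    note int = division_interval[OF *(2)]
    have K: "0 \<le> Inf K" "0 \<le> Sup K" if "K \<in> D" for K
    proof -
      have "Inf K \<in> K" by (subst int(1)[OF that]) (use int(2)[OF that] in simp)
      then show "0 \<le> Inf K" using division_ofD(2)[OF *(2) that] *(3) ab by auto
      then show "0 \<le> Sup K" using int(2)[OF that] by simp
    qed
    have "(\<lambda>n. \<Sum>K\<in>D. norm (\<gamma>s n (Sup K) - \<gamma>s n (Inf K))) \<longlonglongrightarrow> (\<Sum>K\<in>D. norm (\<gamma> (Sup K) - \<gamma> (Inf K)))"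
      using K by (intro tendsto_intros lim)
    then show "(\<Sum>K\<in>D. norm (\<gamma> (Sup K) - \<gamma> (Inf K))) \<le> \<kappa> * (\<Sum>K\<in>D. Sup K - Inf K) + \<kappa> powr (1 - \<theta>) * E"
    proof (rule LIMSEQ_le_const2)
      have "S \<subseteq> {0..}" using *(3) ab by auto
      then show "\<exists>N. \<forall>n\<ge>N. (\<Sum>K\<in>D. norm (\<gamma>s n (Sup K) - \<gamma>s n (Inf K))) \<le>
          \<kappa> * (\<Sum>K\<in>D. Sup K - Inf K) + \<kappa> powr (1 - \<theta>) * E"
        using curve_division_increments[OF \<gamma>s \<open>0 \<le> E\<close> *(1) less_imp_le[OF \<open>\<theta> > 1\<close>] *(2)] by blast
    qed
  qed
qed

section \<open>Weak convergence of the velocities\<close>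

lemma (in finite_measure) weak_convergence_generator:
  fixes us :: "nat \<Rightarrow> 'a \<Rightarrow> 'b::euclidean_space"
  assumes G: "Int_stable G" "G \<subseteq> Pow \<Omega>"
    and sub: "\<And>B. B \<in> sigma_sets \<Omega> G \<Longrightarrow> B \<inter> space M \<in> sets M" "space M \<subseteq> \<Omega>"
    and us: "\<And>n. integrable M (us n)" and u: "integrable M u"
    and ui: "\<And>e. e > 0 \<Longrightarrow> \<exists>\<delta>>0. \<forall>n. \<forall>B\<in>sets M. measure M B < \<delta> \<longrightarrow> norm (LINT t:B|M. us n t) < e"
    and conv: "\<And>B. B \<in> G \<Longrightarrow> (\<lambda>n. LINT t:(B \<inter> space M)|M. us n t) \<longlonglongrightarrow> (LINT t:(B \<inter> space M)|M. u t)"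
    and conv_space: "(\<lambda>n. LINT t:space M|M. us n t) \<longlonglongrightarrow> (LINT t:space M|M. u t)"
    and B: "B \<in> sigma_sets \<Omega> G"
  shows "(\<lambda>n. LINT t:(B \<inter> space M)|M. us n t) \<longlonglongrightarrow> (LINT t:(B \<inter> space M)|M. u t)"
proof -
  have si: "set_integrable M A w" if "integrable M w" "A \<in> sets M" for A and w :: "'a \<Rightarrow> 'b"
    using that unfolding set_integrable_def by (intro integrable_mult_indicator)
  have diff: "(LINT t:(A - B)|M. w t) = (LINT t:A|M. w t) - (LINT t:B|M. w t)"
    if "integrable M w" "A \<in> sets M" "B \<in> sets M" "B \<subseteq> A" for A B and w :: "'a \<Rightarrow> 'b"
  proof -
    have "(LINT t:((A - B) \<union> B)|M. w t) = (LINT t:(A - B)|M. w t) + (LINT t:B|M. w t)"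
      using that by (intro set_integral_Un si) auto
    moreover have "(A - B) \<union> B = A" using that(4) by auto
    ultimately show ?thesis by simp
  qed
  have \<Omega>: "\<Omega> \<inter> space M = space M" using sub(2) by auto
  \<comment> \<open>The sets on which the integrals converge are closed under complements and, by
    the uniform integrability \<open>ui\<close>, under countable disjoint unions; a generator stable
    under intersections is then enough.\<close>
  show ?thesis
    using G(1,2) B
  proof (induction rule: sigma_sets_induct_disjoint)
    case (basic A)
    then show ?case by (rule conv)
  next
    case empty
    then show ?case by (simp add: set_lebesgue_integral_def)
  next
    case (compl A)
    have "(\<Omega> - A) \<inter> space M = space M - A \<inter> space M" using sub(2) by auto
    then have eq: "(LINT t:((\<Omega> - A) \<inter> space M)|M. w t) = (LINT t:space M|M. w t) - (LINT t:(A \<inter> space M)|M. w t)"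
      if "integrable M w" for w :: "'a \<Rightarrow> 'b"
      using diff[OF that, of "space M" "A \<inter> space M"] sub(1)[OF compl(1)] by simp
    show ?case unfolding eq[OF us] eq[OF u] by (intro tendsto_diff conv_space compl)
  next
    case (union A)
    define F where "F k = (\<Union>i<k. A i \<inter> space M)" for k :: nat
    define U where "U = (\<Union>i. A i) \<inter> space M"
    have A_sets: "A i \<inter> space M \<in> sets M" for i using union by (intro sub(1)) auto
    have F_sets: "F k \<in> sets M" for k unfolding F_def by (intro sets.finite_UN A_sets) auto
    have U_eq: "U = (\<Union>k. F k)" unfolding U_def F_def by auto
    have U_sets: "U \<in> sets M" unfolding U_eq using F_sets by auto
    have F_inc: "incseq F" by (rule incseq_SucI) (auto simp: F_def lessThan_Suc)
    have F_sub: "F k \<subseteq> U" for k unfolding U_eq by auto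
    have F_conv: "(\<lambda>n. LINT t:F k|M. us n t) \<longlonglongrightarrow> (LINT t:F k|M. u t)" for k
    proof (induction k)
      case 0
      then show ?case by (simp add: F_def set_lebesgue_integral_def)
    next
      case (Suc k)
      have Fk: "F (Suc k) = F k \<union> (A k \<inter> space M)" by (auto simp: F_def lessThan_Suc)
      have disj: "F k \<inter> (A k \<inter> space M) = {}"
      proof -
        have "A i \<inter> A k = {}" if "i < k" for i
          using union(1) that by (simp add: disjoint_family_on_def)
        then show ?thesis by (auto simp: F_def)
      qed
      have eq: "(LINT t:F (Suc k)|M. w t) = (LINT t:F k|M. w t) + (LINT t:(A k \<inter> space M)|M. w t)"
        if "integrable M w" for w :: "'a \<Rightarrow> 'b"
        unfolding Fk using that by (intro set_integral_Un disj si F_sets A_sets)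
      show ?case unfolding eq[OF us] eq[OF u] by (intro tendsto_add Suc.IH union)
    qed
    have u_conv: "(\<lambda>k. LINT t:F k|M. u t) \<longlonglongrightarrow> (LINT t:U|M. u t)"
      unfolding U_eq using u F_sets F_inc by (intro set_integral_cont_up si) auto
    have m_conv: "(\<lambda>k. measure M (U - F k)) \<longlonglongrightarrow> 0"
    proof -
      have "(\<lambda>k. measure M (F k)) \<longlonglongrightarrow> measure M U"
        unfolding U_eq using F_sets F_inc by (intro finite_Lim_measure_incseq) auto
      then have "(\<lambda>k. measure M U - measure M (F k)) \<longlonglongrightarrow> measure M U - measure M U"
        by (intro tendsto_intros)
      then show ?thesis using finite_measure_Diff[OF U_sets F_sets F_sub] by simp
    qed
    \<comment> \<open>The remainder \<open>U - F k\<close> has small measure, so it contributes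
      little uniformly in \<open>n\<close>, while on the finite union \<open>F k\<close> convergence
      is known.\<close>
    have "(\<lambda>n. LINT t:U|M. us n t) \<longlonglongrightarrow> (LINT t:U|M. u t)"
    proof (rule LIMSEQ_I)
      fix r :: real assume r: "0 < r"
      obtain \<delta> where \<delta>: "\<delta> > 0" "\<And>n B. B \<in> sets M \<Longrightarrow> measure M B < \<delta> \<Longrightarrow> norm (LINT t:B|M. us n t) < r / 3"
        using ui[of "r / 3"] r by auto
      have "\<forall>\<^sub>F k in sequentially. measure M (U - F k) < \<delta>"
        using m_conv \<delta>(1) by (rule order_tendstoD(2))
      moreover have "\<forall>\<^sub>F k in sequentially. dist (LINT t:F k|M. u t) (LINT t:U|M. u t) < r / 3"
        using u_conv r by (intro tendstoD) auto
      ultimately have "\<forall>\<^sub>F k in sequentially. measure M (U - F k) < \<delta> \<and>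
          dist (LINT t:F k|M. u t) (LINT t:U|M. u t) < r / 3" by eventually_elim simp
      then obtain k where k: "measure M (U - F k) < \<delta>" "dist (LINT t:F k|M. u t) (LINT t:U|M. u t) < r / 3"
        by (auto simp: eventually_sequentially)
      obtain N where N: "\<And>n. n \<ge> N \<Longrightarrow> norm ((LINT t:F k|M. us n t) - (LINT t:F k|M. u t)) < r / 3"
        using LIMSEQ_D[OF F_conv[of k], of "r / 3"] r by auto
      have "norm ((LINT t:U|M. us n t) - (LINT t:U|M. u t)) < r" if "n \<ge> N" for n
      proof -
        have "norm ((LINT t:U|M. us n t) - (LINT t:F k|M. us n t)) < r / 3"
          using \<delta>(2)[of "U - F k" n] U_sets F_sets k(1) diff[OF us U_sets F_sets F_sub] by simp
        then show ?thesis
          using dist_triangle_third[OF _ _ k(2), of "LINT t:U|M. us n t" "LINT t:F k|M. us n t"] N[OF that]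
          unfolding dist_norm by blast
      qed
      then show "\<exists>no. \<forall>n\<ge>no. norm ((LINT t:U|M. us n t) - (LINT t:U|M. u t)) < r" by blast
    qed
    then show ?case by (simp add: U_def)
  qed
qed

lemma finite_measure_lebesgue_on_Icc: "finite_measure (lebesgue_on {0..s::real})"
  by (rule finite_measure_lebesgue_on) simp

lemma pos_velocity_lebesgue_on:
  "\<gamma> \<in> curves X \<Longrightarrow> pos_velocity \<gamma> \<in> borel_measurable (lebesgue_on {0..s})"
  by (rule measurable_restrict_space1) (rule pos_velocity_measurable)

lemma nn_integral_lebesgue_on:
  "S \<in> sets lebesgue \<Longrightarrow> (\<integral>\<^sup>+t. f t \<partial>lebesgue_on S) = (\<integral>\<^sup>+t\<in>S. f t \<partial>lebesgue)"
  by (simp add: nn_integral_restrict_space)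

lemma energy_lebesgue_on:
  "(\<integral>\<^sup>+t. ennreal (norm (pos_velocity \<gamma> t) powr \<theta>) \<partial>lebesgue_on {0..s}) \<le> energy \<theta> \<gamma>"
  unfolding energy_pos_velocity by (subst nn_integral_lebesgue_on) (auto intro!: nn_integral_mono simp: indicator_def)

lemma pos_velocity_integral:
  assumes \<gamma>: "abs_continuous_curve \<gamma>" and a: "0 \<le> a" "a \<le> s"
  shows "integrable (lebesgue_on {0..s}) (pos_velocity \<gamma>)"
    "(LINT t:{0..a}|lebesgue_on {0..s}. pos_velocity \<gamma> t) = \<gamma> a - \<gamma> 0"
proof -
  have vi: "velocity_integral \<gamma> 0 b" if "0 \<le> b" for b
    using \<gamma> that by (intro abs_continuous_on_velocity_integral) (auto simp: abs_continuous_curve_def)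
  have neg: "negligible {0 :: real}" by simp
  have abs: "pos_velocity \<gamma> absolutely_integrable_on {0..b}" if "0 \<le> b" for b
    by (rule absolutely_integrable_spike[where f = "velocity \<gamma>", OF _ neg])
      (use vi[OF that] in \<open>auto simp: velocity_integral_def pos_velocity_def\<close>)
  have has: "(pos_velocity \<gamma> has_integral (\<gamma> b - \<gamma> 0)) {0..b}" if "0 \<le> b" for b
    by (rule has_integral_spike[where f = "velocity \<gamma>", OF neg])
      (use vi[OF that] in \<open>auto simp: velocity_integral_def pos_velocity_def\<close>)
  have "0 \<le> s" using a by simp
  from abs[OF this] show "integrable (lebesgue_on {0..s}) (pos_velocity \<gamma>)"
    by (simp add: set_integrable_def integrable_restrict_space)
  have "(LINT t:{0..a}|lebesgue_on {0..s}. pos_velocity \<gamma> t) =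
      (LINT t|lebesgue. indicator {0..s} t *\<^sub>R indicator {0..a} t *\<^sub>R pos_velocity \<gamma> t)"
    unfolding set_lebesgue_integral_def by (subst integral_restrict_space) auto
  also have "\<dots> = (LINT t:{0..a}|lebesgue. pos_velocity \<gamma> t)"
    unfolding set_lebesgue_integral_def using a by (intro Bochner_Integration.integral_cong) (auto simp: indicator_def)
  also have "\<dots> = integral {0..a} (pos_velocity \<gamma>)"
    by (rule set_lebesgue_integral_eq_integral(2)[OF abs[OF a(1)]])
  also have "\<dots> = \<gamma> a - \<gamma> 0" using has[OF a(1)] by (rule integral_unique)
  finally show "(LINT t:{0..a}|lebesgue_on {0..s}. pos_velocity \<gamma> t) = \<gamma> a - \<gamma> 0" .
qed

text \<open>Over \<open>{0..a}\<close> the velocity integrates to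
  \<open>\<gamma> a - \<gamma> 0\<close>, so pointwise convergence of the curves gives convergence
  on intervals. The energy bound makes the velocities uniformly integrable, which extends this to
  all measurable sets.\<close>

lemma pos_velocity_weak_convergence:
  assumes \<gamma>s: "\<And>n. \<gamma>s n \<in> curves X" "\<And>n. abs_continuous_curve (\<gamma>s n)" "\<And>n. energy \<theta> (\<gamma>s n) \<le> ennreal E"
    and E: "0 \<le> E" "\<theta> > 1" and lim: "\<And>t. 0 \<le> t \<Longrightarrow> (\<lambda>n. \<gamma>s n t) \<longlonglongrightarrow> \<gamma> t"
    and \<gamma>: "abs_continuous_curve \<gamma>" and s: "0 \<le> s" and B: "B \<in> sets (lebesgue_on {0..s})"
  shows "(\<lambda>n. LINT t:B|lebesgue_on {0..s}. pos_velocity (\<gamma>s n) t) \<longlonglongrightarrow>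
    (LINT t:B|lebesgue_on {0..s}. pos_velocity \<gamma> t)"
proof -
  let ?M = "lebesgue_on {0..s}"
  interpret finite_measure ?M by (rule finite_measure_lebesgue_on_Icc)
  have space: "space ?M = {0..s}" by simp
  have sM: "A \<in> sets ?M \<longleftrightarrow> A \<in> sets lebesgue \<and> A \<subseteq> {0..s}" for A
    using sets_restrict_space_iff[of "{0..s}" lebesgue A] by auto
  have int: "integrable ?M (pos_velocity (\<gamma>s n))" "integrable ?M (pos_velocity \<gamma>)" for n
    using pos_velocity_integral(1)[OF \<gamma>s(2) s order_refl] pos_velocity_integral(1)[OF \<gamma> s order_refl] by auto
  have bound: "norm (LINT t:A|?M. pos_velocity (\<gamma>s n) t) \<le> \<kappa> * measure ?M A + \<kappa> powr (1 - \<theta>) * E"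
    if A: "A \<in> sets ?M" and \<kappa>: "\<kappa> > 0" for A n \<kappa>
  proof -
    have A': "A \<in> sets lebesgue" "A \<subseteq> {0..s}" using A sM by auto
    have int_A: "integrable ?M (\<lambda>t. indicator A t *\<^sub>R pos_velocity (\<gamma>s n) t)"
      using int(1) A by (intro integrable_mult_indicator)
    have "ennreal (norm (LINT t:A|?M. pos_velocity (\<gamma>s n) t)) \<le>
        (\<integral>\<^sup>+t. ennreal (norm (indicator A t *\<^sub>R pos_velocity (\<gamma>s n) t)) \<partial>?M)"
      unfolding set_lebesgue_integral_def by (rule integral_norm_bound_ennreal[OF int_A])
    also have "\<dots> = (\<integral>\<^sup>+t\<in>A. ennreal (norm (pos_velocity (\<gamma>s n) t)) \<partial>lebesgue)"
      using A' by (subst nn_integral_lebesgue_on) (auto intro!: nn_integral_cong simp: indicator_def)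
    also have "\<dots> \<le> ennreal \<kappa> * emeasure lebesgue A +
        ennreal (\<kappa> powr (1 - \<theta>)) * (\<integral>\<^sup>+t\<in>A. ennreal (norm (pos_velocity (\<gamma>s n) t) powr \<theta>) \<partial>lebesgue)"
      using A' E \<kappa> pos_velocity_measurable[OF \<gamma>s(1)] by (intro nn_integral_Young) auto
    also have "\<dots> \<le> ennreal \<kappa> * ennreal (measure ?M A) + ennreal (\<kappa> powr (1 - \<theta>)) * ennreal E"
    proof (intro add_mono mult_left_mono)
      show "emeasure lebesgue A \<le> ennreal (measure ?M A)"
        using A' emeasure_eq_measure[of A] by (simp add: emeasure_restrict_space)
      have "(\<integral>\<^sup>+t\<in>A. ennreal (norm (pos_velocity (\<gamma>s n) t) powr \<theta>) \<partial>lebesgue) \<le> energy \<theta> (\<gamma>s n)"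
        unfolding energy_pos_velocity using A' by (intro nn_integral_mono) (auto simp: indicator_def)
      then show "(\<integral>\<^sup>+t\<in>A. ennreal (norm (pos_velocity (\<gamma>s n) t) powr \<theta>) \<partial>lebesgue) \<le> ennreal E"
        using \<gamma>s(3) order_trans by blast
    qed auto
    also have "\<dots> = ennreal (\<kappa> * measure ?M A + \<kappa> powr (1 - \<theta>) * E)"
      using E \<kappa> by (simp add: ennreal_mult[symmetric] ennreal_plus[symmetric] del: ennreal_plus)
    finally show ?thesis using E \<kappa> by (subst (asm) ennreal_le_iff) auto
  qed
  have ui: "\<exists>\<delta>>0. \<forall>n. \<forall>A\<in>sets ?M. measure ?M A < \<delta> \<longrightarrow> norm (LINT t:A|?M. pos_velocity (\<gamma>s n) t) < e"
    if e: "e > 0" for e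
  proof -
    obtain \<kappa> where \<kappa>: "\<kappa> > 0" "\<kappa> powr (1 - \<theta>) * E < e / 2"
      using powr_coefficient_small[of E "e / 2" \<theta>] E e by (metis half_gt_zero)
    have "norm (LINT t:A|?M. pos_velocity (\<gamma>s n) t) < e" if "A \<in> sets ?M" "measure ?M A < e / (2 * \<kappa>)" for n A
    proof -
      have "\<kappa> * measure ?M A < e / 2" using that(2) \<kappa>(1) by (simp add: field_simps)
      then show ?thesis using bound[OF that(1) \<kappa>(1), of n] \<kappa>(2) by linarith
    qed
    moreover have "e / (2 * \<kappa>) > 0" using e \<kappa>(1) by simp
    ultimately show ?thesis by blast
  qed
  let ?G = "range (\<lambda>a. {..a::real})"
  have borel: "sets borel = sigma_sets UNIV ?G" unfolding borel_eq_atMost by (rule sets_measure_of) simp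
  have interval: "(\<lambda>n. LINT t:{0..a}|?M. pos_velocity (\<gamma>s n) t) \<longlonglongrightarrow> (LINT t:{0..a}|?M. pos_velocity \<gamma> t)"
    if "0 \<le> a" "a \<le> s" for a
    unfolding pos_velocity_integral(2)[OF \<gamma>s(2) that] pos_velocity_integral(2)[OF \<gamma> that]
    using that by (intro tendsto_diff lim) auto
  have main: "(\<lambda>n. LINT t:(A \<inter> space ?M)|?M. pos_velocity (\<gamma>s n) t) \<longlonglongrightarrow> (LINT t:(A \<inter> space ?M)|?M. pos_velocity \<gamma> t)"
    if A: "A \<in> sets borel" for A
  proof (rule weak_convergence_generator[where G = ?G and \<Omega> = UNIV])
    show "Int_stable ?G"
    proof (rule Int_stableI)
      fix A B assume "A \<in> ?G" "B \<in> ?G"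
      then obtain a b where "A = {..a}" "B = {..b}" by auto
      then have "A \<inter> B = {..min a b}" by auto
      then show "A \<inter> B \<in> ?G" by blast
    qed
    show "A \<inter> space ?M \<in> sets ?M" if "A \<in> sigma_sets UNIV ?G" for A
      using that unfolding borel[symmetric] sM space by auto
    show "(\<lambda>n. LINT t:(A \<inter> space ?M)|?M. pos_velocity (\<gamma>s n) t) \<longlonglongrightarrow> (LINT t:(A \<inter> space ?M)|?M. pos_velocity \<gamma> t)"
      if "A \<in> ?G" for A
    proof -
      obtain a where a: "A = {..a}" using \<open>A \<in> ?G\<close> by auto
      show ?thesis
      proof (cases "0 \<le> a")
        case True
        then have "A \<inter> space ?M = {0..min a s}" by (auto simp: a)
        then show ?thesis using interval[of "min a s"] True s by simp
      next
        case False
        then have "A \<inter> space ?M = {}" by (auto simp: a)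
        then show ?thesis by (simp add: set_lebesgue_integral_def)
      qed
    qed
    show "(\<lambda>n. LINT t:space ?M|?M. pos_velocity (\<gamma>s n) t) \<longlonglongrightarrow> (LINT t:space ?M|?M. pos_velocity \<gamma> t)"
      unfolding space by (rule interval[OF s order_refl])
    show "A \<in> sigma_sets UNIV ?G" using A unfolding borel .
  qed (use int ui in auto)
  \<comment> \<open>The intervals generate the Borel sets; a Lebesgue set differs from a Borel set
    by a null set, which no integral sees.\<close>
  obtain S N N' where S: "B = S \<union> N" "N \<subseteq> N'" "N' \<in> null_sets lborel" "S \<in> sets lborel"
    using B unfolding sM by (auto elim: sets_completionE)
  have S': "S \<inter> space ?M = S" using S(1) B unfolding sM space by auto
  have S_M: "S \<in> sets ?M" using S B unfolding sM by auto
  have "N' \<in> null_sets lebesgue" using S(3) by (rule null_sets_completionI)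
  then have "AE t in lebesgue. t \<notin> N'" by (rule AE_not_in)
  then have "AE t in ?M. t \<notin> N'" by (subst AE_restrict_space_iff) (auto elim: eventually_mono)
  then have AE: "AE t in ?M. t \<in> B \<longleftrightarrow> t \<in> S"
    by eventually_elim (use S(1,2) in auto)
  have eq: "(LINT t:B|?M. w t) = (LINT t:S|?M. w t)" if "integrable ?M w" for w :: "real \<Rightarrow> 'a"
    unfolding set_lebesgue_integral_def
  proof (rule integral_cong_AE)
    show "(\<lambda>t. indicator B t *\<^sub>R w t) \<in> borel_measurable ?M" "(\<lambda>t. indicator S t *\<^sub>R w t) \<in> borel_measurable ?M"
      using that B S_M by auto
    show "AE t in ?M. indicator B t *\<^sub>R w t = indicator S t *\<^sub>R w t"
      using AE by eventually_elim (auto simp: indicator_def)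
  qed
  show ?thesis unfolding eq[OF int(1)] eq[OF int(2)] using main[of S] S(4) unfolding S' by simp
qed

section \<open>Integrals along locally uniform limits of curves\<close>

definition locally_uniform_limit :: "(nat \<Rightarrow> real \<Rightarrow> 'a::metric_space) \<Rightarrow> (real \<Rightarrow> 'a) \<Rightarrow> bool" where
  "locally_uniform_limit \<gamma>s \<gamma> \<longleftrightarrow>
    (\<forall>T \<epsilon>. 0 < \<epsilon> \<longrightarrow> (\<forall>\<^sub>F n in sequentially. \<forall>t\<in>{0..T}. dist (\<gamma>s n t) (\<gamma> t) < \<epsilon>))"

lemma locally_uniform_limit_pointwise:
  assumes "locally_uniform_limit \<gamma>s \<gamma>" "0 \<le> t"
  shows "(\<lambda>n. \<gamma>s n t) \<longlonglongrightarrow> \<gamma> t"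
proof (rule tendstoI)
  fix e :: real assume "0 < e"
  then have "\<forall>\<^sub>F n in sequentially. \<forall>s\<in>{0..t}. dist (\<gamma>s n s) (\<gamma> s) < e"
    using assms(1) by (auto simp: locally_uniform_limit_def)
  then show "\<forall>\<^sub>F n in sequentially. dist (\<gamma>s n t) (\<gamma> t) < e"
    by eventually_elim (use assms(2) in auto)
qed

text \<open>Locally uniform convergence with a common energy bound yields both the absolute
  continuity of the limit and the weak convergence of the velocities that
  \<open>convex_integral_lsc\<close> asks for.\<close>

theorem curve_integral_lsc:
  fixes L :: "real \<Rightarrow> 'a::euclidean_space \<Rightarrow> 'a \<Rightarrow> real"
  assumes X: "compact X"
    and L_meas: "\<And>x p. x \<in> X \<Longrightarrow> (\<lambda>t. L t x p) \<in> borel_measurable (lebesgue_on {0..s})"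
    and L_cont: "AE t in lebesgue_on {0..s}. continuous_on (X \<times> UNIV) (\<lambda>(x, p). L t x p)"
    and L_conv: "AE t in lebesgue_on {0..s}. \<forall>x\<in>X. convex_on UNIV (L t x)"
    and L_nonneg: "\<And>t x p. 0 \<le> t \<Longrightarrow> x \<in> X \<Longrightarrow> 0 \<le> L t x p"
    and \<gamma>s: "\<And>n. \<gamma>s n \<in> curves X" "\<And>n. abs_continuous_curve (\<gamma>s n)" "\<And>n. energy \<theta> (\<gamma>s n) \<le> ennreal E"
    and E: "0 \<le> E" "\<theta> > 1" and \<gamma>: "\<gamma> \<in> curves X" and lim: "locally_uniform_limit \<gamma>s \<gamma>" and s: "0 \<le> s"
  shows "(\<integral>\<^sup>+t\<in>{0..s}. ennreal (L t (\<gamma> t) (velocity \<gamma> t)) \<partial>lebesgue) \<le>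
    liminf (\<lambda>n. \<integral>\<^sup>+t\<in>{0..s}. ennreal (L t (\<gamma>s n t) (velocity (\<gamma>s n) t)) \<partial>lebesgue)"
proof -
  let ?M = "lebesgue_on {0..s}"
  interpret finite_measure ?M by (rule finite_measure_lebesgue_on_Icc)
  have ac: "abs_continuous_curve \<gamma>"
    by (rule abs_continuous_curve_limit[OF \<gamma>s E locally_uniform_limit_pointwise[OF lim]])
  have "(\<integral>\<^sup>+t. ennreal (L t (\<gamma> t) (pos_velocity \<gamma> t)) \<partial>?M) \<le>
      liminf (\<lambda>n. \<integral>\<^sup>+t. ennreal (L t (\<gamma>s n t) (pos_velocity (\<gamma>s n) t)) \<partial>?M)"
  proof (rule convex_integral_lsc[OF X L_meas L_cont L_conv, where \<theta> = \<theta> and E = E])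
    have "continuous_on {0..s} \<gamma>" using curvesD(1)[OF \<gamma>] by (rule continuous_on_subset) auto
    then show "\<gamma> \<in> borel_measurable ?M" by (intro continuous_imp_measurable_on_sets_lebesgue) auto
    show "\<forall>\<^sub>F n in sequentially. \<forall>t\<in>space ?M. dist (\<gamma>s n t) (\<gamma> t) < \<epsilon>" if "\<epsilon> > 0" for \<epsilon>
      using lim that by (auto simp: locally_uniform_limit_def)
    show "(\<integral>\<^sup>+t. ennreal (norm (pos_velocity (\<gamma>s n) t) powr \<theta>) \<partial>?M) \<le> ennreal E" for n
      using energy_lebesgue_on \<gamma>s(3) by (rule order_trans)
    show "(\<lambda>n. LINT t:B|?M. pos_velocity (\<gamma>s n) t) \<longlonglongrightarrow> (LINT t:B|?M. pos_velocity \<gamma> t)"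
      if "B \<in> sets ?M" for B
      by (rule pos_velocity_weak_convergence[OF \<gamma>s E locally_uniform_limit_pointwise[OF lim] ac s that])
  qed (use L_nonneg pos_velocity_integral(1)[OF ac s order_refl] E in
      \<open>auto intro: curvesD(2)[OF \<gamma>] curvesD(2)[OF \<gamma>s(1)] pos_velocity_lebesgue_on[OF \<gamma>s(1)]\<close>)
  then show ?thesis
    by (subst (1 2) nn_integral_pos_velocity) (auto simp: nn_integral_lebesgue_on)
qed

text \<open>The integrand is set to \<open>0\<close> on the null set where continuity fails, after
  which \<open>Caratheodory_measurable\<close> applies; completeness of Lebesgue measure makes the
  change harmless.\<close>

lemma curve_integrand_measurable:
  fixes L :: "real \<Rightarrow> 'a::euclidean_space \<Rightarrow> 'a \<Rightarrow> real"
  assumes L_meas: "\<And>x p. x \<in> X \<Longrightarrow> (\<lambda>t. L t x p) \<in> borel_measurable (lebesgue_on {0..})"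
    and L_cont: "AE t in lebesgue_on {0..}. continuous_on (X \<times> UNIV) (\<lambda>(x, p). L t x p)"
    and \<gamma>: "\<gamma> \<in> curves X"
  shows "(\<lambda>t. if 0 < t then L t (\<gamma> t) (velocity \<gamma> t) else 0) \<in> borel_measurable lebesgue"
proof -
  have "AE t in lebesgue. t \<in> {0..} \<longrightarrow> continuous_on (X \<times> UNIV) (\<lambda>(x, p). L t x p)"
    using L_cont by (subst (asm) AE_restrict_space_iff) auto
  then obtain N where N: "N \<in> null_sets lebesgue"
      "\<And>t. 0 \<le> t \<Longrightarrow> t \<notin> N \<Longrightarrow> continuous_on (X \<times> UNIV) (\<lambda>(x, p). L t x p)"
    by (auto simp: eventually_ae_filter)
  have [measurable]: "N \<in> sets lebesgue" using N(1) by auto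
  define f where "f t = (\<lambda>(x, p). if t \<in> N \<or> t \<le> 0 then 0 else L t x p)" for t
  have "continuous_on UNIV (\<lambda>t. \<gamma> (max 0 t))"
    by (intro continuous_on_compose2[OF curvesD(1)[OF \<gamma>]] continuous_intros) auto
  then have [measurable]: "(\<lambda>t. \<gamma> (max 0 t)) \<in> borel_measurable lebesgue"
    by (intro measurable_completion) (simp add: borel_measurable_continuous_onI)
  note pos_velocity_measurable[OF \<gamma>, measurable]
  have "(\<lambda>t. f t (\<gamma> (max 0 t), pos_velocity \<gamma> t)) \<in> borel_measurable lebesgue"
  proof (rule Caratheodory_measurable[where Z = "X \<times> UNIV"])
    fix z assume "z \<in> X \<times> (UNIV :: 'a set)"
    then obtain x p where z: "z = (x, p)" "x \<in> X" by auto
    have m: "(\<lambda>t. if t \<in> {0..} then L t x p else 0) \<in> borel_measurable lebesgue"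
      using L_meas[OF z(2), of p] by (intro borel_measurable_if_I) auto
    have "(\<lambda>t. f t z) = (\<lambda>t. if t \<in> N \<union> {..0} then 0 else if t \<in> {0..} then L t x p else 0)"
      by (auto simp: f_def z)
    also have "\<dots> \<in> borel_measurable lebesgue"
      by (rule measurable_If_set[OF _ m]) auto
    finally show "(\<lambda>t. f t z) \<in> borel_measurable lebesgue" .
  next
    fix t :: real
    show "continuous_on (X \<times> UNIV) (f t)"
    proof (cases "t \<in> N \<or> t \<le> 0")
      case True
      then have "f t = (\<lambda>_. 0)" by (auto simp: f_def)
      then show ?thesis by simp
    next
      case False
      then have "f t = (\<lambda>(x, p). L t x p)" by (auto simp: f_def)
      then show ?thesis using N(2)[of t] False by simp
    qed
  next
    show "(\<gamma> (max 0 t), pos_velocity \<gamma> t) \<in> X \<times> UNIV" for t using curvesD(2)[OF \<gamma>, of "max 0 t"] by simp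
  qed measurable
  then show ?thesis
  proof (rule borel_measurable_AE)
    show "AE t in lebesgue. f t (\<gamma> (max 0 t), pos_velocity \<gamma> t) = (if 0 < t then L t (\<gamma> t) (velocity \<gamma> t) else 0)"
      using AE_not_in[OF N(1)] by eventually_elim (auto simp: f_def pos_velocity_def max_def)
  qed
qed

text \<open>Lower semicontinuity of exit times gives estimates on \<open>{0..s}\<close> for
  \<open>s\<close> strictly before the horizon \<open>c\<close>. Such intervals exhaust the horizon
  up to its endpoints, which are null, and monotone convergence carries the bound over. With
  \<open>c = \<infinity>\<close> the lemma reduces the half-line to compact intervals.\<close>

lemma nn_integral_horizon_le:
  fixes f :: "real \<Rightarrow> ennreal"
  assumes f: "(\<lambda>t. f t * indicator {0<..} t) \<in> borel_measurable lebesgue"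
    and le: "\<And>s. 0 \<le> s \<Longrightarrow> ennreal s < c \<Longrightarrow> (\<integral>\<^sup>+t\<in>{0..s}. f t \<partial>lebesgue) \<le> B"
  shows "(\<integral>\<^sup>+t\<in>{t. 0 \<le> t \<and> ennreal t \<le> c}. f t \<partial>lebesgue) \<le> B"
proof -
  obtain s :: "nat \<Rightarrow> real" where s: "incseq s" "\<And>k. c > 0 \<Longrightarrow> 0 \<le> s k \<and> ennreal (s k) < c"
    "\<And>t. 0 < t \<Longrightarrow> ennreal t < c \<Longrightarrow> \<exists>k. t \<le> s k"
  proof (cases c)
    case top
    show ?thesis
    proof
      show "incseq real" by (simp add: incseq_def)
      show "\<exists>k. t \<le> real k" for t by (rule real_arch_simple)
    qed (simp add: top)
  next
    case (real r)
    \<comment> \<open>For \<open>r > 0\<close> these times start at \<open>0\<close> and increase to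
      \<open>r\<close> without reaching it.\<close>
    let ?s = "\<lambda>k. r - r / real (Suc k)"
    show ?thesis
    proof
      show "incseq ?s"
        using real(1) by (auto simp: incseq_def intro!: divide_left_mono)
      show "0 \<le> ?s k \<and> ennreal (?s k) < c" if "c > 0" for k
        using real that by (auto simp: ennreal_less_iff field_simps)
      show "\<exists>k. t \<le> ?s k" if t: "0 < t" "ennreal t < c" for t
      proof -
        have tr: "t < r" using t real by (simp add: ennreal_less_iff)
        obtain k where "r / (r - t) < real k" using reals_Archimedean2 by blast
        then have "r < (r - t) * real (Suc k)" using tr by (simp add: field_simps)
        then have "r / real (Suc k) \<le> r - t" using tr by (simp add: field_simps)
        then show ?thesis by (intro exI[of _ k]) simp
      qed
    qed
  qed
  let ?g = "\<lambda>t. f t * indicator {0<..} t"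
  show ?thesis
  proof (cases "c > 0")
    case False
    then have "c = 0" by simp
    have "(\<integral>\<^sup>+t\<in>{t. 0 \<le> t \<and> ennreal t \<le> c}. f t \<partial>lebesgue) = (\<integral>\<^sup>+t. 0 \<partial>(lebesgue :: real measure))"
      using AE_lebesgue_neq[of 0]
      by (intro nn_integral_cong_AE, eventually_elim) (auto simp: indicator_def \<open>c = 0\<close>)
    then show ?thesis by simp
  next
    case True
    have "(\<integral>\<^sup>+t\<in>{t. 0 \<le> t \<and> ennreal t \<le> c}. f t \<partial>lebesgue) =
        (\<integral>\<^sup>+t. (SUP k. ?g t * indicator {0..s k} t) \<partial>lebesgue)"
    proof (rule nn_integral_cong_AE)
      show "AE t in lebesgue. f t * indicator {t. 0 \<le> t \<and> ennreal t \<le> c} t = (SUP k. ?g t * indicator {0..s k} t)"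
        using AE_lebesgue_neq[of 0] AE_lebesgue_neq[of "enn2real c"]
      proof eventually_elim
        case (elim t)
        show ?case
        proof (cases "0 < t \<and> ennreal t \<le> c")
          case True
          then have "ennreal t < c" using elim(2) by (cases c) (auto simp: ennreal_less_iff)
          then obtain k where "t \<le> s k" using s(3) True by blast
          then have "(SUP k. ?g t * indicator {0..s k} t) = f t"
            using True by (intro antisym SUP_least SUP_upper2[of k]) (auto simp: indicator_def)
          then show ?thesis using True by simp
        next
          case False
          have out: "t \<notin> {0..s k}" if "0 < t" for k
          proof
            assume "t \<in> {0..s k}"
            then have "ennreal t \<le> ennreal (s k)" by (intro ennreal_leI) auto
            then have "ennreal t < c" using s(2)[OF \<open>c > 0\<close>, of k] le_less_trans by blast
            then show False using False that by auto
          qed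
          have "?g t * indicator {0..s k} t = 0" for k using out[of k] by (auto simp: indicator_def)
          then have "(SUP k. ?g t * indicator {0..s k} t) = (SUP k::nat. 0)" by (simp only:)
          also have "\<dots> = 0" by simp
          finally have "(SUP k. ?g t * indicator {0..s k} t) = 0" .
          moreover have "f t * indicator {t. 0 \<le> t \<and> ennreal t \<le> c} t = 0"
            using False elim(1) by (auto simp: indicator_def)
          ultimately show ?thesis by simp
        qed
      qed
    qed
    also have "\<dots> = (SUP k. \<integral>\<^sup>+t. ?g t * indicator {0..s k} t \<partial>lebesgue)"
    proof (rule nn_integral_monotone_convergence_SUP)
      show "incseq (\<lambda>k t. ?g t * indicator {0..s k} t)"
      proof (rule incseq_SucI, rule le_funI)
        fix k t
        have "s k \<le> s (Suc k)" using s(1) by (simp add: incseq_SucD)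
        then show "?g t * indicator {0..s k} t \<le> ?g t * indicator {0..s (Suc k)} t"
          by (auto simp: indicator_def)
      qed
      show "(\<lambda>t. ?g t * indicator {0..s k} t) \<in> borel_measurable lebesgue" for k
        by (intro borel_measurable_times_ennreal f borel_measurable_indicator) auto
    qed
    also have "\<dots> \<le> B"
    proof (rule SUP_least)
      fix k
      have "(\<integral>\<^sup>+t. ?g t * indicator {0..s k} t \<partial>lebesgue) \<le> (\<integral>\<^sup>+t\<in>{0..s k}. f t \<partial>lebesgue)"
        by (intro nn_integral_mono) (auto simp: indicator_def)
      also have "\<dots> \<le> B" using s(2)[OF True, of k] by (intro le) auto
      finally show "(\<integral>\<^sup>+t. ?g t * indicator {0..s k} t \<partial>lebesgue) \<le> B" .
    qed
    finally show ?thesis .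
  qed
qed

subsection \<open>Competitors\<close>

text \<open>The parameter at arc length \<open>s\<close> is the last time at which the length does not exceed \<open>s\<close>; the
  length function itself need not be known to be continuous.\<close>

lemma arc_length_parametrization:
  fixes g :: "real \<Rightarrow> 'a::euclidean_space"
  assumes g: "path g" "path_image g \<subseteq> X" and len: "curve_length g < ennreal L" and L: "0 < L"
  obtains \<sigma> where "\<sigma> 0 = pathstart g" "\<sigma> L = pathfinish g" "\<And>s. 0 \<le> s \<Longrightarrow> s \<le> L \<Longrightarrow> \<sigma> s \<in> X"
    "\<And>s s'. 0 \<le> s \<Longrightarrow> s \<le> s' \<Longrightarrow> s' \<le> L \<Longrightarrow> norm (\<sigma> s' - \<sigma> s) \<le> s' - s"
proof -
  have cont: "continuous_on {0..1} g" using g(1) by (simp add: path_def)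
  have fin: "variation g u v < ennreal L" if "0 \<le> u" "v \<le> 1" for u v
    using variation_mono[OF that, of g] len by (simp add: curve_length_eq_variation)
  have fin': "variation g u v < \<infinity>" if "0 \<le> u" "v \<le> 1" for u v
    using fin[OF that] less_trans ennreal_less_top by (metis infinity_ennreal_def)
  define v where "v t = enn2real (variation g 0 t)" for t
  have v_diff: "v t' - v t = enn2real (variation g t t')" if "0 \<le> t" "t \<le> t'" "t' \<le> 1" for t t'
  proof -
    have "variation g 0 t' = variation g 0 t + variation g t t'"
      using that by (intro antisym variation_subadditive variation_superadditive)
    then have "v t' = v t + enn2real (variation g t t')"
      using that fin'[of 0 t] fin'[of t t'] by (simp add: v_def enn2real_plus)
    then show ?thesis by simp
  qed
  have g_v: "dist (g t) (g t') \<le> v t' - v t" if "0 \<le> t" "t \<le> t'" "t' \<le> 1" for t t'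
  proof -
    have "dist (g t) (g t') = enn2real (ennreal (dist (g t) (g t')))" by simp
    also have "\<dots> \<le> enn2real (variation g t t')"
      using dist_le_variation[of t t' g] fin'[of t t'] that by (intro enn2real_mono) auto
    finally show ?thesis using v_diff[OF that] by simp
  qed
  have "variation g 0 0 \<le> 0"
  proof (rule variation_least)
    fix n and s :: "nat \<Rightarrow> real" assume "range s \<subseteq> {0..0}"
    then have "s i = 0" for i by (auto simp: image_subset_iff)
    then show "(\<Sum>i<n. ennreal (dist (g (s i)) (g (s (Suc i))))) \<le> 0" by simp
  qed
  then have v0: "v 0 = 0" by (simp add: v_def)
  have v1: "v 1 \<le> L"
  proof -
    have "v 1 \<le> enn2real (ennreal L)" unfolding v_def using fin[of 0 1] by (intro enn2real_mono) auto
    then show ?thesis using L by simp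
  qed
  define S where "S s = {t \<in> {0..1}. v t \<le> s}" for s
  define T where "T s = Sup (S s)" for s
  have S0: "0 \<in> S s" if "0 \<le> s" for s using that v0 by (simp add: S_def)
  have bdd: "bdd_above (S s)" for s by (rule bdd_aboveI[of _ 1]) (auto simp: S_def)
  have T_ge: "t \<le> T s" if "t \<in> S s" for t s unfolding T_def using that bdd by (rule cSup_upper)
  have T01: "0 \<le> T s" "T s \<le> 1" if "0 \<le> s" for s
    using T_ge[OF S0[OF that]] S0[OF that] unfolding T_def
    by (auto intro!: cSup_least simp: S_def)
  have T_mono: "T s \<le> T s'" if "0 \<le> s" "s \<le> s'" for s s'
    unfolding T_def
  proof (rule cSup_subset_mono[OF _ bdd])
    show "S s \<noteq> {}" using S0[OF that(1)] by blast
    show "S s \<subseteq> S s'" using that by (auto simp: S_def)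
  qed
  have contT: "\<exists>d>0. \<forall>t\<in>{0..1}. \<bar>t - T s\<bar> < d \<longrightarrow> dist (g t) (g (T s)) < e" if "0 \<le> s" "0 < e" for s e
    using cont T01[OF that(1)] that(2) unfolding continuous_on_iff dist_real_def by auto
  \<comment> \<open>Without continuity of \<open>v\<close> the supremum \<open>T s\<close> need not
    belong to \<open>S s\<close>; it is approached from below by members of \<open>S s\<close> at
    which \<open>g\<close> is close to \<open>g (T s)\<close>.\<close>
  have below: "\<exists>t. a < t \<and> t \<le> T s \<and> t \<in> S s \<and> dist (g t) (g (T s)) < e" if A: "0 \<le> s" "a < T s" "0 < e" for s a e
  proof -
    obtain d where d: "d > 0" "\<forall>t\<in>{0..1}. \<bar>t - T s\<bar> < d \<longrightarrow> dist (g t) (g (T s)) < e"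
      using contT[OF A(1,3)] by blast
    have "S s \<noteq> {}" using S0[OF A(1)] by blast
    moreover have "max a (T s - d) < Sup (S s)" using d(1) A(2) unfolding T_def by simp
    ultimately have "\<exists>t\<in>S s. max a (T s - d) < t" by (rule less_cSupD)
    then obtain t where t: "t \<in> S s" "max a (T s - d) < t" by auto
    then have "dist (g t) (g (T s)) < e" using d(2) T_ge[OF t(1)] by (auto simp: S_def)
    then show ?thesis using t T_ge[OF t(1)] by auto
  qed
  have lip: "dist (g (T s)) (g (T s')) \<le> s' - s" if ss: "0 \<le> s" "s \<le> s'" for s s'
  proof (cases "T s = T s'")
    case True
    then show ?thesis using ss by simp
  next
    case False
    then have less: "T s < T s'" using T_mono[OF ss] by simp
    have s': "0 \<le> s'" using ss by simp
    show ?thesis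
    proof (rule field_le_epsilon)
      fix e :: real assume e: "0 < e"
      obtain d where d: "d > 0" "\<forall>t\<in>{0..1}. \<bar>t - T s\<bar> < d \<longrightarrow> dist (g t) (g (T s)) < e / 2"
        using contT[OF ss(1), of "e / 2"] e by auto
      \<comment> \<open>\<open>t\<close> is taken just after \<open>T s\<close>, where the length
        exceeds \<open>s\<close>, and \<open>t'\<close> close to \<open>T s'\<close> from below,
        where it is at most \<open>s'\<close>. The midpoint keeps the two in order.\<close>
      let ?m = "(T s + T s') / 2"
      obtain t' where t': "?m < t'" "t' \<le> T s'" "t' \<in> S s'" "dist (g t') (g (T s')) < e / 2"
        using below[OF s', of ?m "e / 2"] less e by auto
      define t where "t = min ?m (T s + d / 2)"
      have t: "T s < t" "t \<le> ?m" "t < T s + d" using less d(1) by (simp_all add: t_def min_def)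
      have t01: "0 \<le> t" "t \<le> 1" using t T01[OF ss(1)] T01[OF s'] by auto
      have "t \<notin> S s" using T_ge[of t s] t(1) by auto
      then have "s < v t" using t01 by (auto simp: S_def)
      moreover have "v t' \<le> s'" "t' \<le> 1" using t'(3) by (auto simp: S_def)
      ultimately have "dist (g t) (g t') \<le> s' - s" using g_v[of t t'] t t' t01 by auto
      moreover have "dist (g t) (g (T s)) < e / 2" using d(2) t t01 by auto
      ultimately show "dist (g (T s)) (g (T s')) \<le> s' - s + e"
        using t'(4) dist_triangle[of "g (T s)" "g (T s')" "g t"] dist_triangle[of "g t" "g (T s')" "g t'"]
        by (simp add: dist_commute)
    qed
  qed
  \<comment> \<open>\<open>T 0\<close> is positive if \<open>g\<close> pauses at the beginning, but
    up to then \<open>g\<close> has not moved.\<close>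
  have start: "g (T 0) = g 0"
  proof (rule ccontr)
    assume ne: "g (T 0) \<noteq> g 0"
    then have "T 0 \<noteq> 0" by auto
    then have "0 < T 0" using T01[of 0] by simp
    then obtain t where t: "0 < t" "t \<in> S 0" "dist (g t) (g (T 0)) < dist (g 0) (g (T 0))"
      using below[of 0 0 "dist (g 0) (g (T 0))"] ne by (auto simp: dist_commute)
    then have "dist (g 0) (g t) \<le> v t - v 0" "v t \<le> 0" by (auto intro!: g_v simp: S_def)
    then have "dist (g 0) (g t) \<le> 0" using v0 by linarith
    then have "g 0 = g t" by simp
    then show False using t(3) by simp
  qed
  \<comment> \<open>The total length is at most \<open>L\<close>, so for \<open>s = L\<close> all of
    \<open>{0..1}\<close> has been run through.\<close>
  have TL: "T L = 1"
    using T01[of L] T_ge[of 1 L] v1 L by (auto simp: S_def)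
  show ?thesis
  proof
    show "g (T 0) = pathstart g" using start by (simp add: pathstart_def)
    show "g (T L) = pathfinish g" by (simp add: TL pathfinish_def)
    show "g (T s) \<in> X" if "0 \<le> s" for s
      using T01[OF that] g(2) by (auto simp: path_image_def)
    show "norm (g (T s') - g (T s)) \<le> s' - s" if "0 \<le> s" "s \<le> s'" for s s'
      using lip[OF that] by (simp add: dist_norm norm_minus_commute)
  qed
qed

lemma geodesic_parametrization:
  assumes "geodesic_dist X x y < ennreal L" "0 < L"
  obtains \<sigma> where "\<sigma> 0 = x" "\<sigma> L = y" "\<And>s. 0 \<le> s \<Longrightarrow> s \<le> L \<Longrightarrow> \<sigma> s \<in> X"
    "\<And>s s'. 0 \<le> s \<Longrightarrow> s \<le> s' \<Longrightarrow> s' \<le> L \<Longrightarrow> norm (\<sigma> s' - \<sigma> s) \<le> s' - s"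
proof -
  obtain g where g: "path g" "path_image g \<subseteq> X" "pathstart g = x" "pathfinish g = y" "curve_length g < ennreal L"
    using assms(1) unfolding geodesic_dist_def INF_less_iff by blast
  obtain \<sigma> where "\<sigma> 0 = pathstart g" "\<sigma> L = pathfinish g" "\<And>s. 0 \<le> s \<Longrightarrow> s \<le> L \<Longrightarrow> \<sigma> s \<in> X"
    "\<And>s s'. 0 \<le> s \<Longrightarrow> s \<le> s' \<Longrightarrow> s' \<le> L \<Longrightarrow> norm (\<sigma> s' - \<sigma> s) \<le> s' - s"
    using arc_length_parametrization[OF g(1,2,5) assms(2)] by metis
  with that g(3,4) show ?thesis by metis
qed

section \<open>The detour and its speed\<close>

lemma nn_integral_combine_Icc:
  assumes "u \<le> w" "w \<le> (v::real)" and [measurable]: "f \<in> borel_measurable lebesgue"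
  shows "(\<integral>\<^sup>+t\<in>{u..w}. f t \<partial>lebesgue) + (\<integral>\<^sup>+t\<in>{w..v}. f t \<partial>lebesgue) = (\<integral>\<^sup>+t\<in>{u..v}. f t \<partial>lebesgue)"
proof -
  have "(\<integral>\<^sup>+t\<in>{u..w}. f t \<partial>lebesgue) + (\<integral>\<^sup>+t\<in>{w..v}. f t \<partial>lebesgue) =
      (\<integral>\<^sup>+t. f t * indicator {u..w} t + f t * indicator {w..v} t \<partial>lebesgue)"
    by (intro nn_integral_add[symmetric] borel_measurable_times_ennreal borel_measurable_indicator assms(3)) auto
  also have "\<dots> = (\<integral>\<^sup>+t\<in>{u..v}. f t \<partial>lebesgue)"
  proof (rule nn_integral_cong_AE)
    show "AE t in lebesgue. f t * indicator {u..w} t + f t * indicator {w..v} t = f t * indicator {u..v} t"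
      using AE_lebesgue_neq[of w] by eventually_elim (use assms(1,2) in \<open>auto simp: indicator_def\<close>)
  qed
  finally show ?thesis .
qed

lemma norm_vector_derivative_le:
  fixes f :: "real \<Rightarrow> 'a::euclidean_space"
  assumes f: "(f has_vector_derivative v) (at t)" and t: "a < t" "t < b"
    and lip: "\<And>s s'. a \<le> s \<Longrightarrow> s \<le> s' \<Longrightarrow> s' \<le> b \<Longrightarrow> norm (f s' - f s) \<le> s' - s"
  shows "norm v \<le> 1"
proof (rule tendsto_upperbound)
  show "((\<lambda>h. norm ((f (t + h) - f t) /\<^sub>R h)) \<longlongrightarrow> norm v) (at 0)"
    using f unfolding has_vector_derivative_iff_quotient by (rule tendsto_norm)
  have "\<forall>\<^sub>F h in at 0. h \<in> {a - t<..<b - t}" using t by (intro eventually_at_in_open') auto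
  moreover have "\<forall>\<^sub>F h::real in at 0. h \<noteq> 0" by (simp add: eventually_at_filter)
  ultimately show "\<forall>\<^sub>F h in at 0. norm ((f (t + h) - f t) /\<^sub>R h) \<le> 1"
  proof eventually_elim
    case (elim h)
    have "norm (f (t + h) - f t) \<le> \<bar>h\<bar>"
      using lip[of t "t + h"] lip[of "t + h" t] elim(1) t by (cases "h > 0") (auto simp: norm_minus_commute)
    then show ?case using elim(2) by (simp add: divide_simps)
  qed
qed simp

lemma AE_has_velocity:
  assumes "abs_continuous_curve \<gamma>"
  shows "AE t in lebesgue. 0 < t \<longrightarrow> (\<gamma> has_vector_derivative velocity \<gamma> t) (at t)"
proof -
  let ?N = "\<lambda>b. {t \<in> {0<..<b}. \<not> (\<gamma> has_vector_derivative velocity \<gamma> t) (at t)}"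
  have "velocity_integral \<gamma> 0 (real n)" for n
    using assms by (intro abs_continuous_on_velocity_integral) (auto simp: abs_continuous_curve_def)
  then have "?N (real n) \<in> null_sets lebesgue" for n
    by (simp add: velocity_integral_def negligible_iff_null_sets)
  then have "(\<Union>n. ?N (real n)) \<in> null_sets lebesgue" by (intro null_sets_UN) auto
  then have "AE t in lebesgue. t \<notin> (\<Union>n. ?N (real n))" by (rule AE_not_in)
  then show ?thesis
  proof eventually_elim
    case (elim t)
    obtain n where "t < real n" using reals_Archimedean2 by blast
    then show ?case using elim by auto
  qed
qed

text \<open>The minimum is \<open>2 * (t - L)\<close> up to time \<open>2 * L\<close> and \<open>t\<close> afterwards.\<close>

definition detour :: "(real \<Rightarrow> 'a) \<Rightarrow> real \<Rightarrow> (real \<Rightarrow> 'a) \<Rightarrow> real \<Rightarrow> 'a" where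
  "detour \<sigma> L \<omega> t = (if t < 0 then undefined else if t \<le> L then \<sigma> t else \<omega> (min (2 * (t - L)) t))"

text \<open>\<open>L\<close> is the duration of the joining path and at the same time a bound for
  its length; the path thus has speed at most \<open>1\<close> and needs energy at most
  \<open>L\<close>, whatever \<open>\<theta>\<close> is.\<close>

locale detour_curve =
  fixes X :: "'a::euclidean_space set" and \<sigma> \<omega> :: "real \<Rightarrow> 'a" and L \<theta> :: real
  assumes L: "0 < L" and \<sigma>X: "\<And>s. 0 \<le> s \<Longrightarrow> s \<le> L \<Longrightarrow> \<sigma> s \<in> X"
    and lip: "\<And>s s'. 0 \<le> s \<Longrightarrow> s \<le> s' \<Longrightarrow> s' \<le> L \<Longrightarrow> norm (\<sigma> s' - \<sigma> s) \<le> s' - s"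
    and joint: "\<sigma> L = \<omega> 0" and \<omega>: "\<omega> \<in> curves X" "abs_continuous_curve \<omega>"
    and \<theta>: "\<theta> > 1" and fin: "energy \<theta> \<omega> < \<infinity>"
begin

abbreviation "\<nu> \<equiv> detour \<sigma> L \<omega>"

text \<open>A bound for the speed of the detour in terms of \<omega>. It yields absolute continuity
  of the detour before anything is known about its derivative.\<close>

definition speed :: "real \<Rightarrow> real" where
  "speed t = (if t \<le> L then 1 else if t \<le> 2 * L then 2 * norm (pos_velocity \<omega> (2 * (t - L))) else norm (pos_velocity \<omega> t))"

lemma detour_eq:
  "0 \<le> t \<Longrightarrow> t \<le> L \<Longrightarrow> \<nu> t = \<sigma> t" "L \<le> t \<Longrightarrow> t \<le> 2 * L \<Longrightarrow> \<nu> t = \<omega> (2 * (t - L))" "2 * L \<le> t \<Longrightarrow> \<nu> t = \<omega> t"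
  using L joint by (auto simp: detour_def min_def)

lemma detour_curves: "\<nu> \<in> curves X"
proof -
  have "continuous_on {0..} (\<lambda>t. if t \<le> L then \<sigma> t else \<omega> (min (2 * (t - L)) t))"
  proof (rule continuous_on_cases_le)
    have "1-lipschitz_on {0..L} \<sigma>"
    proof (rule lipschitz_onI)
      fix x y assume "x \<in> {0..L}" "y \<in> {0..L}"
      then show "dist (\<sigma> x) (\<sigma> y) \<le> 1 * dist x y"
        using lip[of x y] lip[of y x] by (cases "x \<le> y") (auto simp: dist_norm norm_minus_commute)
    qed simp
    then have "continuous_on {0..L} \<sigma>" by (rule lipschitz_on_continuous_on)
    then show "continuous_on {t \<in> {0..}. t \<le> L} \<sigma>" by (rule continuous_on_subset) auto
    show "continuous_on {t \<in> {0..}. L \<le> t} (\<lambda>t. \<omega> (min (2 * (t - L)) t))"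
      using L by (intro continuous_on_compose2[OF curvesD(1)[OF \<omega>(1)]] continuous_intros) auto
  qed (use joint L in \<open>auto intro: continuous_on_id\<close>)
  then have "continuous_on {0..} \<nu>"
    by (rule continuous_on_eq) (auto simp: detour_def)
  moreover have "\<nu> t \<in> X" if "0 \<le> t" for t
    using that \<sigma>X[of t] curvesD(2)[OF \<omega>(1), of "min (2 * (t - L)) t"] by (auto simp: detour_def)
  moreover have "\<nu> t = undefined" if "t < 0" for t using that by (simp add: detour_def)
  ultimately show ?thesis by (auto simp: curves_def PiE_def extensional_def not_le)
qed

lemma speed_borel: "speed \<in> borel_measurable borel"
proof -
  note pos_velocity_borel[OF \<omega>(1), measurable]
  show ?thesis unfolding speed_def by measurable
qed

lemma speed_lebesgue: "speed \<in> borel_measurable lebesgue"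
  by (rule measurable_completion) (simp add: speed_borel)

lemma speed_nonneg: "0 \<le> speed t"
  by (simp add: speed_def)

lemma nn_integral_double_speed:
  assumes "F \<in> borel_measurable borel"
  shows "(\<integral>\<^sup>+t\<in>{2 * (u - L)..2 * (v - L)}. F t \<partial>lebesgue) = 2 * (\<integral>\<^sup>+t\<in>{u..v}. F (2 * (t - L)) \<partial>lebesgue)"
proof -
  note assms[measurable]
  have "(\<integral>\<^sup>+t\<in>{2 * (u - L)..2 * (v - L)}. F t \<partial>lborel) =
      ennreal \<bar>2\<bar> * (\<integral>\<^sup>+t. F (- 2 * L + 2 * t) * indicator {2 * (u - L)..2 * (v - L)} (- 2 * L + 2 * t) \<partial>lborel)"
    by (rule nn_integral_real_affine) auto
  also have "\<dots> = 2 * (\<integral>\<^sup>+t\<in>{u..v}. F (2 * (t - L)) \<partial>lborel)"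
    by (auto intro!: arg_cong2[where f = "(*)"] nn_integral_cong simp: indicator_def algebra_simps)
  finally show ?thesis unfolding nn_integral_completion .
qed

lemma detour_increment:
  assumes "0 \<le> u" "u \<le> v"
  shows "ennreal (norm (\<nu> v - \<nu> u)) \<le> (\<integral>\<^sup>+t\<in>{u..v}. ennreal (speed t) \<partial>lebesgue)"
proof -
  \<comment> \<open>The estimate is additive over adjacent intervals, so it suffices to establish it
    on each of the three pieces.\<close>
  define P where "P u v \<longleftrightarrow> ennreal (norm (\<nu> v - \<nu> u)) \<le> (\<integral>\<^sup>+t\<in>{u..v}. ennreal (speed t) \<partial>lebesgue)" for u v
  have trans: "P u v" if "P u w" "P w v" "u \<le> w" "w \<le> v" for u w v
  proof -
    have "norm (\<nu> v - \<nu> u) \<le> norm (\<nu> w - \<nu> u) + norm (\<nu> v - \<nu> w)"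
      using norm_triangle_ineq[of "\<nu> w - \<nu> u" "\<nu> v - \<nu> w"] by simp
    then have "ennreal (norm (\<nu> v - \<nu> u)) \<le> ennreal (norm (\<nu> w - \<nu> u)) + ennreal (norm (\<nu> v - \<nu> w))"
      by (metis ennreal_leI ennreal_plus norm_ge_zero)
    also have "\<dots> \<le> (\<integral>\<^sup>+t\<in>{u..w}. ennreal (speed t) \<partial>lebesgue) + (\<integral>\<^sup>+t\<in>{w..v}. ennreal (speed t) \<partial>lebesgue)"
      using that unfolding P_def by (intro add_mono)
    also have "\<dots> = (\<integral>\<^sup>+t\<in>{u..v}. ennreal (speed t) \<partial>lebesgue)"
      using that speed_lebesgue by (intro nn_integral_combine_Icc) auto
    finally show ?thesis unfolding P_def .
  qed
  have P1: "P u v" if "0 \<le> u" "u \<le> v" "v \<le> L" for u v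
  proof -
    have "ennreal (norm (\<nu> v - \<nu> u)) \<le> ennreal (v - u)"
      using that lip[of u v] by (intro ennreal_leI) (simp add: detour_eq)
    also have "\<dots> = (\<integral>\<^sup>+t\<in>{u..v}. 1 \<partial>lebesgue)" using that by simp
    also have "\<dots> = (\<integral>\<^sup>+t\<in>{u..v}. ennreal (speed t) \<partial>lebesgue)"
      using that by (intro nn_integral_cong) (auto simp: speed_def indicator_def)
    finally show ?thesis unfolding P_def .
  qed
  have P2: "P u v" if "L \<le> u" "u \<le> v" "v \<le> 2 * L" for u v
  proof -
    note pos_velocity_borel[OF \<omega>(1), measurable]
    have "ennreal (norm (\<nu> v - \<nu> u)) \<le>
        (\<integral>\<^sup>+t\<in>{2 * (u - L)..2 * (v - L)}. ennreal (norm (pos_velocity \<omega> t)) \<partial>lebesgue)"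
      using that increment_le_nn_integral[OF \<omega>(2), of "2 * (u - L)" "2 * (v - L)"] by (simp add: detour_eq)
    also have "\<dots> = 2 * (\<integral>\<^sup>+t\<in>{u..v}. ennreal (norm (pos_velocity \<omega> (2 * (t - L)))) \<partial>lebesgue)"
      by (rule nn_integral_double_speed) measurable
    also have "\<dots> = (\<integral>\<^sup>+t\<in>{u..v}. ennreal (speed t) \<partial>lebesgue)"
      unfolding nn_integral_completion
    proof (subst nn_integral_cmult[symmetric])
      show "(\<integral>\<^sup>+t. 2 * (ennreal (norm (pos_velocity \<omega> (2 * (t - L)))) * indicator {u..v} t) \<partial>lborel) =
          (\<integral>\<^sup>+t\<in>{u..v}. ennreal (speed t) \<partial>lborel)"
      proof (rule nn_integral_cong_AE)
        have "AE t in lborel. t \<noteq> L" by (rule AE_lborel_singleton)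
        then show "AE t in lborel. 2 * (ennreal (norm (pos_velocity \<omega> (2 * (t - L)))) * indicator {u..v} t) =
            ennreal (speed t) * indicator {u..v} t"
          by eventually_elim (use that in \<open>auto simp: speed_def indicator_def ennreal_mult\<close>)
      qed
    qed measurable
    finally show ?thesis unfolding P_def .
  qed
  have P3: "P u v" if "2 * L \<le> u" "u \<le> v" for u v
  proof -
    have "ennreal (norm (\<nu> v - \<nu> u)) \<le> (\<integral>\<^sup>+t\<in>{u..v}. ennreal (norm (pos_velocity \<omega> t)) \<partial>lebesgue)"
      using that L increment_le_nn_integral[OF \<omega>(2), of u v] by (simp add: detour_eq)
    also have "\<dots> = (\<integral>\<^sup>+t\<in>{u..v}. ennreal (speed t) \<partial>lebesgue)"
    proof (rule nn_integral_cong_AE)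
      show "AE t in lebesgue. ennreal (norm (pos_velocity \<omega> t)) * indicator {u..v} t =
          ennreal (speed t) * indicator {u..v} t"
        using AE_lebesgue_neq[of "2 * L"]
        by eventually_elim (use that L in \<open>auto simp: speed_def indicator_def\<close>)
    qed
    finally show ?thesis unfolding P_def .
  qed
  have P23: "P u v" if "L \<le> u" "u \<le> v" for u v
    using P2[of u v] P3[of u v] trans[of u "2 * L" v] P2[of u "2 * L"] P3[of "2 * L" v] that
    by (cases "v \<le> 2 * L"; cases "2 * L \<le> u") auto
  have "P u v"
    using P1[of u v] P23[of u v] trans[of u L v] P1[of u L] P23[of L v] assms
    by (cases "v \<le> L"; cases "L \<le> u") auto
  then show ?thesis unfolding P_def .
qed

text \<open>At double speed the integrand grows by the factor \<open>2 powr \<theta>\<close>, while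
  the change of time contributes a factor \<open>1 / 2\<close>, which is given away.\<close>

lemma speed_energy_le:
  "(\<integral>\<^sup>+t\<in>{0..2 * L}. ennreal (speed t powr \<theta>) \<partial>lebesgue) \<le>
    ennreal L + ennreal (2 powr \<theta>) * (\<integral>\<^sup>+t\<in>{0..2 * L}. ennreal (norm (velocity \<omega> t) powr \<theta>) \<partial>lebesgue)"
proof -
  note pos_velocity_borel[OF \<omega>(1), measurable]
  let ?k = "\<lambda>t. ennreal (norm (pos_velocity \<omega> t) powr \<theta>)"
  let ?J = "\<integral>\<^sup>+t\<in>{L..2 * L}. ?k (2 * (t - L)) \<partial>lebesgue"
  have first: "(\<integral>\<^sup>+t\<in>{0..L}. ennreal (speed t powr \<theta>) \<partial>lebesgue) = ennreal L"
  proof -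
    have "(\<integral>\<^sup>+t\<in>{0..L}. ennreal (speed t powr \<theta>) \<partial>lebesgue) = (\<integral>\<^sup>+t\<in>{0..L}. 1 \<partial>lebesgue)"
      by (intro nn_integral_cong) (auto simp: speed_def indicator_def)
    then show ?thesis using L by simp
  qed
  have second: "(\<integral>\<^sup>+t\<in>{L..2 * L}. ennreal (speed t powr \<theta>) \<partial>lebesgue) = ennreal (2 powr \<theta>) * ?J"
  proof -
    have "(\<integral>\<^sup>+t\<in>{L..2 * L}. ennreal (speed t powr \<theta>) \<partial>lebesgue) =
        (\<integral>\<^sup>+t. ennreal (2 powr \<theta>) * (?k (2 * (t - L)) * indicator {L..2 * L} t) \<partial>lebesgue)"
    proof (rule nn_integral_cong_AE)
      show "AE t in lebesgue. ennreal (speed t powr \<theta>) * indicator {L..2 * L} t =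
          ennreal (2 powr \<theta>) * (?k (2 * (t - L)) * indicator {L..2 * L} t)"
        using AE_lebesgue_neq[of L]
        by eventually_elim (auto simp: speed_def indicator_def powr_mult ennreal_mult)
    qed
    also have "\<dots> = ennreal (2 powr \<theta>) * ?J"
      unfolding nn_integral_completion by (rule nn_integral_cmult) measurable
    finally show ?thesis .
  qed
  have J: "?J \<le> (\<integral>\<^sup>+t\<in>{0..2 * L}. ennreal (norm (velocity \<omega> t) powr \<theta>) \<partial>lebesgue)"
  proof -
    have "?J \<le> ?J + ?J" by (rule add_increasing2) simp_all
    also have "\<dots> = (\<integral>\<^sup>+t\<in>{2 * (L - L)..2 * (2 * L - L)}. ?k t \<partial>lebesgue)"
      unfolding mult_2[symmetric] by (rule nn_integral_double_speed[symmetric]) measurable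
    also have "\<dots> = (\<integral>\<^sup>+t\<in>{0..2 * L}. ennreal (norm (velocity \<omega> t) powr \<theta>) \<partial>lebesgue)"
      using nn_integral_pos_velocity[of "{0..2 * L}" "\<lambda>t p. ennreal (norm p powr \<theta>)" \<omega>] by simp
    finally show ?thesis .
  qed
  have "(\<integral>\<^sup>+t\<in>{0..2 * L}. ennreal (speed t powr \<theta>) \<partial>lebesgue) =
      (\<integral>\<^sup>+t\<in>{0..L}. ennreal (speed t powr \<theta>) \<partial>lebesgue) + (\<integral>\<^sup>+t\<in>{L..2 * L}. ennreal (speed t powr \<theta>) \<partial>lebesgue)"
    using L speed_lebesgue by (intro nn_integral_combine_Icc[symmetric]) auto
  also have "\<dots> = ennreal L + ennreal (2 powr \<theta>) * ?J" by (simp only: first second)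
  finally show ?thesis using J by (simp add: add_left_mono mult_left_mono)
qed

lemma detour_abs_continuous: "abs_continuous_curve \<nu>"
proof (rule abs_continuous_curve_of_speed[OF speed_lebesgue speed_nonneg detour_increment _ \<theta>])
  have "(\<integral>\<^sup>+t\<in>{0..}. ennreal (speed t powr \<theta>) \<partial>lebesgue) \<le>
      (\<integral>\<^sup>+t. ennreal (speed t powr \<theta>) * indicator {0..2 * L} t + ennreal (norm (pos_velocity \<omega> t) powr \<theta>) * indicator {0..} t \<partial>lebesgue)"
    using L by (intro nn_integral_mono) (auto simp: indicator_def speed_def)
  also have "\<dots> = (\<integral>\<^sup>+t\<in>{0..2 * L}. ennreal (speed t powr \<theta>) \<partial>lebesgue) + energy \<theta> \<omega>"
    unfolding energy_pos_velocity
    using speed_lebesgue pos_velocity_measurable[OF \<omega>(1)]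
    by (intro nn_integral_add borel_measurable_times_ennreal borel_measurable_indicator) auto
  also have "\<dots> \<le> (ennreal L + ennreal (2 powr \<theta>) * energy \<theta> \<omega>) + energy \<theta> \<omega>"
  proof -
    have "(\<integral>\<^sup>+t\<in>{0..2 * L}. ennreal (norm (velocity \<omega> t) powr \<theta>) \<partial>lebesgue) \<le> energy \<theta> \<omega>"
      unfolding energy_def by (intro nn_integral_mono) (auto simp: indicator_def)
    then show ?thesis
      using speed_energy_le by (intro add_right_mono) (meson add_left_mono mult_left_mono order_trans zero_le)
  qed
  also have "\<dots> < \<infinity>" using fin by (simp add: ennreal_mult_less_top)
  finally show "(\<integral>\<^sup>+t\<in>{0..}. ennreal (speed t powr \<theta>) \<partial>lebesgue) < \<infinity>" .
qed

text \<open>Absolute continuity provides a derivative of the detour at almost every time, and on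
  each piece this derivative is handed on to \<sigma> or \<omega>. Arguing in this direction avoids
  transporting the null set of \<omega> through the change of time.\<close>

lemma detour_velocity:
  "AE t in lebesgue. (0 < t \<longrightarrow> norm (velocity \<nu> t) \<le> speed t) \<and> (2 * L < t \<longrightarrow> velocity \<nu> t = velocity \<omega> t)"
  using AE_has_velocity[OF detour_abs_continuous] AE_lebesgue_neq[of L] AE_lebesgue_neq[of "2 * L"]
proof eventually_elim
  case (elim t)
  have late: "velocity \<nu> t = velocity \<omega> t" if t: "2 * L < t"
  proof -
    have "(\<nu> has_vector_derivative velocity \<nu> t) (at t)" using elim(1) t L by simp
    then have "(\<omega> has_vector_derivative velocity \<nu> t) (at t)"
      by (rule has_vector_derivative_transform_within_open[where S = "{2 * L<..}"])
        (use t in \<open>auto simp: detour_eq\<close>)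
    then show ?thesis by (simp add: vector_derivative_at)
  qed
  have "norm (velocity \<nu> t) \<le> speed t" if t0: "0 < t"
  proof -
    have der: "(\<nu> has_vector_derivative velocity \<nu> t) (at t)" using elim(1) t0 by simp
    consider "t < L" | "L < t" "t < 2 * L" | "2 * L < t" using elim(2,3) by linarith
    then show ?thesis
    proof cases
      case 1
      have "norm (velocity \<nu> t) \<le> 1"
        by (rule norm_vector_derivative_le[OF der t0 1]) (use lip in \<open>auto simp: detour_eq\<close>)
      then show ?thesis using 1 by (simp add: speed_def)
    next
      case 2
      let ?s = "2 * (t - L)"
      have half: "?s / 2 + L = t" by (simp add: field_simps)
      \<comment> \<open>The chain rule is used for the inverse change of time; it turns the
        derivative of the detour at \<open>t\<close> into one of \<omega> at
        \<open>?s\<close>.\<close>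
      have "((\<lambda>s. s / 2 + L) has_vector_derivative (1 / 2 :: real)) (at ?s)"
        by (auto intro!: derivative_eq_intros)
      moreover have "(\<nu> has_vector_derivative velocity \<nu> t) (at (?s / 2 + L))" using der half by simp
      ultimately have "((\<nu> \<circ> (\<lambda>s. s / 2 + L)) has_vector_derivative ((1 / 2) *\<^sub>R velocity \<nu> t)) (at ?s)"
        by (rule vector_diff_chain_at)
      then have "(\<omega> has_vector_derivative ((1 / 2) *\<^sub>R velocity \<nu> t)) (at ?s)"
        by (rule has_vector_derivative_transform_within_open[where S = "{0<..<2 * L}"])
          (use 2 in \<open>auto simp: detour_eq\<close>)
      then have "velocity \<omega> ?s = (1 / 2) *\<^sub>R velocity \<nu> t" by (rule vector_derivative_at)
      then show ?thesis using 2 by (simp add: speed_def pos_velocity_def)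
    next
      case 3
      then show ?thesis using late L t0 by (simp add: speed_def pos_velocity_def)
    qed
  qed
  then show ?case using late by simp
qed

lemma detour_energy_le:
  "(\<integral>\<^sup>+t\<in>{0..2 * L}. ennreal (norm (velocity \<nu> t) powr \<theta>) \<partial>lebesgue) \<le>
    ennreal L + ennreal (2 powr \<theta>) * (\<integral>\<^sup>+t\<in>{0..2 * L}. ennreal (norm (velocity \<omega> t) powr \<theta>) \<partial>lebesgue)"
proof (rule order_trans[OF _ speed_energy_le], rule nn_integral_mono_AE)
  show "AE t in lebesgue. ennreal (norm (velocity \<nu> t) powr \<theta>) * indicator {0..2 * L} t \<le>
      ennreal (speed t powr \<theta>) * indicator {0..2 * L} t"
    using detour_velocity AE_lebesgue_neq[of 0]
    by eventually_elim (use \<theta> in \<open>auto simp: indicator_def intro!: ennreal_leI powr_mono2\<close>)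
qed

text \<open>Every visit of \<omega> to \<open>\<Xi>\<close> happens at or after
  \<open>2 * L\<close>, where the detour coincides with \<omega>. The joining path may meet
  \<open>\<Xi>\<close> earlier, hence an inequality.\<close>

lemma exit_time_detour_le: "ennreal (2 * L) \<le> exit_time \<Xi> \<omega> \<Longrightarrow> exit_time \<Xi> \<nu> \<le> exit_time \<Xi> \<omega>"
  unfolding exit_time_def[of \<Xi> \<omega>]
proof (rule INF_greatest)
  fix t assume le: "ennreal (2 * L) \<le> (INF t\<in>{t. 0 \<le> t \<and> \<omega> t \<in> \<Xi>}. ennreal t)" and t: "t \<in> {t. 0 \<le> t \<and> \<omega> t \<in> \<Xi>}"
  have "ennreal (2 * L) \<le> ennreal t" using le INF_lower[OF t, of ennreal] by (rule order_trans)
  then have "2 * L \<le> t" using t by simp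
  then show "exit_time \<Xi> \<nu> \<le> ennreal t" using t by (intro exit_time_le) (auto simp: detour_eq)
qed

end

subsection \<open>Support, energy and exit times\<close>

text \<open>On a compact interval a strict bound leaves a positive margin, which neighbouring curves
  may use up.\<close>

lemma tube_openin:
  fixes f :: "real \<Rightarrow> 'a::euclidean_space"
  assumes "0 \<le> c" "continuous_on {c..d} f"
  shows "openin (curve_topology X) {\<omega> \<in> curves X. \<forall>t\<in>{c..d}. dist (\<omega> t) (f t) < r}"
  unfolding openin_curve_topology
proof (intro conjI ballI)
  fix \<gamma> assume "\<gamma> \<in> {\<omega> \<in> curves X. \<forall>t\<in>{c..d}. dist (\<omega> t) (f t) < r}"
  then have \<gamma>: "\<gamma> \<in> curves X" "\<And>t. t \<in> {c..d} \<Longrightarrow> dist (\<gamma> t) (f t) < r" by auto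
  have "\<exists>\<epsilon>>0. \<forall>t\<in>{c..d}. dist (\<gamma> t) (f t) + \<epsilon> \<le> r"
  proof (cases "{c..d} = {}")
    case True
    then show ?thesis by (intro exI[of _ 1]) auto
  next
    case False
    have "continuous_on {c..d} (\<lambda>t. dist (\<gamma> t) (f t))"
      using assms curvesD(1)[OF \<gamma>(1)] by (intro continuous_on_dist) (auto elim: continuous_on_subset)
    then obtain t0 where t0: "t0 \<in> {c..d}" "\<And>t. t \<in> {c..d} \<Longrightarrow> dist (\<gamma> t) (f t) \<le> dist (\<gamma> t0) (f t0)"
      using continuous_attains_sup[OF compact_Icc False] by blast
    have "r - dist (\<gamma> t0) (f t0) > 0" using \<gamma>(2)[OF t0(1)] by simp
    moreover have "dist (\<gamma> t) (f t) + (r - dist (\<gamma> t0) (f t0)) \<le> r" if "t \<in> {c..d}" for t using t0(2)[OF that] by simp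
    ultimately show ?thesis by blast
  qed
  then obtain \<epsilon> where \<epsilon>: "\<epsilon> > 0" "\<And>t. t \<in> {c..d} \<Longrightarrow> dist (\<gamma> t) (f t) + \<epsilon> \<le> r" by blast
  have "dist (\<omega> t) (f t) < r" if "\<forall>t\<in>{0..max 0 d}. dist (\<omega> t) (\<gamma> t) < \<epsilon>" "t \<in> {c..d}" for \<omega> t
  proof -
    have "t \<in> {0..max 0 d}" using that(2) assms(1) by auto
    then have "dist (\<omega> t) (\<gamma> t) < \<epsilon>" using that(1) by blast
    then show ?thesis using \<epsilon>(2)[OF that(2)] dist_triangle[of "\<omega> t" "f t" "\<gamma> t"] by linarith
  qed
  then show "\<exists>T\<ge>0. \<exists>\<epsilon>>0. \<forall>\<omega>\<in>curves X. (\<forall>t\<in>{0..T}. dist (\<omega> t) (\<gamma> t) < \<epsilon>) \<longrightarrow>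
      \<omega> \<in> {\<omega> \<in> curves X. \<forall>t\<in>{c..d}. dist (\<omega> t) (f t) < r}"
    using \<epsilon>(1) by (intro exI[of _ "max 0 d"] conjI exI[of _ \<epsilon>]) auto
qed auto

text \<open>Base sets are tubes of radius \<open>1 / (k + 1)\<close> around step functions. These
  take values in a countable dense set on finitely many cells of a grid of mesh
  \<open>1 / (N + 1)\<close>, so a list encodes them.\<close>

lemma curve_topology_countable_base:
  fixes X :: "'a::euclidean_space set"
  obtains \<F> where "countable \<F>" "\<And>U. U \<in> \<F> \<Longrightarrow> openin (curve_topology X) U"
    "\<And>V \<gamma>. openin (curve_topology X) V \<Longrightarrow> \<gamma> \<in> V \<Longrightarrow> \<exists>U\<in>\<F>. \<gamma> \<in> U \<and> U \<subseteq> V"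
proof -
  obtain D :: "'a set" where D: "countable D" "\<And>S. open S \<Longrightarrow> S \<noteq> {} \<Longrightarrow> \<exists>d\<in>D. d \<in> S"
    using countable_dense_setE by blast
  define tube where "tube N k q i = {\<omega> \<in> curves X. \<forall>t\<in>{real i / real (Suc N)..real (Suc i) / real (Suc N)}.
    dist (\<omega> t) (q :: 'a) < inverse (real (Suc k))}" for N k i :: nat and q
  define U where "U = (\<lambda>(N, k, qs). (\<Inter>i<length qs. tube N k (qs ! i) i) \<inter> curves X)"
  show ?thesis
  proof
    show "countable (U ` (UNIV \<times> UNIV \<times> lists D))" using D(1) by (intro countable_image countable_SIGMA countable_lists) auto
    have "openin (curve_topology X) (U (N, k, qs))" for N k qs
    proof -
      have "openin (curve_topology X) (tube N k q i)" for q i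
        unfolding tube_def by (rule tube_openin) auto
      then have "openin (curve_topology X) ((\<Inter>i\<in>{..<length qs}. tube N k (qs ! i) i) \<inter> topspace (curve_topology X))"
        by (intro openin_INT) auto
      then show ?thesis by (simp add: U_def topspace_curve_topology)
    qed
    then show "openin (curve_topology X) W" if "W \<in> U ` (UNIV \<times> UNIV \<times> lists D)" for W
      using that by auto
    fix V \<gamma> assume V: "openin (curve_topology X) V" "\<gamma> \<in> V"
    then obtain T \<epsilon> where T: "T \<ge> 0" "\<epsilon> > 0"
        "\<And>\<omega>. \<omega> \<in> curves X \<Longrightarrow> (\<forall>t\<in>{0..T}. dist (\<omega> t) (\<gamma> t) < \<epsilon>) \<Longrightarrow> \<omega> \<in> V"
      unfolding openin_curve_topology by meson
    have \<gamma>: "\<gamma> \<in> curves X" using V openin_subset topspace_curve_topology by blast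
    obtain k :: nat where k: "inverse (real (Suc k)) < \<epsilon> / 2" using reals_Archimedean[of "\<epsilon> / 2"] T(2) by auto
    let ?r = "inverse (real (Suc k))"
    have "uniformly_continuous_on {0..T + 2} \<gamma>"
      by (intro compact_uniformly_continuous continuous_on_subset[OF curvesD(1)[OF \<gamma>]]) auto
    then obtain \<delta> where \<delta>: "\<delta> > 0" "\<And>s t. s \<in> {0..T + 2} \<Longrightarrow> t \<in> {0..T + 2} \<Longrightarrow> dist t s < \<delta> \<Longrightarrow> dist (\<gamma> t) (\<gamma> s) < ?r / 2"
      unfolding uniformly_continuous_on_def by (metis half_gt_zero inverse_positive_iff_positive of_nat_0_less_iff zero_less_Suc)
    obtain N :: nat where N: "inverse (real (Suc N)) < \<delta>" using reals_Archimedean[OF \<delta>(1)] by auto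
    let ?x = "\<lambda>i. real i / real (Suc N)"
    \<comment> \<open>\<open>n\<close> cells reach beyond \<open>T\<close> but not beyond
      \<open>T + 1\<close>; the interval of uniform continuity contains them all.\<close>
    define n where "n = Suc (nat \<lfloor>T * real (Suc N)\<rfloor>)"
    have n: "T < ?x n" "?x n \<le> T + 1"
    proof -
      have "real n = of_int \<lfloor>T * real (Suc N)\<rfloor> + 1" using T(1) by (simp add: n_def)
      then have "T * real (Suc N) < real n" "real n \<le> T * real (Suc N) + 1"
        using real_of_int_floor_add_one_gt[of "T * real (Suc N)"] of_int_floor_le[of "T * real (Suc N)"]
        by linarith+
      then show "T < ?x n" "?x n \<le> T + 1" by (simp_all add: field_simps)
    qed
    have "\<exists>q\<in>D. dist q (\<gamma> (?x i)) < ?r / 2" for i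
      using D(2)[of "ball (\<gamma> (?x i)) (?r / 2)"] by (auto simp: dist_commute)
    then obtain q where q: "\<And>i. q i \<in> D" "\<And>i. dist (q i) (\<gamma> (?x i)) < ?r / 2" by metis
    define qs where "qs = map q [0..<n]"
    have qs: "length qs = n" "\<And>i. i < n \<Longrightarrow> qs ! i = q i" by (auto simp: qs_def)
    have step: "?x (Suc i) = ?x i + inverse (real (Suc N))" for i by (simp add: field_simps)
    have xn: "?x i \<le> ?x n" if "i \<le> n" for i using that by (simp add: divide_right_mono)
    have near: "dist (q i) (\<gamma> t) < ?r" if i: "i < n" and t: "t \<in> {?x i..?x (Suc i)}" for i t
    proof -
      have "0 \<le> ?x i" by simp
      moreover have "0 \<le> t" by (rule order_trans[OF \<open>0 \<le> ?x i\<close>]) (use t in auto)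
      ultimately have "?x i \<in> {0..T + 2}" "t \<in> {0..T + 2}"
        using t n(2) xn[of i] xn[of "Suc i"] i by auto
      moreover have "dist t (?x i) < \<delta>" using t N step[of i] by (auto simp: dist_real_def)
      ultimately have "dist (\<gamma> t) (\<gamma> (?x i)) < ?r / 2" by (intro \<delta>(2))
      then show ?thesis using q(2)[of i] dist_triangle[of "q i" "\<gamma> t" "\<gamma> (?x i)"] by (simp add: dist_commute)
    qed
    have "\<gamma> \<in> U (N, k, qs)"
      using near \<gamma> by (auto simp: U_def tube_def qs dist_commute)
    moreover have "U (N, k, qs) \<subseteq> V"
    proof
      fix \<omega> assume \<omega>: "\<omega> \<in> U (N, k, qs)"
      show "\<omega> \<in> V"
      proof (rule T(3))
        show "\<omega> \<in> curves X" using \<omega> by (auto simp: U_def)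
        show "\<forall>t\<in>{0..T}. dist (\<omega> t) (\<gamma> t) < \<epsilon>"
        proof
          fix t assume t: "t \<in> {0..T}"
          define i where "i = nat \<lfloor>t * real (Suc N)\<rfloor>"
          have ri: "real i = of_int \<lfloor>t * real (Suc N)\<rfloor>" using t by (simp add: i_def)
          have i1: "real i \<le> t * real (Suc N)" "t * real (Suc N) < real i + 1"
            unfolding ri using real_of_int_floor_add_one_gt[of "t * real (Suc N)"] of_int_floor_le[of "t * real (Suc N)"] by auto
          have ti: "t \<in> {?x i..?x (Suc i)}" using i1 by (simp add: field_simps)
          have "?x i \<le> t" using ti by simp
          also have "t < ?x n" using t n(1) by auto
          finally have "i < n" by (simp add: divide_less_cancel)
          then have "dist (\<omega> t) (q i) < ?r" using \<omega> ti by (auto simp: U_def tube_def qs)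
          then show "dist (\<omega> t) (\<gamma> t) < \<epsilon>"
            using near[OF \<open>i < n\<close> ti] k dist_triangle[of "\<omega> t" "\<gamma> t" "q i"] by linarith
        qed
      qed
    qed
    moreover have "(N, k, qs) \<in> UNIV \<times> UNIV \<times> lists D" using q(1) by (auto simp: qs_def)
    ultimately show "\<exists>W\<in>U ` (UNIV \<times> UNIV \<times> lists D). \<gamma> \<in> W \<and> W \<subseteq> V" by blast
  qed
qed

text \<open>A curve outside the support has a null neighbourhood and within it a null member of the
  countable base; all these members together still form a null set.\<close>

lemma AE_curve_support:
  fixes X :: "'a::euclidean_space set"
  assumes Q: "sets Q = sets (curve_borel X)"
  shows "AE \<gamma> in Q. \<gamma> \<in> curve_support X Q"
proof -
  obtain \<F> where \<F>: "countable \<F>" "\<And>U. U \<in> \<F> \<Longrightarrow> openin (curve_topology X) U"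
    "\<And>V \<gamma>. openin (curve_topology X) V \<Longrightarrow> \<gamma> \<in> V \<Longrightarrow> \<exists>U\<in>\<F>. \<gamma> \<in> U \<and> U \<subseteq> V"
    using curve_topology_countable_base[of X] by metis
  have sets: "U \<in> sets Q" if "openin (curve_topology X) U" for U
    using openin_sets_curve_borel[OF that] Q by simp
  have space: "space Q = curves X" using sets_eq_imp_space_eq[OF Q] by (simp add: space_curve_borel)
  let ?N = "\<Union>{U \<in> \<F>. emeasure Q U = 0}"
  have "(\<Union>U\<in>{U \<in> \<F>. emeasure Q U = 0}. U) \<in> null_sets Q"
    using \<F>(1,2) sets by (intro null_sets_UN') (auto intro: countable_subset[OF _ \<F>(1)])
  then have "?N \<in> null_sets Q" by simp
  moreover have "{\<gamma> \<in> space Q. \<not> \<gamma> \<in> curve_support X Q} \<subseteq> ?N"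
  proof
    fix \<gamma> assume "\<gamma> \<in> {\<gamma> \<in> space Q. \<not> \<gamma> \<in> curve_support X Q}"
    then obtain V where V: "openin (curve_topology X) V" "\<gamma> \<in> V" "emeasure Q V = 0"
      by (auto simp: curve_support_def space not_gr_zero)
    then obtain U where U: "U \<in> \<F>" "\<gamma> \<in> U" "U \<subseteq> V" using \<F>(3) by blast
    have "emeasure Q U \<le> emeasure Q V" using U(3) sets[OF V(1)] by (rule emeasure_mono)
    then show "\<gamma> \<in> ?N" using U V(3) by auto
  qed
  ultimately show ?thesis by (rule AE_I'[OF _ ])
qed

lemma liminf_add_le:
  fixes f g :: "nat \<Rightarrow> ennreal"
  shows "liminf f + liminf g \<le> liminf (\<lambda>n. f n + g n)"
proof -
  have inc: "incseq (\<lambda>n. INF m\<in>{n..}. f m)" for f :: "nat \<Rightarrow> ennreal"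
    by (auto simp: incseq_def intro!: INF_superset_mono)
  have "liminf f + liminf g = (SUP n. (INF m\<in>{n..}. f m) + (INF m\<in>{n..}. g m))"
    unfolding liminf_SUP_INF by (rule ennreal_SUP_add[OF inc inc, symmetric])
  also have "\<dots> \<le> (SUP n. INF m\<in>{n..}. f m + g m)"
    by (intro SUP_mono' INF_greatest add_mono INF_lower) auto
  finally show ?thesis by (simp add: liminf_SUP_INF)
qed

lemma energy_on_measurable:
  assumes "A \<in> sets borel" "A \<subseteq> {0..}"
  shows "(\<lambda>\<omega>. \<integral>\<^sup>+t\<in>A. ennreal (norm (velocity \<omega> t) powr \<theta>) \<partial>lebesgue) \<in> borel_measurable (curve_borel X)"
proof -
  note assms(1)[measurable]
  have [measurable]: "(\<lambda>p. pos_velocity (fst p) (snd p)) \<in> borel_measurable (curve_borel X \<Otimes>\<^sub>M borel)"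
    using velocity_joint_measurable[of X] by (simp add: pos_velocity_def[abs_def])
  have "(\<lambda>p. ennreal (norm (pos_velocity (fst p) (snd p)) powr \<theta>) * indicator A (snd p))
      \<in> borel_measurable (curve_borel X \<Otimes>\<^sub>M borel)" by measurable
  also have "borel_measurable (curve_borel X \<Otimes>\<^sub>M borel) = borel_measurable (curve_borel X \<Otimes>\<^sub>M lborel)"
    by (intro measurable_cong_sets sets_pair_measure_cong) auto
  finally have "(\<lambda>(\<omega>, t). ennreal (norm (pos_velocity \<omega> t) powr \<theta>) * indicator A t)
      \<in> borel_measurable (curve_borel X \<Otimes>\<^sub>M lborel)" by (simp add: split_beta')
  then have "(\<lambda>\<omega>. \<integral>\<^sup>+t\<in>A. ennreal (norm (pos_velocity \<omega> t) powr \<theta>) \<partial>lborel) \<in> borel_measurable (curve_borel X)"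
    by (rule lborel.borel_measurable_nn_integral)
  then show ?thesis
    using assms(2) by (subst nn_integral_pos_velocity[of A "\<lambda>t p. ennreal (norm p powr \<theta>)"])
      (simp_all add: nn_integral_completion)
qed

lemma exit_time_zero: "\<gamma> 0 \<in> \<Xi> \<Longrightarrow> exit_time \<Xi> \<gamma> = 0"
  using exit_time_le[of 0 \<gamma> \<Xi>] by simp

lemma exit_time_pos:
  assumes "\<gamma> \<in> curves X" "closed \<Xi>" "\<gamma> 0 \<notin> \<Xi>"
  shows "0 < exit_time \<Xi> \<gamma>"
proof -
  have "open (- \<Xi>)" using assms(2) by auto
  then obtain e where e: "e > 0" "ball (\<gamma> 0) e \<subseteq> - \<Xi>" using assms(3) open_contains_ball by blast
  have "\<exists>d>0. \<forall>t\<in>{0..}. dist t 0 < d \<longrightarrow> dist (\<gamma> t) (\<gamma> 0) < e"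
    using bspec[OF curvesD(1)[OF assms(1), unfolded continuous_on_iff], of 0] e(1) by simp
  then obtain d where d: "d > 0" "\<And>t. 0 \<le> t \<Longrightarrow> dist t 0 < d \<Longrightarrow> dist (\<gamma> t) (\<gamma> 0) < e" by auto
  have "ennreal (d / 2) \<le> exit_time \<Xi> \<gamma>"
  proof (rule exit_time_ge)
    fix t assume t: "0 \<le> t" "t \<le> d / 2"
    then have "dist (\<gamma> t) (\<gamma> 0) < e" using d by (intro d(2)) (auto simp: dist_real_def)
    then have "\<gamma> t \<in> ball (\<gamma> 0) e" by (simp add: dist_commute)
    then show "\<gamma> t \<notin> \<Xi>" using e(2) by blast
  qed
  moreover have "0 < ennreal (d / 2)" using d(1) by simp
  ultimately show ?thesis by (rule less_le_trans[rotated])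
qed

lemma powr_le_one_plus:
  fixes r :: real
  assumes "0 \<le> r" "0 < \<beta>" "\<beta> \<le> \<theta>"
  shows "r powr \<beta> \<le> 1 + r powr \<theta>"
proof (cases "r \<le> 1")
  case True
  then have "r powr \<beta> \<le> 1 powr \<beta>" using assms by (intro powr_mono2) auto
  then show ?thesis by (simp add: add_increasing2)
next
  case False
  then have "r powr \<beta> \<le> r powr \<theta>" using assms by (intro powr_mono) auto
  then show ?thesis by simp
qed

text \<open>The intervals are those on which a detour with \<open>L = 1 / (k + 1)\<close> differs
  from its model; the total energy dominates the integrands.\<close>

lemma energy_on_tendsto_0:
  assumes \<gamma>: "\<gamma> \<in> curves X" and fin: "energy \<theta> \<gamma> < \<infinity>"
  shows "(\<lambda>k. \<integral>\<^sup>+t\<in>{0..2 * inverse (real (Suc k))}. ennreal (norm (velocity \<gamma> t) powr \<theta>) \<partial>lebesgue) \<longlonglongrightarrow> 0"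
proof -
  note pos_velocity_measurable[OF \<gamma>, measurable]
  let ?f = "\<lambda>t. ennreal (norm (pos_velocity \<gamma> t) powr \<theta>)"
  have "(\<lambda>k. \<integral>\<^sup>+t. ?f t * indicator {0..2 * inverse (real (Suc k))} t \<partial>lebesgue) \<longlonglongrightarrow> (\<integral>\<^sup>+t. 0 \<partial>(lebesgue :: real measure))"
  proof (rule nn_integral_dominated_convergence[where w = "\<lambda>t. ?f t * indicator {0..} t"])
    show "(\<integral>\<^sup>+t. ?f t * indicator {0..} t \<partial>lebesgue) < \<infinity>"
      using fin by (simp add: energy_pos_velocity)
    show "AE t in lebesgue. (\<lambda>k. ?f t * indicator {0..2 * inverse (real (Suc k))} t) \<longlonglongrightarrow> 0"
      using AE_lebesgue_neq[of 0]
    proof eventually_elim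
      case (elim t)
      have "\<forall>\<^sub>F k in sequentially. ?f t * indicator {0..2 * inverse (real (Suc k))} t = 0"
      proof (cases "0 < t")
        case True
        have "(\<lambda>k. 2 * inverse (real (Suc k))) \<longlonglongrightarrow> 2 * 0"
          by (intro tendsto_intros LIMSEQ_inverse_real_of_nat)
        then have "\<forall>\<^sub>F k in sequentially. 2 * inverse (real (Suc k)) < t"
          using True by (intro order_tendstoD(2)) auto
        then show ?thesis by eventually_elim (auto simp: indicator_def)
      next
        case False
        then show ?thesis using elim by (auto simp: indicator_def)
      qed
      then show ?case by (rule tendsto_eventually)
    qed
    show "(\<lambda>t. ?f t * indicator {0..2 * inverse (real (Suc k))} t) \<in> borel_measurable lebesgue" for k
      by (intro borel_measurable_times_ennreal borel_measurable_indicator) auto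
    show "(\<lambda>t. ?f t * indicator {0..} t) \<in> borel_measurable lebesgue"
      by (intro borel_measurable_times_ennreal borel_measurable_indicator) auto
  qed (auto simp: indicator_def)
  then show ?thesis
    by (subst nn_integral_pos_velocity[where F = "\<lambda>t p. ennreal (norm p powr \<theta>)"]) auto
qed

subsection \<open>The mean field game\<close>

lemma AE_lebesgue_on_Icc:
  fixes P :: "real \<Rightarrow> bool"
  assumes "AE t in lebesgue_on {0..}. P t"
  shows "AE t in lebesgue_on {0..s}. P t"
proof -
  have "AE t in lebesgue. t \<in> {0..} \<longrightarrow> P t" using assms by (subst (asm) AE_restrict_space_iff) auto
  then show ?thesis by (subst AE_restrict_space_iff) (auto elim: eventually_mono)
qed

locale mean_field_game =
  fixes X \<Xi> :: "'a::euclidean_space set"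
    and l :: "real \<Rightarrow> 'a \<Rightarrow> 'a \<Rightarrow> real"
    and h :: "real \<Rightarrow> 'a \<Rightarrow> 'a \<Rightarrow> 'a \<Rightarrow> 'a \<Rightarrow> real"
    and \<Psi> :: "real \<Rightarrow> real"
    and \<alpha> \<theta> C \<beta> a b \<alpha>' :: real
    and Q :: "(real \<Rightarrow> 'a) measure"
  assumes X: "compact X" and \<Xi>: "closed \<Xi>"
    and l_nonneg: "\<And>t x p. t \<ge> 0 \<Longrightarrow> x \<in> X \<Longrightarrow> l t x p \<ge> 0"
    and l_measurable: "\<And>x p. x \<in> X \<Longrightarrow> (\<lambda>t. l t x p) \<in> borel_measurable (lebesgue_on {0..})"
    and l_continuous: "AE t in lebesgue_on {0..}. continuous_on (X \<times> UNIV) (\<lambda>(x, p). l t x p)"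
    and l_convex: "AE t in lebesgue_on {0..}. \<forall>x\<in>X. convex_on UNIV (\<lambda>p. l t x p)"
    and \<alpha>: "\<alpha> > 0" and \<theta>: "\<theta> > 1"
    and l_lower: "\<And>t x p. t \<ge> 0 \<Longrightarrow> x \<in> X \<Longrightarrow> l t x p \<ge> \<alpha> * norm p powr \<theta>"
    and h_nonneg: "\<And>t x y p q. t \<ge> 0 \<Longrightarrow> x \<in> X \<Longrightarrow> y \<in> X \<Longrightarrow> h t x y p q \<ge> 0"
    and h_measurable: "\<And>x y p q. x \<in> X \<Longrightarrow> y \<in> X \<Longrightarrow> (\<lambda>t. h t x y p q) \<in> borel_measurable (lebesgue_on {0..})"
    and h_continuous: "AE t in lebesgue_on {0..}.
          continuous_on (X \<times> X \<times> UNIV \<times> UNIV) (\<lambda>(x, y, p, q). h t x y p q)"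
    and h_convex: "AE t in lebesgue_on {0..}. \<forall>x\<in>X. \<forall>y\<in>X. convex_on UNIV (\<lambda>(p, q). h t x y p q)"
    and C: "C > 0" and \<beta>: "0 < \<beta>" "\<beta> \<le> \<theta>"
    and h_upper: "\<And>t x y p q. t \<ge> 0 \<Longrightarrow> x \<in> X \<Longrightarrow> y \<in> X \<Longrightarrow>
          h t x y p q \<le> C * (norm p powr \<beta> + norm q powr \<beta>)"
    and \<Psi>_nonneg: "\<And>t. t \<ge> 0 \<Longrightarrow> \<Psi> t \<ge> 0"
    and \<Psi>_lsc: "lower_semicontinuous_on {0..} \<Psi>"
    and \<Psi>_mono: "mono_on {0..} \<Psi>"
    and ab: "a > 0" "b > 0"
    and \<Psi>_lower: "\<And>t. t \<ge> 0 \<Longrightarrow> \<Psi> t \<ge> a * t - b"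
    and geodesic: "\<And>x xs. x \<in> X \<Longrightarrow> (\<And>n::nat. xs n \<in> X) \<Longrightarrow> xs \<longlonglongrightarrow> x \<Longrightarrow>
          (\<lambda>n. geodesic_dist X (xs n) x) \<longlonglongrightarrow> 0"
    and \<alpha>': "\<alpha>' > 0"
    and l_upper: "\<And>t x p. t \<ge> 0 \<Longrightarrow> x \<in> X \<Longrightarrow> l t x p \<le> \<alpha>' * norm p powr \<theta>"
    and Q: "Q \<in> space (prob_algebra (curve_borel X))"
begin

section \<open>The cost for a fixed distribution of curves\<close>

lemma prob_Q: "prob_space Q" and sets_Q: "sets Q = sets (curve_borel X)" and space_Q: "space Q = curves X"
proof -
  show "prob_space Q" and *: "sets Q = sets (curve_borel X)"
    using Q by (auto simp: space_prob_algebra)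
  show "space Q = curves X" using sets_eq_imp_space_eq[OF *] by (simp add: space_curve_borel)
qed

lemma measurable_Q: "f \<in> borel_measurable (curve_borel X) \<Longrightarrow> f \<in> borel_measurable Q"
  using measurable_cong_sets[OF sets_Q refl] by blast

abbreviation "F \<gamma> \<equiv> mfg_cost \<Xi> l h \<Psi> \<gamma> Q"

definition mean_interaction :: "(real \<Rightarrow> 'a) \<Rightarrow> ennreal" where
  "mean_interaction \<gamma> = (\<integral>\<^sup>+\<omega>. interaction \<Xi> h \<gamma> \<omega> \<partial>Q)"

abbreviation terminal_cost :: "(real \<Rightarrow> 'a) \<Rightarrow> ennreal" where
  "terminal_cost \<gamma> \<equiv> exit_cost \<Psi> (exit_time \<Xi> \<gamma>)"

lemma interaction_measurable_Q: "\<gamma> \<in> curves X \<Longrightarrow> interaction \<Xi> h \<gamma> \<in> borel_measurable Q"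
  by (rule measurable_Q[OF interaction_measurable[OF h_measurable h_continuous _ \<Xi>]])

text \<open>The interaction of a curve in \<open>X\<close> is measurable, and an infinite mean
  interaction makes the sum infinite anyway; so absolute continuity is all that remains of the case
  distinction in \<open>mfg_cost\<close>.\<close>

lemma mfg_cost_eq:
  assumes "\<gamma> \<in> curves X" "abs_continuous_curve \<gamma>" "AE \<omega> in Q. abs_continuous_curve \<omega>"
  shows "F \<gamma> = running_cost l \<gamma> + terminal_cost \<gamma> + mean_interaction \<gamma>"
  using assms interaction_measurable_Q[OF assms(1)]
  by (auto simp: mfg_cost_def mean_interaction_def top_unique not_less)

lemma mfg_cost_finiteD: "F \<gamma> < \<infinity> \<Longrightarrow> abs_continuous_curve \<gamma>"
  by (auto simp: mfg_cost_def split: if_splits)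

lemma energy_le_running_cost:
  assumes "\<gamma> \<in> curves X"
  shows "ennreal \<alpha> * energy \<theta> \<gamma> \<le> running_cost l \<gamma>"
proof -
  note pos_velocity_measurable[OF assms, measurable]
  have "ennreal \<alpha> * energy \<theta> \<gamma> =
      (\<integral>\<^sup>+t. ennreal \<alpha> * (ennreal (norm (pos_velocity \<gamma> t) powr \<theta>) * indicator {0..} t) \<partial>lebesgue)"
    unfolding energy_pos_velocity
    by (intro nn_integral_cmult[symmetric] borel_measurable_times_ennreal borel_measurable_indicator) auto
  also have "\<dots> \<le> (\<integral>\<^sup>+t\<in>{0..}. ennreal (l t (\<gamma> t) (pos_velocity \<gamma> t)) \<partial>lebesgue)"
    using l_lower[OF _ curvesD(2)[OF assms]] \<alpha>
    by (intro nn_integral_mono) (auto simp: indicator_def ennreal_mult[symmetric] intro!: ennreal_leI)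
  also have "\<dots> = running_cost l \<gamma>"
    unfolding running_cost_def
    using nn_integral_pos_velocity[of "{0..}" "\<lambda>t p. ennreal (l t (\<gamma> t) p)" \<gamma>] by simp
  finally show ?thesis .
qed

lemma running_cost_le_mfg_cost: "running_cost l \<gamma> + terminal_cost \<gamma> \<le> F \<gamma>"
  by (auto simp: mfg_cost_def add_increasing2)

lemma energy_le_mfg_cost:
  assumes "\<gamma> \<in> curves X"
  shows "ennreal \<alpha> * energy \<theta> \<gamma> + terminal_cost \<gamma> \<le> F \<gamma>"
  using add_right_mono[OF energy_le_running_cost[OF assms]] running_cost_le_mfg_cost by (rule order_trans)

lemma energy_bound:
  assumes "\<gamma> \<in> curves X" "F \<gamma> \<le> ennreal B" "0 \<le> B"
  shows "energy \<theta> \<gamma> \<le> ennreal (B / \<alpha>)"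
proof -
  have "ennreal \<alpha> * energy \<theta> \<gamma> \<le> ennreal B"
    using energy_le_mfg_cost[OF assms(1)] assms(2) by (meson add_increasing2 order_trans zero_le order_refl le_add_same_cancel1)
  then have "ennreal (1 / \<alpha>) * (ennreal \<alpha> * energy \<theta> \<gamma>) \<le> ennreal (1 / \<alpha>) * ennreal B" by (rule mult_left_mono) simp
  then show ?thesis using \<alpha> assms(3)
    by (simp add: mult.assoc[symmetric] ennreal_mult[symmetric])
qed

section \<open>Lower semicontinuity of the cost\<close>

lemma exit_cost_mono: "s \<le> s' \<Longrightarrow> exit_cost \<Psi> s \<le> exit_cost \<Psi> s'"
proof (cases "s' = \<infinity>")
  case False
  assume "s \<le> s'"
  moreover from this False obtain r r' where "s = ennreal r" "s' = ennreal r'" "0 \<le> r" "0 \<le> r'"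
    by (cases s; cases s') (auto simp: top_unique)
  ultimately show ?thesis using mono_onD[OF \<Psi>_mono, of r r'] by (auto simp: exit_cost_def intro!: ennreal_leI)
qed (simp add: exit_cost_def)

lemma exit_cost_ennreal: "0 \<le> s \<Longrightarrow> exit_cost \<Psi> (ennreal s) = ennreal (\<Psi> s)"
  by (simp add: exit_cost_def)

text \<open>A nondecreasing lower semicontinuous function is left-continuous at positive times, so a
  level below \<open>exit_cost \<Psi> \<tau>\<close> is exceeded already at some \<open>s\<close>
  strictly before \<open>\<tau>\<close>, which the exit times eventually reach. If
  \<open>\<tau> = \<infinity>\<close>, the linear growth of \<open>\<Psi>\<close> provides
  \<open>s\<close>; if \<open>\<tau> = 0\<close>, monotonicity suffices.\<close>

lemma exit_cost_lsc:
  assumes ev: "\<And>s. 0 \<le> s \<Longrightarrow> ennreal s < \<tau> \<Longrightarrow> \<forall>\<^sub>F n in sequentially. ennreal s \<le> \<tau>s n"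
  shows "exit_cost \<Psi> \<tau> \<le> liminf (\<lambda>n. exit_cost \<Psi> (\<tau>s n))"
  unfolding le_Liminf_iff
proof (intro allI impI)
  fix y assume y: "y < exit_cost \<Psi> \<tau>"
  show "\<forall>\<^sub>F n in sequentially. y < exit_cost \<Psi> (\<tau>s n)"
  proof (cases "\<tau> = 0")
    case True
    then have "exit_cost \<Psi> \<tau> \<le> exit_cost \<Psi> (\<tau>s n)" for n by (intro exit_cost_mono) simp
    then show ?thesis by (intro always_eventually allI) (rule less_le_trans[OF y])
  next
    case \<tau>0: False
    obtain y' where y': "y = ennreal y'" "0 \<le> y'" using y by (cases y) auto
    have "\<exists>s\<ge>0. ennreal s < \<tau> \<and> y' < \<Psi> s"
    proof (cases \<tau>)
      case top
      let ?s = "(y' + b + 1) / a"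
      have s: "0 \<le> ?s" using ab y' by simp
      have "a * ?s - b = y' + 1" using ab by simp
      then have "y' < \<Psi> ?s" using \<Psi>_lower[OF s] by linarith
      then show ?thesis using s by (intro exI[of _ ?s]) (simp add: top)
    next
      case (real r)
      then have r: "0 < r" using \<tau>0 by auto
      have "y' < \<Psi> r" using y y' real by (simp add: exit_cost_ennreal ennreal_less_iff)
      then have "\<forall>\<^sub>F z in at r within {0..}. y' < \<Psi> z"
        using \<Psi>_lsc r unfolding lower_semicontinuous_on_def by auto
      then obtain d where d: "d > 0" "\<And>z. z \<in> {0..} \<Longrightarrow> z \<noteq> r \<Longrightarrow> dist z r < d \<Longrightarrow> y' < \<Psi> z"
        unfolding eventually_at by blast
      let ?s = "max 0 (r - d / 2)"
      have s: "0 \<le> ?s" "?s < r" "dist ?s r < d" using d(1) r by (auto simp: dist_real_def max_def)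
      then have "y' < \<Psi> ?s" by (intro d(2)) auto
      moreover have "ennreal ?s < \<tau>" unfolding real(2) by (rule ennreal_lessI[OF r s(2)])
      ultimately show ?thesis using s(1) by blast
    qed
    then obtain s where s: "0 \<le> s" "ennreal s < \<tau>" "y' < \<Psi> s" by blast
    have "y < ennreal (\<Psi> s)" using s(3) y' by (simp add: ennreal_less_iff)
    from ev[OF s(1,2)] show ?thesis
    proof eventually_elim
      case (elim n)
      show ?case using \<open>y < ennreal (\<Psi> s)\<close> exit_cost_mono[OF elim] s(1) by (simp add: exit_cost_ennreal)
    qed
  qed
qed

text \<open>Freezing the second curve turns \<open>h\<close> into an integrand in the position and
  velocity of the first, as \<open>curve_integral_lsc\<close> demands; convexity in \<open>p\<close>
  is inherited from joint convexity. Measurability in time is that of an integrand along \<omega>,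
  the two curves having exchanged their roles.\<close>

lemma interaction_slice:
  assumes \<omega>: "\<omega> \<in> curves X"
  shows "\<And>x p. x \<in> X \<Longrightarrow> (\<lambda>t. h t x (\<omega> t) p (velocity \<omega> t)) \<in> borel_measurable (lebesgue_on {0..})"
    "AE t in lebesgue_on {0..}. continuous_on (X \<times> UNIV) (\<lambda>(x, p). h t x (\<omega> t) p (velocity \<omega> t))"
    "AE t in lebesgue_on {0..}. \<forall>x\<in>X. convex_on UNIV (\<lambda>p. h t x (\<omega> t) p (velocity \<omega> t))"
proof -
  have slice_cont: "continuous_on (X \<times> UNIV) (\<lambda>(x, p). h t x (\<omega> t) p q)"
    if "continuous_on (X \<times> X \<times> UNIV \<times> UNIV) (\<lambda>(x, y, p, q). h t x y p q)" "0 \<le> t" for t q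
  proof -
    have "continuous_on (X \<times> UNIV) (\<lambda>z. (\<lambda>(x, y, p, q). h t x y p q) (fst z, \<omega> t, snd z, q))"
      using curvesD(2)[OF \<omega> that(2)]
      by (intro continuous_on_compose2[OF that(1)]) (auto intro!: continuous_intros)
    then show ?thesis by (simp add: split_beta')
  qed
  have slice_cont': "continuous_on (X \<times> UNIV) (\<lambda>(y, q). h t x y p q)"
    if "continuous_on (X \<times> X \<times> UNIV \<times> UNIV) (\<lambda>(x, y, p, q). h t x y p q)" "x \<in> X" for t x p
  proof -
    have "continuous_on (X \<times> UNIV) (\<lambda>z. (\<lambda>(x, y, p, q). h t x y p q) (x, fst z, p, snd z))"
      using that(2) by (intro continuous_on_compose2[OF that(1)]) (auto intro!: continuous_intros)
    then show ?thesis by (simp add: split_beta')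
  qed
  have slice_conv: "convex_on UNIV (\<lambda>p. h t x y p q)" if "convex_on UNIV (\<lambda>(p, q). h t x y p q)" for t x y q
  proof (rule convex_onI)
    fix r :: real and p p' :: 'a assume r: "0 < r" "r < 1"
    show "h t x y ((1 - r) *\<^sub>R p + r *\<^sub>R p') q \<le> (1 - r) * h t x y p q + r * h t x y p' q"
      using convex_onD[OF that, of r "(p, q)" "(p', q)"] r by (simp add: scaleR_left_diff_distrib)
  qed simp
  show "(\<lambda>t. h t x (\<omega> t) p (velocity \<omega> t)) \<in> borel_measurable (lebesgue_on {0..})" if x: "x \<in> X" for x p
  proof -
    have m: "(\<lambda>t. if 0 < t then h t x (\<omega> t) p (velocity \<omega> t) else 0) \<in> borel_measurable lebesgue"
    proof (rule curve_integrand_measurable[OF _ _ \<omega>])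
      show "AE t in lebesgue_on {0..}. continuous_on (X \<times> UNIV) (\<lambda>(y, q). h t x y p q)"
        using h_continuous by eventually_elim (rule slice_cont'[OF _ x])
    qed (use h_measurable x in auto)
    have "(\<lambda>t. if t \<in> {0..} then h t x (\<omega> t) p (velocity \<omega> t) else 0) \<in> borel_measurable lebesgue"
    proof (rule borel_measurable_AE[OF m])
      show "AE t in lebesgue. (if 0 < t then h t x (\<omega> t) p (velocity \<omega> t) else 0) =
          (if t \<in> {0..} then h t x (\<omega> t) p (velocity \<omega> t) else 0)"
        using AE_lebesgue_neq[of 0] by eventually_elim auto
    qed
    then have "(\<lambda>t. if t \<in> {0..} then h t x (\<omega> t) p (velocity \<omega> t) else 0) \<in> borel_measurable (lebesgue_on {0..})"
      by (rule measurable_restrict_space1)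
    then show ?thesis by (rule measurable_cong[THEN iffD1, rotated]) auto
  qed
  have AE_nonneg: "AE t in lebesgue_on {0..}. (0::real) \<le> t" by (rule AE_I2) auto
  show "AE t in lebesgue_on {0..}. continuous_on (X \<times> UNIV) (\<lambda>(x, p). h t x (\<omega> t) p (velocity \<omega> t))"
    using h_continuous AE_nonneg by eventually_elim (rule slice_cont)
  show "AE t in lebesgue_on {0..}. \<forall>x\<in>X. convex_on UNIV (\<lambda>p. h t x (\<omega> t) p (velocity \<omega> t))"
    using h_convex AE_nonneg by eventually_elim (auto intro!: slice_conv simp: curvesD(2)[OF \<omega>])
qed

lemma interaction_integrand_measurable:
  assumes \<gamma>: "\<gamma> \<in> curves X" and \<omega>: "\<omega> \<in> curves X"
  shows "(\<lambda>t. ennreal (h t (\<gamma> t) (\<omega> t) (velocity \<gamma> t) (velocity \<omega> t)) * indicator {0<..} t)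
    \<in> borel_measurable lebesgue"
proof -
  have "(\<lambda>t. ennreal (if 0 < t then h t (\<gamma> t) (\<omega> t) (velocity \<gamma> t) (velocity \<omega> t) else 0)) \<in> borel_measurable lebesgue"
    using curve_integrand_measurable[OF interaction_slice(1,2)[OF \<omega>] \<gamma>] by measurable
  also have "(\<lambda>t. ennreal (if 0 < t then h t (\<gamma> t) (\<omega> t) (velocity \<gamma> t) (velocity \<omega> t) else 0)) =
      (\<lambda>t. ennreal (h t (\<gamma> t) (\<omega> t) (velocity \<gamma> t) (velocity \<omega> t)) * indicator {0<..} t)"
    by (auto simp: indicator_def)
  finally show ?thesis .
qed

context
  fixes \<gamma> :: "real \<Rightarrow> 'a" and \<gamma>s :: "nat \<Rightarrow> real \<Rightarrow> 'a" and E :: real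
  assumes \<gamma>: "\<gamma> \<in> curves X" and \<gamma>s: "\<And>n. \<gamma>s n \<in> curves X" "\<And>n. abs_continuous_curve (\<gamma>s n)"
    and energy: "\<And>n. energy \<theta> (\<gamma>s n) \<le> ennreal E" and E: "0 \<le> E" and lim: "locally_uniform_limit \<gamma>s \<gamma>"
begin

lemma running_cost_lsc: "running_cost l \<gamma> \<le> liminf (\<lambda>n. running_cost l (\<gamma>s n))"
proof -
  have "(\<integral>\<^sup>+t\<in>{t. 0 \<le> t \<and> ennreal t \<le> \<infinity>}. ennreal (l t (\<gamma> t) (velocity \<gamma> t)) \<partial>lebesgue) \<le>
      liminf (\<lambda>n. running_cost l (\<gamma>s n))"
  proof (rule nn_integral_horizon_le)
    have "(\<lambda>t. ennreal (if 0 < t then l t (\<gamma> t) (velocity \<gamma> t) else 0)) \<in> borel_measurable lebesgue"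
      using curve_integrand_measurable[OF l_measurable l_continuous \<gamma>] by measurable
    also have "(\<lambda>t. ennreal (if 0 < t then l t (\<gamma> t) (velocity \<gamma> t) else 0)) =
        (\<lambda>t. ennreal (l t (\<gamma> t) (velocity \<gamma> t)) * indicator {0<..} t)" by (auto simp: indicator_def)
    finally show "(\<lambda>t. ennreal (l t (\<gamma> t) (velocity \<gamma> t)) * indicator {0<..} t) \<in> borel_measurable lebesgue" .
    fix s :: real assume s: "0 \<le> s"
    have "(\<integral>\<^sup>+t\<in>{0..s}. ennreal (l t (\<gamma> t) (velocity \<gamma> t)) \<partial>lebesgue) \<le>
        liminf (\<lambda>n. \<integral>\<^sup>+t\<in>{0..s}. ennreal (l t (\<gamma>s n t) (velocity (\<gamma>s n) t)) \<partial>lebesgue)"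
    proof (rule curve_integral_lsc[OF X _ AE_lebesgue_on_Icc[OF l_continuous] AE_lebesgue_on_Icc[OF l_convex]
          l_nonneg \<gamma>s energy E \<theta> \<gamma> lim s])
      show "(\<lambda>t. l t x p) \<in> borel_measurable (lebesgue_on {0..s})" if "x \<in> X" for x p
        using l_measurable[OF that] by (rule measurable_restrict_mono) auto
    qed
    also have "\<dots> \<le> liminf (\<lambda>n. running_cost l (\<gamma>s n))"
      unfolding running_cost_def
      by (intro Liminf_mono always_eventually allI nn_integral_mono) (auto simp: indicator_def)
    finally show "(\<integral>\<^sup>+t\<in>{0..s}. ennreal (l t (\<gamma> t) (velocity \<gamma> t)) \<partial>lebesgue) \<le>
        liminf (\<lambda>n. running_cost l (\<gamma>s n))" .
  qed
  then show ?thesis by (simp add: running_cost_def atLeast_def)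
qed

lemma exit_time_lsc:
  assumes "0 \<le> s" "ennreal s < exit_time \<Xi> \<gamma>"
  shows "\<forall>\<^sub>F n in sequentially. ennreal s \<le> exit_time \<Xi> (\<gamma>s n)"
proof -
  obtain \<epsilon> where \<epsilon>: "\<epsilon> > 0"
    "\<And>\<omega>. (\<And>t. 0 \<le> t \<Longrightarrow> t \<le> s \<Longrightarrow> dist (\<omega> t) (\<gamma> t) < \<epsilon>) \<Longrightarrow> ennreal s \<le> exit_time \<Xi> \<omega>"
    using exit_time_tube[OF \<gamma> \<Xi> assms] by metis
  have "\<forall>\<^sub>F n in sequentially. \<forall>t\<in>{0..s}. dist (\<gamma>s n t) (\<gamma> t) < \<epsilon>"
    using lim \<epsilon>(1) by (auto simp: locally_uniform_limit_def)
  then show ?thesis by eventually_elim (rule \<epsilon>(2), auto)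
qed

text \<open>For \<open>s\<close> strictly before both exit times the curves
  \<open>\<gamma>s n\<close> eventually exit no earlier than \<open>s\<close>, so their interactions
  with \<omega> include the integral over \<open>{0..s}\<close>.\<close>

lemma interaction_lsc:
  assumes \<omega>: "\<omega> \<in> curves X"
  shows "interaction \<Xi> h \<gamma> \<omega> \<le> liminf (\<lambda>n. interaction \<Xi> h (\<gamma>s n) \<omega>)"
proof -
  note slice = interaction_slice[OF \<omega>]
  have L_meas: "(\<lambda>t. h t x (\<omega> t) p (velocity \<omega> t)) \<in> borel_measurable (lebesgue_on {0..s})" if "x \<in> X" for x p s
    using slice(1)[OF that] by (rule measurable_restrict_mono) auto
  show ?thesis
    unfolding interaction_def[of \<Xi> h \<gamma>]
  proof (rule order_trans[OF nn_integral_horizon_le])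
    show "(\<lambda>t. ennreal (h t (\<gamma> t) (\<omega> t) (velocity \<gamma> t) (velocity \<omega> t)) * indicator {0<..} t)
        \<in> borel_measurable lebesgue"
      by (rule interaction_integrand_measurable[OF \<gamma> \<omega>])
    fix s :: real assume s: "0 \<le> s" "ennreal s < min (exit_time \<Xi> \<gamma>) (exit_time \<Xi> \<omega>)"
    have "(\<integral>\<^sup>+t\<in>{0..s}. ennreal (h t (\<gamma> t) (\<omega> t) (velocity \<gamma> t) (velocity \<omega> t)) \<partial>lebesgue) \<le>
        liminf (\<lambda>n. \<integral>\<^sup>+t\<in>{0..s}. ennreal (h t (\<gamma>s n t) (\<omega> t) (velocity (\<gamma>s n) t) (velocity \<omega> t)) \<partial>lebesgue)"
      by (rule curve_integral_lsc[OF X L_meas AE_lebesgue_on_Icc[OF slice(2)] AE_lebesgue_on_Icc[OF slice(3)]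
          h_nonneg[OF _ _ curvesD(2)[OF \<omega>]] \<gamma>s energy E \<theta> \<gamma> lim s(1)])
    also have "\<dots> \<le> liminf (\<lambda>n. interaction \<Xi> h (\<gamma>s n) \<omega>)"
    proof (rule Liminf_mono)
      have "ennreal s < exit_time \<Xi> \<gamma>" using s(2) by simp
      from exit_time_lsc[OF s(1) this]
      show "\<forall>\<^sub>F n in sequentially.
          (\<integral>\<^sup>+t\<in>{0..s}. ennreal (h t (\<gamma>s n t) (\<omega> t) (velocity (\<gamma>s n) t) (velocity \<omega> t)) \<partial>lebesgue) \<le>
          interaction \<Xi> h (\<gamma>s n) \<omega>"
      proof eventually_elim
        case (elim n)
        have "ennreal t \<le> min (exit_time \<Xi> (\<gamma>s n)) (exit_time \<Xi> \<omega>)" if "t \<le> s" for t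
          using order_trans[OF ennreal_leI[OF that] elim] order_trans[OF ennreal_leI[OF that], of "exit_time \<Xi> \<omega>"] s(2)
          by auto
        then show ?case unfolding interaction_def by (intro nn_integral_mono) (auto simp: indicator_def)
      qed
    qed
    finally show "(\<integral>\<^sup>+t\<in>{0..s}. ennreal (h t (\<gamma> t) (\<omega> t) (velocity \<gamma> t) (velocity \<omega> t)) \<partial>lebesgue) \<le>
        liminf (\<lambda>n. interaction \<Xi> h (\<gamma>s n) \<omega>)" .
  qed simp
qed

lemma mean_interaction_lsc: "mean_interaction \<gamma> \<le> liminf (\<lambda>n. mean_interaction (\<gamma>s n))"
proof -
  have "mean_interaction \<gamma> \<le> (\<integral>\<^sup>+\<omega>. liminf (\<lambda>n. interaction \<Xi> h (\<gamma>s n) \<omega>) \<partial>Q)"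
    unfolding mean_interaction_def by (intro nn_integral_mono interaction_lsc) (simp add: space_Q)
  also have "\<dots> \<le> liminf (\<lambda>n. mean_interaction (\<gamma>s n))"
    unfolding mean_interaction_def by (intro nn_integral_liminf interaction_measurable_Q \<gamma>s)
  finally show ?thesis .
qed

lemma mfg_cost_lsc:
  assumes "AE \<omega> in Q. abs_continuous_curve \<omega>"
  shows "F \<gamma> \<le> liminf (\<lambda>n. F (\<gamma>s n))"
proof -
  have ac: "abs_continuous_curve \<gamma>"
    by (rule abs_continuous_curve_limit[OF \<gamma>s energy E \<theta> locally_uniform_limit_pointwise[OF lim]])
  have "F \<gamma> \<le> liminf (\<lambda>n. running_cost l (\<gamma>s n)) + liminf (\<lambda>n. terminal_cost (\<gamma>s n)) +
      liminf (\<lambda>n. mean_interaction (\<gamma>s n))"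
    unfolding mfg_cost_eq[OF \<gamma> ac assms]
    by (intro add_mono running_cost_lsc mean_interaction_lsc exit_cost_lsc exit_time_lsc)
  also have "\<dots> \<le> liminf (\<lambda>n. running_cost l (\<gamma>s n) + terminal_cost (\<gamma>s n)) + liminf (\<lambda>n. mean_interaction (\<gamma>s n))"
    by (intro add_right_mono liminf_add_le)
  also have "\<dots> \<le> liminf (\<lambda>n. running_cost l (\<gamma>s n) + terminal_cost (\<gamma>s n) + mean_interaction (\<gamma>s n))"
    by (rule liminf_add_le)
  finally show ?thesis unfolding mfg_cost_eq[OF \<gamma>s assms] .
qed

end

end

lemma ennreal_add_right_cancel_le: "x + ennreal r \<le> y + ennreal r \<Longrightarrow> x \<le> y"
  using ennreal_add_left_cancel_le[of "ennreal r" x y] by (simp add: add.commute)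

context mean_field_game
begin

section \<open>The additional cost of a detour\<close>

lemma h_le_energy:
  assumes "t \<ge> 0" "x \<in> X" "y \<in> X"
  shows "h t x y p q \<le> C * (2 + norm p powr \<theta> + norm q powr \<theta>)"
proof -
  have "C * (norm p powr \<beta> + norm q powr \<beta>) \<le> C * ((1 + norm p powr \<theta>) + (1 + norm q powr \<theta>))"
    using C powr_le_one_plus[of "norm p" \<beta> \<theta>] powr_le_one_plus[of "norm q" \<beta> \<theta>] \<beta>
    by (intro mult_left_mono add_mono) auto
  then show ?thesis using h_upper[OF assms, of p q] by (simp add: algebra_simps)
qed

definition energy_upto :: "real \<Rightarrow> (real \<Rightarrow> 'a) \<Rightarrow> ennreal" where
  "energy_upto s \<gamma> = (\<integral>\<^sup>+t\<in>{0..s}. ennreal (norm (velocity \<gamma> t) powr \<theta>) \<partial>lebesgue)"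

definition detour_bound :: "real \<Rightarrow> (real \<Rightarrow> 'a) \<Rightarrow> ennreal" where
  "detour_bound L \<omega> = ennreal L + ennreal (2 powr \<theta>) * energy_upto (2 * L) \<omega>"

text \<open>The running cost up to \<open>2 * L\<close> is bounded by the upper growth of
  \<open>l\<close>, the interaction by \<open>h_le_energy\<close>: \<open>4 * L\<close> is the
  integral of the constant \<open>2\<close>, \<open>detour_bound\<close> accounts for the energy of
  the detour, and the last integral is the mean energy of the other curves over the same
  interval.\<close>

definition detour_error :: "real \<Rightarrow> (real \<Rightarrow> 'a) \<Rightarrow> ennreal" where
  "detour_error L \<omega> = ennreal \<alpha>' * detour_bound L \<omega> +
    ennreal C * (ennreal (4 * L) + detour_bound L \<omega> + (\<integral>\<^sup>+\<gamma>. energy_upto (2 * L) \<gamma> \<partial>Q))"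

lemma energy_upto_measurable: "energy_upto s \<in> borel_measurable Q"
  using energy_on_measurable[of "{0..s}" \<theta> X] unfolding energy_upto_def[abs_def] by (intro measurable_Q) auto

lemma energy_upto_le: "energy_upto s \<gamma> \<le> energy \<theta> \<gamma>"
  unfolding energy_upto_def energy_def by (intro nn_integral_mono) (auto simp: indicator_def)

lemma energy_upto_pos_velocity:
  "energy_upto s \<gamma> = (\<integral>\<^sup>+t\<in>{0..s}. ennreal (norm (pos_velocity \<gamma> t) powr \<theta>) \<partial>lebesgue)"
  unfolding energy_upto_def by (rule nn_integral_pos_velocity[where F = "\<lambda>t p. ennreal (norm p powr \<theta>)"]) auto

text \<open>Over a shrinking initial interval the energy of \<omega> vanishes, and so does that of
  almost every other curve; the finite mean energy dominates the integral over
  \<open>Q\<close>.\<close>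

lemma detour_error_tendsto_0:
  assumes \<omega>: "\<omega> \<in> curves X" "energy \<theta> \<omega> < \<infinity>" and EQ: "(\<integral>\<^sup>+\<gamma>. energy \<theta> \<gamma> \<partial>Q) < \<infinity>"
  shows "(\<lambda>k. detour_error (inverse (real (Suc k))) \<omega>) \<longlonglongrightarrow> 0"
proof -
  let ?L = "\<lambda>k. inverse (real (Suc k))"
  have L: "(\<lambda>k. ennreal (c * ?L k)) \<longlonglongrightarrow> ennreal (c * 0)" for c
    by (intro tendsto_ennrealI tendsto_intros LIMSEQ_inverse_real_of_nat)
  have e: "(\<lambda>k. energy_upto (2 * ?L k) \<gamma>) \<longlonglongrightarrow> 0" if "\<gamma> \<in> curves X" "energy \<theta> \<gamma> < \<infinity>" for \<gamma>
    unfolding energy_upto_def using that by (rule energy_on_tendsto_0)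
  have bound: "(\<lambda>k. detour_bound (?L k) \<omega>) \<longlonglongrightarrow> 0"
  proof -
    have "(\<lambda>k. ennreal (1 * ?L k) + ennreal (2 powr \<theta>) * energy_upto (2 * ?L k) \<omega>) \<longlonglongrightarrow>
        ennreal (1 * 0) + ennreal (2 powr \<theta>) * 0"
      by (intro tendsto_add L ennreal_tendsto_cmult e \<omega>) simp
    then show ?thesis by (simp add: detour_bound_def)
  qed
  have en_meas: "energy \<theta> \<in> borel_measurable Q"
    using energy_on_measurable[of "{0..}" \<theta> X] unfolding energy_def[abs_def] by (intro measurable_Q) auto
  have "(\<lambda>k. \<integral>\<^sup>+\<gamma>. energy_upto (2 * ?L k) \<gamma> \<partial>Q) \<longlonglongrightarrow> (\<integral>\<^sup>+\<gamma>. 0 \<partial>Q)"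
  proof (rule nn_integral_dominated_convergence[OF energy_upto_measurable _ en_meas _ EQ])
    have "AE \<gamma> in Q. energy \<theta> \<gamma> \<noteq> \<infinity>"
      using EQ by (intro nn_integral_PInf_AE en_meas) auto
    with AE_space show "AE \<gamma> in Q. (\<lambda>k. energy_upto (2 * ?L k) \<gamma>) \<longlonglongrightarrow> 0"
      by eventually_elim (intro e, auto simp: space_Q less_top)
  qed (auto simp: energy_upto_le)
  then have "(\<lambda>k. ennreal \<alpha>' * detour_bound (?L k) \<omega> + ennreal C * (ennreal (4 * ?L k) + detour_bound (?L k) \<omega> +
      (\<integral>\<^sup>+\<gamma>. energy_upto (2 * ?L k) \<gamma> \<partial>Q))) \<longlonglongrightarrow> ennreal \<alpha>' * 0 + ennreal C * (ennreal (4 * 0) + 0 + (\<integral>\<^sup>+\<gamma>. 0 \<partial>Q))"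
    by (intro tendsto_add ennreal_tendsto_cmult bound L) auto
  then show ?thesis by (simp add: detour_error_def)
qed

text \<open>Up to \<open>2 * L\<close> the costs are estimated by the growth bounds; afterwards the
  curves agree, and so do their velocities almost everywhere. \<open>horizon\<close> is a hypothesis
  because it holds for different reasons: either the detour exits no later than \<omega>, or it has
  exited before \<open>2 * L\<close>. Terminal costs are compared separately.\<close>

lemma detour_cost_le:
  assumes det: "detour_curve X \<sigma> \<omega> L \<theta>"
    and horizon: "\<And>t. 2 * L < t \<Longrightarrow> ennreal t \<le> exit_time \<Xi> (detour \<sigma> L \<omega>) \<Longrightarrow> ennreal t \<le> exit_time \<Xi> \<omega>"
  shows "running_cost l (detour \<sigma> L \<omega>) + mean_interaction (detour \<sigma> L \<omega>) \<le>
    running_cost l \<omega> + mean_interaction \<omega> + detour_error L \<omega>"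
proof -
  interpret detour_curve X \<sigma> \<omega> L \<theta> by (rule det)
  have \<nu>X: "\<nu> t \<in> X" and \<omega>X: "\<omega> t \<in> X" if "0 \<le> t" for t
    using curvesD(2)[OF detour_curves that] curvesD(2)[OF \<omega>(1) that] .
  have \<nu>_energy: "energy_upto (2 * L) \<nu> \<le> detour_bound L \<omega>"
    unfolding energy_upto_def detour_bound_def by (rule detour_energy_le)
  note \<nu>_meas = pos_velocity_measurable[OF detour_curves]
  have AE: "AE t in lebesgue. t \<noteq> 0 \<and> (2 * L < t \<longrightarrow> velocity \<nu> t = velocity \<omega> t)"
    using detour_velocity AE_lebesgue_neq[of 0] by eventually_elim auto
  let ?e = "\<lambda>\<gamma> t. ennreal (norm (pos_velocity \<gamma> t) powr \<theta>) * indicator {0..2 * L} t"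
  have e_meas: "?e \<gamma> \<in> borel_measurable lebesgue" if "\<gamma> \<in> curves X" for \<gamma>
    using pos_velocity_measurable[OF that]
    by (intro borel_measurable_times_ennreal borel_measurable_indicator) auto
  have run: "running_cost l \<nu> \<le> ennreal \<alpha>' * detour_bound L \<omega> + running_cost l \<omega>"
  proof -
    let ?g = "\<lambda>t. ennreal (if 0 < t then l t (\<omega> t) (velocity \<omega> t) else 0)"
    have g_meas: "?g \<in> borel_measurable lebesgue"
      using curve_integrand_measurable[OF l_measurable l_continuous \<omega>(1)] by measurable
    have "running_cost l \<nu> \<le> (\<integral>\<^sup>+t. ennreal \<alpha>' * ?e \<nu> t + ?g t \<partial>lebesgue)"
      unfolding running_cost_def
    proof (rule nn_integral_mono_AE)
      show "AE t in lebesgue. ennreal (l t (\<nu> t) (velocity \<nu> t)) * indicator {0..} t \<le> ennreal \<alpha>' * ?e \<nu> t + ?g t"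
        using AE
      proof eventually_elim
        case (elim t)
        consider "t < 0" | "0 < t" "t \<le> 2 * L" | "2 * L < t" using elim by linarith
        then show ?case
        proof cases
          case 2
          have "ennreal (l t (\<nu> t) (velocity \<nu> t)) \<le> ennreal \<alpha>' * ennreal (norm (velocity \<nu> t) powr \<theta>)"
            using l_upper[of t "\<nu> t" "velocity \<nu> t"] \<nu>X[of t] 2 \<alpha>' by (simp add: ennreal_mult[symmetric] ennreal_leI)
          then show ?thesis using 2 by (simp add: pos_velocity_def add_increasing2)
        next
          case 3
          then have "0 < t" using L by simp
          then show ?thesis using 3 elim by (simp add: detour_eq indicator_def)
        qed simp
      qed
    qed
    also have "\<dots> = ennreal \<alpha>' * energy_upto (2 * L) \<nu> + (\<integral>\<^sup>+t. ?g t \<partial>lebesgue)"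
      unfolding energy_upto_pos_velocity
      by (subst nn_integral_add[OF borel_measurable_times_ennreal[OF borel_measurable_const e_meas[OF detour_curves]] g_meas])
        (simp only: nn_integral_cmult[OF e_meas[OF detour_curves]])
    also have "\<dots> \<le> ennreal \<alpha>' * detour_bound L \<omega> + running_cost l \<omega>"
    proof (rule add_mono)
      show "ennreal \<alpha>' * energy_upto (2 * L) \<nu> \<le> ennreal \<alpha>' * detour_bound L \<omega>"
        using \<nu>_energy by (rule mult_left_mono) simp
      show "(\<integral>\<^sup>+t. ?g t \<partial>lebesgue) \<le> running_cost l \<omega>"
        unfolding running_cost_def by (intro nn_integral_mono) (auto simp: indicator_def)
    qed
    finally show ?thesis .
  qed
  have inter: "interaction \<Xi> h \<nu> \<gamma> \<le>
      ennreal C * (ennreal (4 * L) + detour_bound L \<omega> + energy_upto (2 * L) \<gamma>) + interaction \<Xi> h \<omega> \<gamma>"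
    if \<gamma>: "\<gamma> \<in> curves X" for \<gamma>
  proof -
    let ?c = "min (exit_time \<Xi> \<omega>) (exit_time \<Xi> \<gamma>)"
    let ?g = "\<lambda>t. ennreal (h t (\<omega> t) (\<gamma> t) (velocity \<omega> t) (velocity \<gamma> t)) * indicator {0<..} t *
      indicator {t. ennreal t \<le> ?c} t"
    let ?d = "\<lambda>t. ennreal C * (2 * indicator {0..2 * L} t + ?e \<nu> t + ?e \<gamma> t)"
    have g_meas: "?g \<in> borel_measurable lebesgue"
    proof (rule borel_measurable_times_ennreal[OF interaction_integrand_measurable[OF \<omega>(1) \<gamma>]])
      have "{t. ennreal t \<le> ?c} \<in> sets borel" by measurable
      then show "(\<lambda>t. indicator {t. ennreal t \<le> ?c} t) \<in> borel_measurable lebesgue"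
        by (intro borel_measurable_indicator) simp
    qed
    have "interaction \<Xi> h \<nu> \<gamma> \<le> (\<integral>\<^sup>+t. ?d t + ?g t \<partial>lebesgue)"
      unfolding interaction_def
    proof (rule nn_integral_mono_AE)
      show "AE t in lebesgue. ennreal (h t (\<nu> t) (\<gamma> t) (velocity \<nu> t) (velocity \<gamma> t)) *
          indicator {t. 0 \<le> t \<and> ennreal t \<le> min (exit_time \<Xi> \<nu>) (exit_time \<Xi> \<gamma>)} t \<le> ?d t + ?g t"
        using AE
      proof eventually_elim
        case (elim t)
        consider "t < 0" | "0 < t" "t \<le> 2 * L" | "2 * L < t" using elim by linarith
        then show ?case
        proof cases
          case 2
          have "ennreal (h t (\<nu> t) (\<gamma> t) (velocity \<nu> t) (velocity \<gamma> t)) \<le>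
              ennreal (C * (2 + norm (velocity \<nu> t) powr \<theta> + norm (velocity \<gamma> t) powr \<theta>))"
            using 2 by (intro ennreal_leI h_le_energy \<nu>X curvesD(2)[OF \<gamma>]) auto
          also have "\<dots> = ?d t"
            using 2 C by (simp add: pos_velocity_def ennreal_mult)
          finally have "ennreal (h t (\<nu> t) (\<gamma> t) (velocity \<nu> t) (velocity \<gamma> t)) \<le> ?d t" .
          then have "ennreal (h t (\<nu> t) (\<gamma> t) (velocity \<nu> t) (velocity \<gamma> t)) *
            indicator {t. 0 \<le> t \<and> ennreal t \<le> min (exit_time \<Xi> \<nu>) (exit_time \<Xi> \<gamma>)} t \<le> ?d t"
            by (auto simp: indicator_def)
          then show ?thesis by (rule add_increasing2[rotated]) simp
        next
          case 3
          then have "0 < t" using L by simp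
          have "ennreal (h t (\<nu> t) (\<gamma> t) (velocity \<nu> t) (velocity \<gamma> t)) *
            indicator {t. 0 \<le> t \<and> ennreal t \<le> min (exit_time \<Xi> \<nu>) (exit_time \<Xi> \<gamma>)} t \<le> ?g t"
            using 3 elim horizon[OF 3] \<open>0 < t\<close> by (auto simp: detour_eq indicator_def)
          then show ?thesis by (rule add_increasing[rotated]) simp
        qed simp
      qed
    qed
    also have "\<dots> = (\<integral>\<^sup>+t. ?d t \<partial>lebesgue) + (\<integral>\<^sup>+t. ?g t \<partial>lebesgue)"
      by (rule nn_integral_add[OF _ g_meas])
        (intro borel_measurable_times_ennreal borel_measurable_add borel_measurable_indicator
          e_meas[OF \<gamma>] e_meas[OF detour_curves] borel_measurable_const, simp)
    also have "(\<integral>\<^sup>+t. ?d t \<partial>lebesgue) = ennreal C * (\<integral>\<^sup>+t. 2 * indicator {0..2 * L} t + ?e \<nu> t + ?e \<gamma> t \<partial>lebesgue)"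
      by (rule nn_integral_cmult)
        (intro borel_measurable_times_ennreal borel_measurable_add borel_measurable_indicator
          e_meas[OF \<gamma>] e_meas[OF detour_curves] borel_measurable_const, simp)
    also have "(\<integral>\<^sup>+t. 2 * indicator {0..2 * L} t + ?e \<nu> t + ?e \<gamma> t \<partial>lebesgue) =
        ennreal (4 * L) + energy_upto (2 * L) \<nu> + energy_upto (2 * L) \<gamma>"
    proof -
      have m: "(\<lambda>t. 2 * indicator {0..2 * L} t :: ennreal) \<in> borel_measurable lebesgue"
        by (intro borel_measurable_times_ennreal borel_measurable_const borel_measurable_indicator) simp
      have "(\<integral>\<^sup>+t. 2 * indicator {0..2 * L} t \<partial>lebesgue) = ennreal 2 * ennreal (2 * L)"
        using L by (subst nn_integral_cmult_indicator) auto
      also have "\<dots> = ennreal (4 * L)" using L by (subst ennreal_mult[symmetric]) auto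
      finally have "(\<integral>\<^sup>+t. 2 * indicator {0..2 * L} t \<partial>lebesgue) = ennreal (4 * L)" .
      then show ?thesis
        unfolding energy_upto_pos_velocity
        by (simp only: nn_integral_add[OF borel_measurable_add[OF m e_meas[OF detour_curves]] e_meas[OF \<gamma>]]
            nn_integral_add[OF m e_meas[OF detour_curves]])
    qed
    also have "(\<integral>\<^sup>+t. ?g t \<partial>lebesgue) \<le> interaction \<Xi> h \<omega> \<gamma>"
      unfolding interaction_def by (intro nn_integral_mono) (auto simp: indicator_def)
    also have "ennreal C * (ennreal (4 * L) + energy_upto (2 * L) \<nu> + energy_upto (2 * L) \<gamma>) \<le>
        ennreal C * (ennreal (4 * L) + detour_bound L \<omega> + energy_upto (2 * L) \<gamma>)"
      using \<nu>_energy by (intro mult_left_mono add_mono) auto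
    finally show ?thesis by (simp add: add_left_mono add_right_mono)
  qed
  have mean: "mean_interaction \<nu> \<le> ennreal C * (ennreal (4 * L) + detour_bound L \<omega> +
      (\<integral>\<^sup>+\<gamma>. energy_upto (2 * L) \<gamma> \<partial>Q)) + mean_interaction \<omega>"
  proof -
    interpret prob_space Q by (rule prob_Q)
    note [measurable] = energy_upto_measurable interaction_measurable_Q[OF \<omega>(1)]
    have "mean_interaction \<nu> \<le> (\<integral>\<^sup>+\<gamma>. ennreal C * (ennreal (4 * L) + detour_bound L \<omega> + energy_upto (2 * L) \<gamma>) +
        interaction \<Xi> h \<omega> \<gamma> \<partial>Q)"
      unfolding mean_interaction_def by (intro nn_integral_mono inter) (simp add: space_Q)
    also have "\<dots> = ennreal C * (\<integral>\<^sup>+\<gamma>. (ennreal (4 * L) + detour_bound L \<omega>) + energy_upto (2 * L) \<gamma> \<partial>Q) +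
        mean_interaction \<omega>"
      unfolding mean_interaction_def by (subst nn_integral_add) (auto simp: nn_integral_cmult)
    also have "(\<integral>\<^sup>+\<gamma>. (ennreal (4 * L) + detour_bound L \<omega>) + energy_upto (2 * L) \<gamma> \<partial>Q) =
        ennreal (4 * L) + detour_bound L \<omega> + (\<integral>\<^sup>+\<gamma>. energy_upto (2 * L) \<gamma> \<partial>Q)"
      by (subst nn_integral_add) (auto simp: emeasure_space_1)
    finally show ?thesis .
  qed
  show ?thesis
    using add_mono[OF run mean] by (simp add: detour_error_def ac_simps)
qed

section \<open>Curves at rest\<close>

definition rest_curve :: "'a \<Rightarrow> real \<Rightarrow> 'a" where
  "rest_curve x t = (if t < 0 then undefined else x)"

lemma rest_curve:
  assumes x: "x \<in> X"
  shows "rest_curve x \<in> curves X" "abs_continuous_curve (rest_curve x)"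
    "0 < t \<Longrightarrow> velocity (rest_curve x) t = 0" "energy \<theta> (rest_curve x) = 0" "running_cost l (rest_curve x) = 0"
proof -
  have "continuous_on {0..} (rest_curve x)"
    by (rule continuous_on_eq[OF continuous_on_const[of _ x]]) (auto simp: rest_curve_def)
  then show curve: "rest_curve x \<in> curves X"
    using x by (auto simp: curves_def rest_curve_def PiE_def extensional_def)
  show "abs_continuous_curve (rest_curve x)"
    unfolding abs_continuous_curve_def abs_continuous_on_def
  proof (intro allI impI)
    fix a b \<epsilon> :: real assume *: "0 \<le> a \<and> a \<le> b" "\<epsilon> > 0"
    have "(\<Sum>K\<in>D. norm (rest_curve x (Sup K) - rest_curve x (Inf K))) < \<epsilon>"
      if D: "D division_of S" "S \<subseteq> {a..b}" for D S
    proof -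
      have "norm (rest_curve x (Sup K) - rest_curve x (Inf K)) = 0" if K: "K \<in> D" for K
      proof -
        have "Inf K \<in> K" by (subst division_interval(1)[OF D(1) K]) (use division_interval(2)[OF D(1) K] in simp)
        then have "0 \<le> Inf K" using division_ofD(2)[OF D(1) K] D(2) * by auto
        then show ?thesis using division_interval(2)[OF D(1) K] by (simp add: rest_curve_def)
      qed
      then show ?thesis using *(2) by simp
    qed
    then show "\<exists>\<delta>>0. \<forall>D S. D division_of S \<and> S \<subseteq> {a..b} \<and> (\<Sum>K\<in>D. Sup K - Inf K) < \<delta> \<longrightarrow>
        (\<Sum>K\<in>D. norm (rest_curve x (Sup K) - rest_curve x (Inf K))) < \<epsilon>"
      by (intro exI[of _ 1]) auto
  qed
  show vel: "velocity (rest_curve x) t = 0" if "0 < t" for t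
  proof (rule vector_derivative_at)
    show "(rest_curve x has_vector_derivative 0) (at t)"
      by (rule has_vector_derivative_transform_within_open[of "\<lambda>_. x" 0 t "{0<..}"])
        (use that in \<open>auto simp: rest_curve_def\<close>)
  qed
  have zero: "(\<integral>\<^sup>+t\<in>{0..}. f t \<partial>lebesgue) = 0" if "\<And>t. 0 < t \<Longrightarrow> f t = 0" for f :: "real \<Rightarrow> ennreal"
  proof -
    have "(\<integral>\<^sup>+t\<in>{0..}. f t \<partial>lebesgue) = (\<integral>\<^sup>+t. 0 \<partial>(lebesgue :: real measure))"
    proof (rule nn_integral_cong_AE)
      show "AE t in lebesgue. f t * indicator {0..} t = 0"
        using AE_lebesgue_neq[of 0] by eventually_elim (use that in \<open>auto simp: indicator_def\<close>)
    qed
    then show ?thesis by simp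
  qed
  show "energy \<theta> (rest_curve x) = 0" unfolding energy_def by (rule zero) (simp add: vel)
  show "running_cost l (rest_curve x) = 0"
    unfolding running_cost_def
  proof (rule zero)
    fix t :: real assume "0 < t"
    \<comment> \<open>At velocity \<open>0\<close> the upper growth bound leaves no positive value
      for \<open>l\<close>.\<close>
    then show "ennreal (l t (rest_curve x t) (velocity (rest_curve x) t)) = 0"
      using l_upper[of t x 0] x vel by (simp add: rest_curve_def ennreal_neg)
  qed
qed

text \<open>The exit time is \<open>0\<close>, so the interaction is an integral over the single
  time \<open>0\<close>.\<close>

lemma rest_curve_mean_interaction:
  assumes "x \<in> \<Xi>"
  shows "mean_interaction (rest_curve x) = 0"
proof -
  have zero: "exit_time \<Xi> (rest_curve x) = 0" using assms by (intro exit_time_zero) (simp add: rest_curve_def)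
  have "interaction \<Xi> h (rest_curve x) \<omega> = (\<integral>\<^sup>+t. 0 \<partial>(lebesgue :: real measure))" for \<omega>
    unfolding interaction_def
  proof (rule nn_integral_cong_AE)
    show "AE t in lebesgue. ennreal (h t (rest_curve x t) (\<omega> t) (velocity (rest_curve x) t) (velocity \<omega> t)) *
      indicator {t. 0 \<le> t \<and> ennreal t \<le> min (exit_time \<Xi> (rest_curve x)) (exit_time \<Xi> \<omega>)} t = 0"
      using AE_lebesgue_neq[of 0] by eventually_elim (auto simp: indicator_def zero)
  qed
  then show ?thesis by (simp add: mean_interaction_def)
qed

lemma mfg_cost_rest_curve:
  assumes "x \<in> X" "x \<in> \<Xi>" "AE \<omega> in Q. abs_continuous_curve \<omega>"
  shows "F (rest_curve x) = ennreal (\<Psi> 0)"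
proof -
  have "exit_time \<Xi> (rest_curve x) = 0" using assms(2) by (intro exit_time_zero) (simp add: rest_curve_def)
  then show ?thesis
    using mfg_cost_eq[OF rest_curve(1,2)[OF assms(1)] assms(3)] rest_curve(5)[OF assms(1)]
      rest_curve_mean_interaction[OF assms(2)] exit_cost_ennreal[of 0] by simp
qed

section \<open>Optimality on the support\<close>

lemma geodesic_dist_small:
  assumes x: "x \<in> X" and e: "e > 0"
  obtains \<delta> where "\<delta> > 0" "\<And>y. y \<in> X \<Longrightarrow> dist y x < \<delta> \<Longrightarrow> geodesic_dist X y x < e"
proof -
  have "\<exists>\<delta>>0. \<forall>y\<in>X. dist y x < \<delta> \<longrightarrow> geodesic_dist X y x < e"
  proof (rule ccontr)
    assume neg: "\<not> ?thesis"
    have "\<exists>y\<in>X. dist y x < inverse (real (Suc n)) \<and> \<not> geodesic_dist X y x < e" for n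
    proof -
      have "0 < inverse (real (Suc n))" by simp
      then show ?thesis using neg by blast
    qed
    then obtain ys where ys: "\<And>n. ys n \<in> X" "\<And>n. dist (ys n) x < inverse (real (Suc n))"
      "\<And>n. \<not> geodesic_dist X (ys n) x < e" by metis
    have "ys \<longlonglongrightarrow> x"
    proof (rule metric_tendsto_imp_tendsto[OF LIMSEQ_inverse_real_of_nat])
      show "\<forall>\<^sub>F n in sequentially. dist (ys n) x \<le> dist (inverse (real (Suc n))) 0"
      proof (rule always_eventually, rule allI)
        fix n
        show "dist (ys n) x \<le> dist (inverse (real (Suc n))) 0"
          using less_imp_le[OF ys(2)[of n]] by (simp add: dist_real_def)
      qed
    qed
    then have "\<forall>\<^sub>F n in sequentially. geodesic_dist X (ys n) x < e"
      using geodesic[OF x ys(1)] e by (intro order_tendstoD(2)) auto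
    then show False using ys(3) by (auto simp: eventually_sequentially)
  qed
  then show ?thesis using that by blast
qed

text \<open>A neighbourhood of a curve in the support has positive measure, hence is not contained
  in the null set of curves that fail to be optimal.\<close>

lemma optimal_approximation:
  assumes \<gamma>: "\<gamma> \<in> curve_support X Q" and opt: "AE \<omega> in Q. optimal_curve X \<Xi> l h \<Psi> Q \<omega>" and r: "0 < r"
  obtains \<omega> where "\<omega> \<in> curves X" "optimal_curve X \<Xi> l h \<Psi> Q \<omega>" "\<And>t. 0 \<le> t \<Longrightarrow> t \<le> T \<Longrightarrow> dist (\<omega> t) (\<gamma> t) < r"
proof -
  have \<gamma>X: "\<gamma> \<in> curves X" using \<gamma> by (simp add: curve_support_def)
  let ?U = "{\<omega> \<in> curves X. \<forall>t\<in>{0..T}. dist (\<omega> t) (\<gamma> t) < r}"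
  have "openin (curve_topology X) ?U"
    by (rule tube_openin[OF order_refl]) (auto intro: continuous_on_subset[OF curvesD(1)[OF \<gamma>X]])
  moreover have "\<gamma> \<in> ?U" using \<gamma>X r by simp
  ultimately have pos: "emeasure Q ?U > 0" and U: "?U \<in> sets Q"
    using \<gamma> openin_sets_curve_borel sets_Q unfolding curve_support_def by auto
  obtain N where N: "N \<in> null_sets Q" "{\<omega> \<in> space Q. \<not> optimal_curve X \<Xi> l h \<Psi> Q \<omega>} \<subseteq> N"
    using opt unfolding eventually_ae_filter by blast
  have "\<not> ?U \<subseteq> N"
  proof
    assume "?U \<subseteq> N"
    then have "emeasure Q ?U \<le> emeasure Q N" using N(1) by (intro emeasure_mono) auto
    then show False using pos N(1) by auto
  qed
  then obtain \<omega> where \<omega>: "\<omega> \<in> ?U" "\<omega> \<notin> N" by blast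
  show ?thesis
  proof (rule that)
    show "\<omega> \<in> curves X" "\<And>t. 0 \<le> t \<Longrightarrow> t \<le> T \<Longrightarrow> dist (\<omega> t) (\<gamma> t) < r" using \<omega>(1) by auto
    show "optimal_curve X \<Xi> l h \<Psi> Q \<omega>" using \<omega> N(2) by (auto simp: space_Q)
  qed
qed

lemma optimal_curve_le:
  "optimal_curve X \<Xi> l h \<Psi> Q \<gamma> \<Longrightarrow> \<omega> \<in> curves X \<Longrightarrow> \<omega> 0 = \<gamma> 0 \<Longrightarrow> F \<gamma> \<le> F \<omega>"
  unfolding optimal_curve_def by (erule ssubst) (rule INF_lower, simp)

lemma support_curve_optimal:
  assumes \<gamma>: "\<gamma> \<in> curve_support X Q" and opt: "AE \<omega> in Q. optimal_curve X \<Xi> l h \<Psi> Q \<omega>"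
    and AC: "AE \<omega> in Q. abs_continuous_curve \<omega>" and EQ: "(\<integral>\<^sup>+\<gamma>. energy \<theta> \<gamma> \<partial>Q) < \<infinity>"
    and \<omega>: "\<omega> \<in> curves X" "\<omega> 0 = \<gamma> 0"
  shows "F \<gamma> \<le> F \<omega>"
proof -
  let ?L = "\<lambda>k. inverse (real (Suc k))"
  have \<gamma>X: "\<gamma> \<in> curves X" using \<gamma> by (simp add: curve_support_def)
  have x: "\<gamma> 0 \<in> X" using curvesD(2)[OF \<gamma>X] by simp
  \<comment> \<open>The initial points have to be close in the geodesic distance as well, so that
    \<open>?L k\<close> can be both the duration and the length bound of a joining path;
    \<open>geodesic_dist_small\<close> reduces this to closeness in norm.\<close>
  have "\<exists>\<eta>. \<eta> \<in> curves X \<and> optimal_curve X \<Xi> l h \<Psi> Q \<eta> \<and> (\<forall>t\<in>{0..real k}. dist (\<eta> t) (\<gamma> t) < ?L k) \<and>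
      geodesic_dist X (\<eta> 0) (\<gamma> 0) < ennreal (?L k)" for k
  proof -
    have "0 < ennreal (?L k)" by simp
    then obtain \<delta> where \<delta>: "\<delta> > 0" "\<And>y. y \<in> X \<Longrightarrow> dist y (\<gamma> 0) < \<delta> \<Longrightarrow> geodesic_dist X y (\<gamma> 0) < ennreal (?L k)"
      using geodesic_dist_small[OF x] by metis
    have "0 < min \<delta> (?L k)" using \<delta>(1) by simp
    then obtain \<eta> where \<eta>: "\<eta> \<in> curves X" "optimal_curve X \<Xi> l h \<Psi> Q \<eta>"
      "\<And>t. 0 \<le> t \<Longrightarrow> t \<le> real k \<Longrightarrow> dist (\<eta> t) (\<gamma> t) < min \<delta> (?L k)"
      using optimal_approximation[OF \<gamma> opt, of "min \<delta> (?L k)" "real k"] by metis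
    then show ?thesis using \<delta>(2)[of "\<eta> 0"] curvesD(2)[OF \<eta>(1), of 0] \<eta>(3)[of 0] by (intro exI[of _ \<eta>]) auto
  qed
  then obtain \<gamma>s where \<gamma>s: "\<And>k. \<gamma>s k \<in> curves X" "\<And>k. optimal_curve X \<Xi> l h \<Psi> Q (\<gamma>s k)"
    "\<And>k t. 0 \<le> t \<Longrightarrow> t \<le> real k \<Longrightarrow> dist (\<gamma>s k t) (\<gamma> t) < ?L k"
    "\<And>k. geodesic_dist X (\<gamma>s k 0) (\<gamma> 0) < ennreal (?L k)"
    by (metis atLeastAtMost_iff)
  \<comment> \<open>The shift by \<open>m\<close> is there because the energy bound will hold from
    some index on, whereas the lower semicontinuity lemmas want it for every index.\<close>
  have lim: "locally_uniform_limit (\<lambda>n. \<gamma>s (n + m)) \<gamma>" for m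
    unfolding locally_uniform_limit_def
  proof (intro allI impI)
    fix T \<epsilon> :: real assume "0 < \<epsilon>"
    obtain N1 :: nat where N1: "T \<le> real N1" using real_arch_simple by blast
    obtain N2 :: nat where N2: "?L N2 < \<epsilon>" using reals_Archimedean[OF \<open>0 < \<epsilon>\<close>] by blast
    have "dist (\<gamma>s (n + m) t) (\<gamma> t) < \<epsilon>" if "n \<ge> max N1 N2" "t \<in> {0..T}" for n t
    proof -
      have "dist (\<gamma>s (n + m) t) (\<gamma> t) < ?L (n + m)" using that N1 by (intro \<gamma>s(3)) auto
      also have "?L (n + m) \<le> ?L N2" using that by (intro le_imp_inverse_le) auto
      finally show ?thesis using N2 by simp
    qed
    then show "\<forall>\<^sub>F n in sequentially. \<forall>t\<in>{0..T}. dist (\<gamma>s (n + m) t) (\<gamma> t) < \<epsilon>"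
      unfolding eventually_sequentially by blast
  qed
  have detour: "\<exists>\<sigma>. detour_curve X \<sigma> \<eta> (?L k) \<theta> \<and> detour \<sigma> (?L k) \<eta> 0 = \<gamma>s k 0"
    if \<eta>: "\<eta> \<in> curves X" "\<eta> 0 = \<gamma> 0" "abs_continuous_curve \<eta>" "energy \<theta> \<eta> < \<infinity>" for \<eta> k
  proof -
    obtain \<sigma> where \<sigma>: "\<sigma> 0 = \<gamma>s k 0" "\<sigma> (?L k) = \<gamma> 0" "\<And>s. 0 \<le> s \<Longrightarrow> s \<le> ?L k \<Longrightarrow> \<sigma> s \<in> X"
      "\<And>s s'. 0 \<le> s \<Longrightarrow> s \<le> s' \<Longrightarrow> s' \<le> ?L k \<Longrightarrow> norm (\<sigma> s' - \<sigma> s) \<le> s' - s"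
      using geodesic_parametrization[OF \<gamma>s(4)[of k]] by (metis inverse_positive_iff_positive of_nat_0_less_iff zero_less_Suc)
    have "detour_curve X \<sigma> \<eta> (?L k) \<theta>" using \<sigma> \<eta> \<theta> by unfold_locales auto
    then show ?thesis using \<sigma>(1) by (intro exI[of _ \<sigma>]) (simp add: detour_def)
  qed
  show ?thesis
  proof (cases "\<gamma> 0 \<in> \<Xi>")
    case out: False
    show ?thesis
    proof (cases "F \<omega> = \<infinity>")
      case True
      then show ?thesis by simp
    next
      case False
      then have F\<omega>: "F \<omega> < \<infinity>" by (simp add: less_top)
      have ac: "abs_continuous_curve \<omega>" using F\<omega> by (rule mfg_cost_finiteD)
      have "ennreal \<alpha> * energy \<theta> \<omega> \<le> F \<omega>"
        using energy_le_mfg_cost[OF \<omega>(1)] by (rule order_trans[rotated]) simp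
      then have fin: "energy \<theta> \<omega> < \<infinity>"
        using F\<omega> \<alpha> by (auto simp: less_top[symmetric] top_unique ennreal_mult_eq_top_iff)
      let ?R = "\<lambda>k. detour_error (?L k) \<omega>"
      have R: "?R \<longlonglongrightarrow> 0" by (rule detour_error_tendsto_0[OF \<omega>(1) fin EQ])
      have \<tau>: "0 < exit_time \<Xi> \<omega>" using exit_time_pos[OF \<omega>(1) \<Xi>] \<omega>(2) out by simp
      have "(\<lambda>k. ennreal (2 * ?L k)) \<longlonglongrightarrow> ennreal (2 * 0)"
        by (intro tendsto_ennrealI tendsto_intros LIMSEQ_inverse_real_of_nat)
      then have early: "\<forall>\<^sub>F k in sequentially. ennreal (2 * ?L k) < exit_time \<Xi> \<omega>"
        using \<tau> by (intro order_tendstoD(2)) auto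
      have le: "F (\<gamma>s k) \<le> F \<omega> + ?R k" if k: "ennreal (2 * ?L k) < exit_time \<Xi> \<omega>" for k
      proof -
        obtain \<sigma> where \<sigma>: "detour_curve X \<sigma> \<omega> (?L k) \<theta>" "detour \<sigma> (?L k) \<omega> 0 = \<gamma>s k 0"
          using detour[OF \<omega> ac fin] by blast
        interpret detour_curve X \<sigma> \<omega> "?L k" \<theta> by (rule \<sigma>(1))
        have exit: "exit_time \<Xi> \<nu> \<le> exit_time \<Xi> \<omega>" using k by (intro exit_time_detour_le) simp
        have "F (\<gamma>s k) \<le> F \<nu>" by (rule optimal_curve_le[OF \<gamma>s(2) detour_curves \<sigma>(2)])
        also have "\<dots> = (running_cost l \<nu> + mean_interaction \<nu>) + terminal_cost \<nu>"
          unfolding mfg_cost_eq[OF detour_curves detour_abs_continuous AC] by (simp add: ac_simps)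
        also have "\<dots> \<le> (running_cost l \<omega> + mean_interaction \<omega> + ?R k) + terminal_cost \<omega>"
          using exit by (intro add_mono detour_cost_le[OF \<sigma>(1)] exit_cost_mono) (auto intro: order_trans)
        also have "\<dots> = F \<omega> + ?R k"
          unfolding mfg_cost_eq[OF \<omega>(1) ac AC] by (simp add: ac_simps)
        finally show ?thesis .
      qed
      have "\<forall>\<^sub>F k in sequentially. ?R k < 1" using R by (intro order_tendstoD(2)) auto
      with early have "\<forall>\<^sub>F k in sequentially. ennreal (2 * ?L k) < exit_time \<Xi> \<omega> \<and> ?R k < 1" by eventually_elim simp
      \<comment> \<open>An error below \<open>1\<close> bounds the costs of the remaining
        \<open>\<gamma>s k\<close> in common, and thereby their energies.\<close>
      then obtain m where m: "\<And>k. k \<ge> m \<Longrightarrow> ennreal (2 * ?L k) < exit_time \<Xi> \<omega> \<and> ?R k < 1"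
        by (auto simp: eventually_sequentially)
      obtain B where B: "F \<omega> = ennreal B" "0 \<le> B" using F\<omega> by (cases "F \<omega>") auto
      have bound: "F (\<gamma>s (n + m)) \<le> ennreal (B + 1)" for n
      proof -
        have "F (\<gamma>s (n + m)) \<le> F \<omega> + ?R (n + m)" using m[of "n + m"] by (intro le) simp
        also have "\<dots> \<le> ennreal B + 1" using m[of "n + m"] B by (intro add_mono) auto
        also have "\<dots> = ennreal (B + 1)" using B(2) by simp
        finally show ?thesis .
      qed
      have "F \<gamma> \<le> liminf (\<lambda>n. F (\<gamma>s (n + m)))"
      proof (rule mfg_cost_lsc[OF \<gamma>X \<gamma>s(1) _ _ _ lim AC])
        show "abs_continuous_curve (\<gamma>s (n + m))" for n
          using bound[of n] by (intro mfg_cost_finiteD) (auto intro: le_less_trans)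
        show "energy \<theta> (\<gamma>s (n + m)) \<le> ennreal ((B + 1) / \<alpha>)" for n
          using B(2) by (intro energy_bound[OF \<gamma>s(1) bound]) simp
        show "0 \<le> (B + 1) / \<alpha>" using B(2) \<alpha> by simp
      qed
      also have "\<dots> \<le> liminf (\<lambda>n. F \<omega> + ?R (n + m))"
      proof (rule Liminf_mono, rule always_eventually, rule allI)
        fix n
        have "ennreal (2 * ?L (n + m)) < exit_time \<Xi> \<omega>" using m[of "n + m"] by simp
        then show "F (\<gamma>s (n + m)) \<le> F \<omega> + ?R (n + m)" by (rule le)
      qed
      also have "\<dots> = F \<omega>"
      proof (rule lim_imp_Liminf)
        have "(\<lambda>n. F \<omega> + ?R (n + m)) \<longlonglongrightarrow> F \<omega> + 0"
          by (intro tendsto_add tendsto_const LIMSEQ_ignore_initial_segment R)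
        then show "(\<lambda>n. F \<omega> + ?R (n + m)) \<longlonglongrightarrow> F \<omega>" by simp
      qed simp
      finally show ?thesis .
    qed
  next
    case True
    \<comment> \<open>The detour that ends at rest in \<open>\<gamma> 0\<close> meets
      \<open>\<Xi>\<close> at time \<open>?L k\<close> at the latest, so its terminal cost is at
      most \<open>\<Psi> (?L k)\<close>.\<close>
    let ?c = "rest_curve (\<gamma> 0)"
    note c = rest_curve[OF x]
    have c0: "?c 0 = \<gamma> 0" by (simp add: rest_curve_def)
    let ?R = "\<lambda>k. detour_error (?L k) ?c"
    have fin: "energy \<theta> ?c < \<infinity>" by (simp add: c(4))
    have R: "?R \<longlonglongrightarrow> 0" by (rule detour_error_tendsto_0[OF c(1) fin EQ])
    have le: "F (\<gamma>s k) \<le> ?R k + ennreal (\<Psi> (?L k))" for k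
    proof -
      obtain \<sigma> where \<sigma>: "detour_curve X \<sigma> ?c (?L k) \<theta>" "detour \<sigma> (?L k) ?c 0 = \<gamma>s k 0"
        using detour[OF c(1) c0 c(2) fin] by blast
      interpret detour_curve X \<sigma> ?c "?L k" \<theta> by (rule \<sigma>(1))
      have "\<nu> (?L k) = \<gamma> 0" using detour_eq(1)[of "?L k"] joint c0 by simp
      then have exit: "exit_time \<Xi> \<nu> \<le> ennreal (?L k)" using True by (intro exit_time_le) auto
      \<comment> \<open>This holds vacuously, the detour having exited by time
        \<open>?L k\<close>.\<close>
      have no_horizon: "ennreal t \<le> exit_time \<Xi> ?c" if "2 * ?L k < t" "ennreal t \<le> exit_time \<Xi> \<nu>" for t
      proof -
        have "ennreal t \<le> ennreal (?L k)" using that(2) exit by (rule order_trans)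
        then have "t \<le> ?L k" by simp
        then show ?thesis using that(1) L by linarith
      qed
      have "F (\<gamma>s k) \<le> F \<nu>" by (rule optimal_curve_le[OF \<gamma>s(2) detour_curves \<sigma>(2)])
      also have "\<dots> = (running_cost l \<nu> + mean_interaction \<nu>) + terminal_cost \<nu>"
        unfolding mfg_cost_eq[OF detour_curves detour_abs_continuous AC] by (simp add: ac_simps)
      also have "\<dots> \<le> (running_cost l ?c + mean_interaction ?c + ?R k) + exit_cost \<Psi> (ennreal (?L k))"
        by (intro add_mono detour_cost_le[OF \<sigma>(1) no_horizon] exit_cost_mono exit)
      also have "\<dots> = ?R k + ennreal (\<Psi> (?L k))"
        using rest_curve_mean_interaction[OF True] c(5) by (simp add: exit_cost_ennreal)
      finally show ?thesis .
    qed
    \<comment> \<open>The right limit of \<open>\<Psi>\<close> at \<open>0\<close>, which may exceed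
      \<open>\<Psi> 0\<close>. No curve that starts outside \<open>\<Xi>\<close> has a smaller
      terminal cost.\<close>
    define p where "p = Inf (\<Psi> ` {0<..})"
    have nonneg: "0 \<le> y" if y: "y \<in> \<Psi> ` {0<..}" for y
    proof -
      obtain t where "y = \<Psi> t" "0 < t" using y by blast
      then show ?thesis using \<Psi>_nonneg[of t] by simp
    qed
    have bdd: "bdd_below (\<Psi> ` {0<..})" using nonneg by (rule bdd_belowI)
    have p_le: "p \<le> \<Psi> t" if "0 < t" for t unfolding p_def by (rule cInf_lower[OF imageI bdd]) (simp add: that)
    have p0: "0 \<le> p" unfolding p_def by (rule cInf_greatest[OF _ nonneg]) auto
    have \<Psi>L: "(\<lambda>k. \<Psi> (?L k)) \<longlonglongrightarrow> p"
    proof (rule order_tendstoI)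
      fix y assume "y < p"
      then show "\<forall>\<^sub>F k in sequentially. y < \<Psi> (?L k)"
        by (intro always_eventually allI) (rule less_le_trans[OF _ p_le], simp_all)
    next
      fix y assume "p < y"
      then obtain t where t: "0 < t" "\<Psi> t < y"
        unfolding p_def using cInf_lessD[of "\<Psi> ` {0<..}" y] by auto
      have "\<forall>\<^sub>F k in sequentially. ?L k < t"
        using t(1) by (intro order_tendstoD(2)[OF LIMSEQ_inverse_real_of_nat])
      then show "\<forall>\<^sub>F k in sequentially. \<Psi> (?L k) < y"
      proof eventually_elim
        case (elim k)
        have "\<Psi> (?L k) \<le> \<Psi> t" using elim t(1) by (intro mono_onD[OF \<Psi>_mono]) auto
        then show ?case using t(2) by simp
      qed
    qed
    let ?\<epsilon> = "\<lambda>k. ?R k + ennreal (\<Psi> (?L k) - p)"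
    have \<epsilon>: "?\<epsilon> \<longlonglongrightarrow> 0"
    proof -
      have "?\<epsilon> \<longlonglongrightarrow> 0 + ennreal (p - p)" by (intro tendsto_add R tendsto_ennrealI tendsto_diff \<Psi>L tendsto_const)
      then show ?thesis by simp
    qed
    \<comment> \<open>The upper and the lower bound for the cost of \<open>\<gamma>s k\<close> share
      a terminal part: \<open>\<Psi> 0\<close> if it starts in \<open>\<Xi>\<close>, where resting
      is a competitor, and \<open>p\<close> otherwise. Cancelling it bounds the energy by a
      vanishing quantity.\<close>
    have small: "ennreal \<alpha> * energy \<theta> (\<gamma>s k) \<le> ?\<epsilon> k" for k
    proof -
      have low: "ennreal \<alpha> * energy \<theta> (\<gamma>s k) + terminal_cost (\<gamma>s k) \<le> F (\<gamma>s k)"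
        by (rule energy_le_mfg_cost[OF \<gamma>s(1)])
      show ?thesis
      proof (cases "\<gamma>s k 0 \<in> \<Xi>")
        case start: True
        have yX: "\<gamma>s k 0 \<in> X" using curvesD(2)[OF \<gamma>s(1)] by simp
        have "F (\<gamma>s k) \<le> F (rest_curve (\<gamma>s k 0))"
          by (rule optimal_curve_le[OF \<gamma>s(2) rest_curve(1)[OF yX]]) (simp add: rest_curve_def)
        also have "\<dots> = ennreal (\<Psi> 0)" by (rule mfg_cost_rest_curve[OF yX start AC])
        finally have upper: "F (\<gamma>s k) \<le> ennreal (\<Psi> 0)" .
        have "terminal_cost (\<gamma>s k) = ennreal (\<Psi> 0)"
          using exit_time_zero[of "\<gamma>s k" \<Xi>] start exit_cost_ennreal[of 0] by simp
        then have "ennreal \<alpha> * energy \<theta> (\<gamma>s k) + ennreal (\<Psi> 0) \<le> 0 + ennreal (\<Psi> 0)"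
          using order_trans[OF low upper] by (simp only: add_0)
        then have "ennreal \<alpha> * energy \<theta> (\<gamma>s k) \<le> 0" by (rule ennreal_add_right_cancel_le)
        then show ?thesis by (rule order_trans) simp
      next
        case False
        have \<tau>: "0 < exit_time \<Xi> (\<gamma>s k)" using exit_time_pos[OF \<gamma>s(1) \<Xi> False] .
        have "ennreal p \<le> terminal_cost (\<gamma>s k)"
        proof (cases "exit_time \<Xi> (\<gamma>s k)")
          case (real r)
          then show ?thesis using \<tau> p_le[of r] by (simp add: exit_cost_ennreal ennreal_leI)
        qed (simp add: exit_cost_def)
        then have "ennreal \<alpha> * energy \<theta> (\<gamma>s k) + ennreal p \<le> ?R k + ennreal (\<Psi> (?L k))"
          using low le[of k] by (meson add_left_mono order_trans)
        also have "ennreal (\<Psi> (?L k)) = ennreal (\<Psi> (?L k) - p) + ennreal p"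
          using p0 p_le[of "?L k"] by (subst ennreal_plus[symmetric]) auto
        finally have "ennreal \<alpha> * energy \<theta> (\<gamma>s k) + ennreal p \<le> ?\<epsilon> k + ennreal p" by (simp add: add.assoc)
        then show ?thesis by (rule ennreal_add_right_cancel_le)
      qed
    qed
    have rest: "\<gamma> t = \<gamma> 0" if t: "0 \<le> t" for t
    proof -
      \<comment> \<open>An energy of at most \<open>\<kappa> powr \<theta>\<close> makes the last
        term of \<open>curve_increment\<close> equal to \<open>\<kappa>\<close>; for large
        \<open>k\<close> the energy of \<open>\<gamma>s k\<close> is that small.\<close>
      have "norm (\<gamma> t - \<gamma> 0) \<le> \<kappa> * t + \<kappa>" if \<kappa>: "\<kappa> > 0" for \<kappa>
      proof -
        have "0 < ennreal (\<alpha> * \<kappa> powr \<theta>)" using \<alpha> \<kappa> by simp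
        then have ev: "\<forall>\<^sub>F k in sequentially. ?\<epsilon> k < ennreal (\<alpha> * \<kappa> powr \<theta>)"
          by (rule order_tendstoD(2)[OF \<epsilon>])
        have "\<forall>\<^sub>F k in sequentially. norm (\<gamma>s k t - \<gamma>s k 0) \<le> \<kappa> * t + \<kappa>"
          using ev
        proof eventually_elim
          case (elim k)
          have "?R k < \<infinity>" using elim by (auto simp: less_top[symmetric] top_unique)
          then have "F (\<gamma>s k) < \<infinity>" using le[of k] by (auto intro: le_less_trans)
          then have ac: "abs_continuous_curve (\<gamma>s k)" by (rule mfg_cost_finiteD)
          have "ennreal \<alpha> * energy \<theta> (\<gamma>s k) \<le> ennreal (\<alpha> * \<kappa> powr \<theta>)" using small[of k] elim by simp
          then have "ennreal (1 / \<alpha>) * (ennreal \<alpha> * energy \<theta> (\<gamma>s k)) \<le> ennreal (1 / \<alpha>) * ennreal (\<alpha> * \<kappa> powr \<theta>)"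
            by (rule mult_left_mono) simp
          then have "energy \<theta> (\<gamma>s k) \<le> ennreal (\<kappa> powr \<theta>)"
            using \<alpha> by (simp add: mult.assoc[symmetric] ennreal_mult[symmetric])
          then have "norm (\<gamma>s k t - \<gamma>s k 0) \<le> \<kappa> * (t - 0) + \<kappa> powr (1 - \<theta>) * \<kappa> powr \<theta>"
            using \<theta> t \<kappa> by (intro curve_increment[OF \<gamma>s(1) ac]) auto
          also have "\<kappa> powr (1 - \<theta>) * \<kappa> powr \<theta> = \<kappa>" using \<kappa> by (simp add: powr_add[symmetric])
          finally show ?case by simp
        qed
        moreover have "(\<lambda>k. norm (\<gamma>s k t - \<gamma>s k 0)) \<longlonglongrightarrow> norm (\<gamma> t - \<gamma> 0)"
          using locally_uniform_limit_pointwise[OF lim[of 0]] t by (intro tendsto_norm tendsto_diff) simp_all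
        ultimately show ?thesis by (intro tendsto_upperbound) auto
      qed
      note bound = this
      have "norm (\<gamma> t - \<gamma> 0) \<le> 0 + e" if "0 < e" for e
      proof -
        have "e / (t + 1) > 0" using that t by simp
        from bound[OF this] have "norm (\<gamma> t - \<gamma> 0) \<le> e / (t + 1) * (t + 1)" by (simp add: distrib_left)
        then show ?thesis using t by simp
      qed
      then have "norm (\<gamma> t - \<gamma> 0) \<le> 0" by (rule field_le_epsilon)
      then show ?thesis by simp
    qed
    have "\<gamma> = ?c"
    proof
      fix t show "\<gamma> t = ?c t" using rest[of t] curvesD(3)[OF \<gamma>X, of t] by (auto simp: rest_curve_def)
    qed
    \<comment> \<open>Every competitor starts in \<open>\<Xi>\<close> as well and pays at least the
      terminal cost \<open>\<Psi> 0\<close>, which is all that the curve at rest pays.\<close>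
    then have "F \<gamma> = ennreal (\<Psi> 0)" using mfg_cost_rest_curve[OF x True AC] by simp
    also have "\<dots> = terminal_cost \<omega>" using exit_time_zero[of \<omega> \<Xi>] \<omega>(2) True exit_cost_ennreal[of 0] by simp
    also have "\<dots> \<le> F \<omega>" using energy_le_mfg_cost[OF \<omega>(1)] by (rule order_trans[rotated]) simp
    finally show ?thesis .
  qed
qed

theorem equilibrium_iff_strong_equilibrium:
  "mfg_equilibrium X \<Xi> l h \<Psi> m0 Q \<longleftrightarrow> mfg_strong_equilibrium X \<Xi> l h \<Psi> m0 Q"
proof
  assume "mfg_strong_equilibrium X \<Xi> l h \<Psi> m0 Q"
  moreover from this have "AE \<gamma> in Q. optimal_curve X \<Xi> l h \<Psi> Q \<gamma>"
    using AE_curve_support[OF sets_Q] by (auto simp: mfg_strong_equilibrium_def elim: eventually_mono)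
  ultimately show "mfg_equilibrium X \<Xi> l h \<Psi> m0 Q"
    by (simp add: mfg_strong_equilibrium_def mfg_equilibrium_def)
next
  assume eq: "mfg_equilibrium X \<Xi> l h \<Psi> m0 Q"
  interpret prob_space Q by (rule prob_Q)
  have fin: "(\<integral>\<^sup>+\<gamma>. F \<gamma> \<partial>Q) < \<infinity>" and opt: "AE \<omega> in Q. optimal_curve X \<Xi> l h \<Psi> Q \<omega>"
    using eq by (auto simp: mfg_equilibrium_def)
  \<comment> \<open>Otherwise every curve would have infinite cost by convention, contrary to the
    finite mean cost.\<close>
  have AC: "AE \<omega> in Q. abs_continuous_curve \<omega>"
  proof (rule ccontr)
    assume "\<not> (AE \<omega> in Q. abs_continuous_curve \<omega>)"
    then have "F \<gamma> = \<infinity>" for \<gamma> by (simp add: mfg_cost_def)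
    then show False using fin by (simp add: emeasure_space_1)
  qed
  \<comment> \<open>The lower growth bound of \<open>l\<close> turns finite mean cost into finite
    mean energy, the dominating quantity in \<open>detour_error_tendsto_0\<close>.\<close>
  have EQ: "(\<integral>\<^sup>+\<gamma>. energy \<theta> \<gamma> \<partial>Q) < \<infinity>"
  proof -
    have meas: "energy \<theta> \<in> borel_measurable Q"
      using energy_on_measurable[of "{0..}" \<theta> X] unfolding energy_def[abs_def] by (intro measurable_Q) auto
    have "ennreal \<alpha> * (\<integral>\<^sup>+\<gamma>. energy \<theta> \<gamma> \<partial>Q) = (\<integral>\<^sup>+\<gamma>. ennreal \<alpha> * energy \<theta> \<gamma> \<partial>Q)"
      using meas by (rule nn_integral_cmult[symmetric])
    also have "\<dots> \<le> (\<integral>\<^sup>+\<gamma>. F \<gamma> \<partial>Q)"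
    proof (rule nn_integral_mono)
      fix \<gamma> assume "\<gamma> \<in> space Q"
      then show "ennreal \<alpha> * energy \<theta> \<gamma> \<le> F \<gamma>"
        using energy_le_mfg_cost[of \<gamma>] by (intro order_trans[OF _ energy_le_mfg_cost]) (auto simp: space_Q)
    qed
    finally show ?thesis using fin \<alpha> by (auto simp: less_top[symmetric] top_unique ennreal_mult_eq_top_iff)
  qed
  have "optimal_curve X \<Xi> l h \<Psi> Q \<gamma>" if \<gamma>: "\<gamma> \<in> curve_support X Q" for \<gamma>
    unfolding optimal_curve_def
  proof (rule antisym)
    show "F \<gamma> \<le> (INF \<omega>\<in>{\<omega> \<in> curves X. \<omega> 0 = \<gamma> 0}. F \<omega>)"
      using support_curve_optimal[OF \<gamma> opt AC EQ] by (intro INF_greatest) auto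
    show "(INF \<omega>\<in>{\<omega> \<in> curves X. \<omega> 0 = \<gamma> 0}. F \<omega>) \<le> F \<gamma>"
      using \<gamma> by (intro INF_lower) (simp add: curve_support_def)
  qed
  then show "mfg_strong_equilibrium X \<Xi> l h \<Psi> m0 Q"
    using eq by (simp add: mfg_equilibrium_def mfg_strong_equilibrium_def)
qed

end

theorem theorem4p12:
  fixes \<Omega> \<Xi> :: "'a::euclidean_space set"
    and l :: "real \<Rightarrow> 'a \<Rightarrow> 'a \<Rightarrow> real"
    and h :: "real \<Rightarrow> 'a \<Rightarrow> 'a \<Rightarrow> 'a \<Rightarrow> 'a \<Rightarrow> real"
    and \<Psi> :: "real \<Rightarrow> real"
    and \<alpha> \<theta> C \<beta> a b \<kappa> \<alpha>' :: real
    and m0 :: "'a measure"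
    and Q :: "(real \<Rightarrow> 'a) measure"
  assumes \<Omega>: "\<Omega> \<noteq> {}" "open \<Omega>" "bounded \<Omega>"
    and \<Xi>: "\<Xi> \<subseteq> closure \<Omega>" "\<Xi> \<noteq> {}" "closed \<Xi>"
    and l_nonneg: "\<And>t x p. t \<ge> 0 \<Longrightarrow> x \<in> closure \<Omega> \<Longrightarrow> l t x p \<ge> 0"
    and l_measurable: "\<And>x p. x \<in> closure \<Omega> \<Longrightarrow> (\<lambda>t. l t x p) \<in> borel_measurable (lebesgue_on {0..})"
    and l_continuous: "AE t in lebesgue_on {0..}. continuous_on (closure \<Omega> \<times> UNIV) (\<lambda>(x, p). l t x p)"
    and l_convex: "AE t in lebesgue_on {0..}. \<forall>x\<in>closure \<Omega>. convex_on UNIV (\<lambda>p. l t x p)"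
    and \<alpha>: "\<alpha> > 0" and \<theta>: "\<theta> > 1"
    and l_lower: "\<And>t x p. t \<ge> 0 \<Longrightarrow> x \<in> closure \<Omega> \<Longrightarrow> l t x p \<ge> \<alpha> * norm p powr \<theta>"
    and h_nonneg: "\<And>t x y p q. t \<ge> 0 \<Longrightarrow> x \<in> closure \<Omega> \<Longrightarrow> y \<in> closure \<Omega> \<Longrightarrow> h t x y p q \<ge> 0"
    and h_measurable: "\<And>x y p q. x \<in> closure \<Omega> \<Longrightarrow> y \<in> closure \<Omega> \<Longrightarrow>
          (\<lambda>t. h t x y p q) \<in> borel_measurable (lebesgue_on {0..})"
    and h_continuous: "AE t in lebesgue_on {0..}.
          continuous_on (closure \<Omega> \<times> closure \<Omega> \<times> UNIV \<times> UNIV) (\<lambda>(x, y, p, q). h t x y p q)"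
    and h_convex: "AE t in lebesgue_on {0..}. \<forall>x\<in>closure \<Omega>. \<forall>y\<in>closure \<Omega>.
          convex_on UNIV (\<lambda>(p, q). h t x y p q)"
    and h_symmetric: "\<And>t x y p q. t \<ge> 0 \<Longrightarrow> x \<in> closure \<Omega> \<Longrightarrow> y \<in> closure \<Omega> \<Longrightarrow>
          h t x y p q = h t y x q p"
    and C: "C > 0" and \<beta>: "0 < \<beta>" "\<beta> \<le> \<theta>"
    and h_upper: "\<And>t x y p q. t \<ge> 0 \<Longrightarrow> x \<in> closure \<Omega> \<Longrightarrow> y \<in> closure \<Omega> \<Longrightarrow>
          h t x y p q \<le> C * (norm p powr \<beta> + norm q powr \<beta>)"
    and \<Psi>_nonneg: "\<And>t. t \<ge> 0 \<Longrightarrow> \<Psi> t \<ge> 0"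
    and \<Psi>_lsc: "lower_semicontinuous_on {0..} \<Psi>"
    and \<Psi>_mono: "mono_on {0..} \<Psi>"
    and ab: "a > 0" "b > 0"
    and \<Psi>_lower: "\<And>t. t \<ge> 0 \<Longrightarrow> \<Psi> t \<ge> a * t - b"
    and \<kappa>: "\<kappa> > 0"
    and finite_cost: "\<And>x0. x0 \<in> closure \<Omega> \<Longrightarrow>
          \<exists>\<gamma>\<in>curves (closure \<Omega>). abs_continuous_curve \<gamma> \<and> \<gamma> 0 = x0 \<and>
            running_cost l \<gamma> + exit_cost \<Psi> (exit_time \<Xi> \<gamma>) \<le> ennreal \<kappa>"
    and geodesic: "\<And>x xs. x \<in> closure \<Omega> \<Longrightarrow> (\<And>n::nat. xs n \<in> closure \<Omega>) \<Longrightarrow> xs \<longlonglongrightarrow> x \<Longrightarrow>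
          (\<lambda>n. geodesic_dist (closure \<Omega>) (xs n) x) \<longlonglongrightarrow> 0"
    and \<alpha>': "\<alpha>' > 0"
    and l_upper: "\<And>t x p. t \<ge> 0 \<Longrightarrow> x \<in> closure \<Omega> \<Longrightarrow> l t x p \<le> \<alpha>' * norm p powr \<theta>"
    and m0: "m0 \<in> space (prob_algebra (restrict_space borel (closure \<Omega>)))"
    and Q: "Q \<in> space (prob_algebra (curve_borel (closure \<Omega>)))"
  shows "mfg_equilibrium (closure \<Omega>) \<Xi> l h \<Psi> m0 Q \<longleftrightarrow>
         mfg_strong_equilibrium (closure \<Omega>) \<Xi> l h \<Psi> m0 Q"
proof -
  interpret mean_field_game "closure \<Omega>" \<Xi> l h \<Psi> \<alpha> \<theta> C \<beta> a b \<alpha>' Q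
  proof
    show "compact (closure \<Omega>)" using \<Omega>(3) by (simp add: compact_closure)
  qed fact+
  show ?thesis by (rule equilibrium_iff_strong_equilibrium)
qed

end
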